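(* Let $c,h,\alpha,\beta\in\mathbb{C}$ with $0\le \mathfrak{Re}\,\alpha<1$ and $\beta\neq 1$. Let $Q_1,Q_2\in U(\mathrm{Vir}_-)$ be the homogeneous elements associated with the maximal submodule $J(c,h)$ of the Verma module $M(c,h)$, let $\phi_n:U(\mathrm{Vir}_-)\to\mathbb{C}$ ($n\in\mathbb{Z}$) be the linear maps attached to $(\alpha,\beta)$, and let $W^{(n)}$ be the submodule of $V(c,h)\otimes V'_{\alpha,\beta}$ generated by $u\otimes v_i$, $i>n$ (all as defined in the context). (a) The $\mathrm{Vir}$-module $V(c,h)\otimes V'_{\alpha,\beta}$ is simple if and only if there is no integer $n$ (no nonzero integer $n$, if $(\alpha,\beta)=(0,0)$) such that $\phi_n(Q_1)=\phi_n(Q_2)=0$. (b) If $n$ is the maximal integer (the maximal nonzero integer, if $(\alpha,\beta)=(0,0)$) with $\phi_n(Q_1)=\phi_n(Q_2)=0$, then $W^{(n)}$ is the unique simple submodule of $V(c,h)\otimes V'_{\alpha,\beta}$, and all nonzero weight spaces of $W^{(n)}$ are infinite-dimensional.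
   Context: The Virasoro algebra $\mathrm{Vir}$ is the complex Lie algebra with basis $\{d_n, C : n\in\mathbb{Z}\}$ and brackets $[d_m,d_n]=(n-m)d_{m+n}+\delta_{n,-m}\frac{m^3-m}{12}C$, $[C,d_m]=0$. Put $\mathrm{Vir}_{\pm}=\sum_{i\in\mathbb{N}}\mathbb{C}d_{\pm i}$, where $\mathbb{N}=\{1,2,\dots\}$. An element $x$ of $U(\mathrm{Vir})$ is homogeneous of degree $m=\deg(x)$ if $[d_0,x]=mx$. The weight spaces of a module $V$ are $V_\lambda=\{v\in V: d_0v=\lambda v\}$, $\lambda\in\mathbb{C}$. Verma modules: for $c,h\in\mathbb{C}$ let $\mathbb{C}u$ be the one-dimensional module over $\mathrm{Vir}_+\oplus\mathbb{C}d_0\oplus\mathbb{C}C$ with $\mathrm{Vir}_+u=0$, $d_0u=hu$, $Cu=cu$, and $M(c,h)=U(\mathrm{Vir})\otimes_{U(\mathrm{Vir}_+\oplus\mathbb{C}d_0\oplus\mathbb{C}C)}\mathbb{C}u$. Let $J(c,h)$ be its unique maximal (proper) submodule and $V(c,h)=M(c,h)/J(c,h)$; the image of $u$ in $V(c,h)$ is again denoted $u$. A singular vector of $M(c,h)$ is a nonzero weight vector killed by $\mathrm{Vir}_+$. The elements $Q_1,Q_2$: it is known (Feigin–Fuchs) that $J(c,h)$ is generated by at most two singular vectors. If $J(c,h)=0$, set $Q_1=Q_2=0$. If $J(c,h)$ is nonzero and can be generated by one singular vector, let $Q_1\in U(\mathrm{Vir}_-)$ be the homogeneous element, unique up to a nonzero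 scalar, with $J(c,h)=U(\mathrm{Vir}_-)Q_1u$, and set $Q_2=Q_1$. Otherwise (two singular vectors are needed) $Q_1,Q_2\in U(\mathrm{Vir}_-)$ are homogeneous elements with $J(c,h)=U(\mathrm{Vir}_-)Q_1u+U(\mathrm{Vir}_-)Q_2u$. Intermediate series modules: $V_{\alpha,\beta}=\bigoplus_{n\in\mathbb{Z}}\mathbb{C}v_n$ with $d_m v_n=(\alpha+n+m\beta)v_{m+n}$ and $Cv_n=0$. When $0\le\mathfrak{Re}\,\alpha<1$ and $\beta\ne1$, $V_{\alpha,\beta}$ is simple unless $(\alpha,\beta)=(0,0)$, in which case $\mathbb{C}v_0$ is its unique nonzero proper submodule. Set $V'_{0,0}=V_{0,0}/\mathbb{C}v_0$ and $V'_{\alpha,\beta}=V_{\alpha,\beta}$ otherwise; the images of the $v_n$ in $V'_{\alpha,\beta}$ are again denoted $v_n$ (so $v_0=0$ in $V'_{0,0}$). The maps $\phi_n$: for $n\in\mathbb{Z}$, $\phi_n:U(\mathrm{Vir}_-)\to\mathbb{C}$ is the (well-defined) linear map with $\phi_n(1)=1$ and $$\phi_n(d_{-k_r}\cdots d_{-k_1})=\prod_{j=1}^r\Big(k_j\beta-\alpha-n-\sum_{i=1}^j k_i\Big)$$ for all $r\ge1$ and $k_1,\dots,k_r\in\mathbb{N}$. For $n\in\mathbb{Z}$, $W^{(n)}$ is the $\mathrm{Vir}$-submodule of $V(c,h)\otimes V'_{\alpha,\beta}$ generated by all $u\otimes v_i$ with $i>n$. *)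

theory Defs
  imports "HOL-Library.Poly_Mapping" "HOL-Algebra.Algebraic_Closure_Type"
begin

section \<open>The Virasoro algebra and its universal enveloping algebra\<close>

datatype vir_gen = Dgen int | Cgen

fun vir_bracket :: "vir_gen \<Rightarrow> vir_gen \<Rightarrow> (vir_gen \<Rightarrow>\<^sub>0 complex)" where
  "vir_bracket (Dgen m) (Dgen n) =
     Poly_Mapping.single (Dgen (m + n)) (of_int (n - m)) +
     Poly_Mapping.single Cgen (if n = - m then of_int (m ^ 3 - m) / 12 else 0)"
| "vir_bracket Cgen _ = 0"
| "vir_bracket _ Cgen = 0"

text \<open>
  Words in the basis of the Virasoro algebra form the free monoid, so that, with the
  convolution product of \<^theory>\<open>HOL-Library.Poly_Mapping\<close>, finitely supported functions on
  words form the free (tensor) algebra on that basis.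
\<close>

datatype vir_word = Word (letters: "vir_gen list")

instantiation vir_word :: monoid_add
begin
definition "0 = Word []"
definition "v + w = Word (letters v @ letters w)"
instance by standard (auto simp: zero_vir_word_def plus_vir_word_def)
end

type_synonym vir_tensor = "vir_word \<Rightarrow>\<^sub>0 complex"

definition tgen :: "vir_gen \<Rightarrow> vir_tensor" where
  "tgen g = Poly_Mapping.single (Word [g]) 1"

definition tlin :: "(vir_gen \<Rightarrow>\<^sub>0 complex) \<Rightarrow> vir_tensor" where
  "tlin x = (\<Sum>g\<in>Poly_Mapping.keys x. Poly_Mapping.single (Word [g]) (Poly_Mapping.lookup x g))"

definition U_relator :: "vir_gen \<Rightarrow> vir_gen \<Rightarrow> vir_tensor" where
  "U_relator g h = tgen g * tgen h - tgen h * tgen g - tlin (vir_bracket g h)"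

inductive_set U_ideal :: "vir_tensor set" where
  zero: "0 \<in> U_ideal"
| relator: "a * U_relator g h * b \<in> U_ideal"
| add: "p \<in> U_ideal \<Longrightarrow> q \<in> U_ideal \<Longrightarrow> p + q \<in> U_ideal"

lemma U_ideal_mult: "p \<in> U_ideal \<Longrightarrow> a * p * b \<in> U_ideal"
proof (induction rule: U_ideal.induct)
  case (relator a' g h b')
  have "a * (a' * U_relator g h * b') * b = (a * a') * U_relator g h * (b' * b)"
    by (simp add: mult.assoc)
  then show ?case by (simp add: U_ideal.relator)
qed (auto simp: algebra_simps intro: U_ideal.intros)

lemma U_ideal_multL: "p \<in> U_ideal \<Longrightarrow> a * p \<in> U_ideal"
  using U_ideal_mult[of p a 1] by simp

lemma U_ideal_multR: "p \<in> U_ideal \<Longrightarrow> p * b \<in> U_ideal"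
  using U_ideal_mult[of p 1 b] by simp

lemma U_ideal_uminus: "p \<in> U_ideal \<Longrightarrow> - p \<in> U_ideal"
  using U_ideal_multL[of p "-1"] by simp

definition U_eq :: "vir_tensor \<Rightarrow> vir_tensor \<Rightarrow> bool" where
  "U_eq p q \<longleftrightarrow> p - q \<in> U_ideal"

lemma U_eq_equivp: "equivp U_eq"
proof (rule equivpI)
  show "reflp U_eq" by (auto simp: reflp_def U_eq_def U_ideal.zero)
  show "symp U_eq"
    by (auto simp: symp_def U_eq_def dest: U_ideal_uminus)
  show "transp U_eq"
  proof (rule transpI)
    fix p q r assume "U_eq p q" "U_eq q r"
    then show "U_eq p r"
      using U_ideal.add[of "p - q" "q - r"] by (simp add: U_eq_def)
  qed
qed

quotient_type Uvir = vir_tensor / U_eq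
  by (rule U_eq_equivp)

lift_definition Ugen :: "vir_gen \<Rightarrow> Uvir" is tgen .

lift_definition U_scale :: "complex \<Rightarrow> Uvir \<Rightarrow> Uvir" is "\<lambda>c. Poly_Mapping.map ((*) c)"
  by (auto simp: U_eq_def mult_map_scale_conv_mult simp flip: right_diff_distrib
           intro: U_ideal_multL)

instantiation Uvir :: "{ring, monoid_mult}"
begin
lift_definition zero_Uvir :: Uvir is 0 .
lift_definition one_Uvir :: Uvir is 1 .
lift_definition plus_Uvir :: "Uvir \<Rightarrow> Uvir \<Rightarrow> Uvir" is "(+)"
  by (simp add: U_eq_def add_diff_add U_ideal.add)
lift_definition minus_Uvir :: "Uvir \<Rightarrow> Uvir \<Rightarrow> Uvir" is "(-)"
proof -
  fix p p' q q' assume "U_eq p p'" "U_eq q q'"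
  then show "U_eq (p - q) (p' - q')"
    using U_ideal.add[of "p - p'" "- (q - q')"] U_ideal_uminus[of "q - q'"]
    by (simp add: U_eq_def algebra_simps)
qed
lift_definition uminus_Uvir :: "Uvir \<Rightarrow> Uvir" is uminus
  by (auto simp: U_eq_def dest: U_ideal_uminus)
lift_definition times_Uvir :: "Uvir \<Rightarrow> Uvir \<Rightarrow> Uvir" is "(*)"
proof -
  fix p p' q q' assume "U_eq p p'" "U_eq q q'"
  moreover have "p * q - p' * q' = (p - p') * q + p' * (q - q')"
    by (simp add: algebra_simps)
  ultimately show "U_eq (p * q) (p' * q')"
    by (auto simp: U_eq_def intro: U_ideal.add U_ideal_multL U_ideal_multR)
qed
instance
  by standard (transfer; simp add: U_eq_def algebra_simps U_ideal.zero)+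
end

text \<open>\<open>U(Vir\<^sub>-)\<close>, as the unital subalgebra of \<open>U(Vir)\<close> generated by \<open>Vir\<^sub>-\<close>.\<close>

inductive_set U_minus :: "Uvir set" where
  one: "1 \<in> U_minus"
| gen: "0 < k \<Longrightarrow> Ugen (Dgen (- k)) \<in> U_minus"
| add: "x \<in> U_minus \<Longrightarrow> y \<in> U_minus \<Longrightarrow> x + y \<in> U_minus"
| mult: "x \<in> U_minus \<Longrightarrow> y \<in> U_minus \<Longrightarrow> x * y \<in> U_minus"
| scale: "x \<in> U_minus \<Longrightarrow> U_scale a x \<in> U_minus"

definition U_homogeneous :: "int \<Rightarrow> Uvir \<Rightarrow> bool" where
  "U_homogeneous m x \<longleftrightarrow> Ugen (Dgen 0) * x - x * Ugen (Dgen 0) = U_scale (of_int m) x"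

section \<open>The maps \<open>\<phi>\<^sub>n\<close>\<close>

definition is_phi :: "complex \<Rightarrow> complex \<Rightarrow> int \<Rightarrow> (Uvir \<Rightarrow> complex) \<Rightarrow> bool" where
  "is_phi \<alpha> \<beta> n f \<longleftrightarrow>
     (\<forall>x\<in>U_minus. \<forall>y\<in>U_minus. f (x + y) = f x + f y) \<and>
     (\<forall>a. \<forall>x\<in>U_minus. f (U_scale a x) = a * f x) \<and>
     f 1 = 1 \<and>
     (\<forall>ks :: nat list. ks \<noteq> [] \<and> (\<forall>k\<in>set ks. 0 < k) \<longrightarrow>
        f (prod_list (map (\<lambda>k. Ugen (Dgen (- int k))) (rev ks))) =
        (\<Prod>j<length ks. of_nat (ks ! j) * \<beta> - \<alpha> - of_int n - of_nat (\<Sum>i\<le>j. ks ! i)))"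

text \<open>
  Only the values on \<^const>\<open>U_minus\<close> are determined; existence and uniqueness there are proved
  below.
\<close>

definition phi :: "complex \<Rightarrow> complex \<Rightarrow> int \<Rightarrow> Uvir \<Rightarrow> complex" where
  "phi \<alpha> \<beta> n = (SOME f. is_phi \<alpha> \<beta> n f)"


fun gen_degree :: "vir_gen \<Rightarrow> int" where
  "gen_degree (Dgen m) = m"
| "gen_degree Cgen = 0"

definition list_degree :: "vir_gen list \<Rightarrow> int" where
  "list_degree w = sum_list (map gen_degree w)"

context
  fixes \<alpha> \<beta> :: complex
begin

fun phi_factor :: "int \<Rightarrow> vir_gen \<Rightarrow> complex" where
  "phi_factor n (Dgen m) = - of_int m * \<beta> - \<alpha> - of_int (n - m)"
| "phi_factor n Cgen = 0"

text \<open>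
  The action of \<open>U(Vir)\<close> on the restricted dual of \<open>V\<^sub>\<alpha>\<^sub>,\<^sub>\<beta>\<close> maps the \<open>n\<close>-th dual basis vector to
  a multiple of another one under each word; the scalar extends \<open>\<phi>\<^sub>n\<close> to \<open>U(Vir)\<close>.
\<close>

fun phi_list :: "int \<Rightarrow> vir_gen list \<Rightarrow> complex" where
  "phi_list n [] = 1"
| "phi_list n (g # w) = phi_factor (n - list_degree w) g * phi_list n w"

definition phi_tensor :: "int \<Rightarrow> vir_tensor \<Rightarrow> complex" where
  "phi_tensor n p = (\<Sum>w\<in>Poly_Mapping.keys p. Poly_Mapping.lookup p w * phi_list n (letters w))"

lemma list_degree_simps [simp]:
  "list_degree [] = 0" "list_degree (g # w) = gen_degree g + list_degree w"
  "list_degree (v @ w) = list_degree v + list_degree w"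
  by (simp_all add: list_degree_def)

lemma phi_list_append: "phi_list n (v @ w) = phi_list (n - list_degree w) v * phi_list n w"
  by (induction v) (auto simp: algebra_simps)

lemma phi_tensor_zero [simp]: "phi_tensor n 0 = 0"
  by (simp add: phi_tensor_def)

lemma phi_tensor_add: "phi_tensor n (p + q) = phi_tensor n p + phi_tensor n q"
  unfolding phi_tensor_def by (rule setsum_keys_plus_distrib) (simp_all add: algebra_simps)

lemma phi_tensor_single [simp]:
  "phi_tensor n (Poly_Mapping.single w a) = a * phi_list n (letters w)"
  by (cases "a = 0") (simp_all add: phi_tensor_def)

lemma phi_tensor_uminus: "phi_tensor n (- p) = - phi_tensor n p"
  using phi_tensor_add[of n p "- p"] by (simp add: eq_neg_iff_add_eq_0 add.commute)

lemma phi_tensor_diff: "phi_tensor n (p - q) = phi_tensor n p - phi_tensor n q"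
  using phi_tensor_add[of n p "- q"] by (simp add: phi_tensor_uminus)

lemma phi_tensor_sum: "phi_tensor n (\<Sum>i\<in>A. f i) = (\<Sum>i\<in>A. phi_tensor n (f i))"
  by (induction A rule: infinite_finite_induct) (simp_all add: phi_tensor_add)

lemma phi_tensor_scale: "phi_tensor n (Poly_Mapping.map ((*) a) p) = a * phi_tensor n p"
proof (cases "a = 0")
  case True
  then show ?thesis by (simp add: mult_map_scale_conv_mult)
next
  case False
  then have "Poly_Mapping.keys (Poly_Mapping.map ((*) a) p) = Poly_Mapping.keys p"
    by (auto simp: in_keys_iff Poly_Mapping.map.rep_eq when_def)
  then show ?thesis
    by (auto simp: phi_tensor_def sum_distrib_left Poly_Mapping.map.rep_eq when_def in_keys_iff
             intro!: sum.cong)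
qed

end

lemma poly_mapping_sum_single:
  "(p :: 'a \<Rightarrow>\<^sub>0 complex) =
     (\<Sum>k\<in>Poly_Mapping.keys p. Poly_Mapping.single k (Poly_Mapping.lookup p k))"
  by (rule poly_mapping_eqI)
     (auto simp: lookup_sum lookup_single when_def in_keys_iff)

lemma tlin_zero [simp]: "tlin 0 = 0"
  by (simp add: tlin_def)

lemma tlin_add: "tlin (x + y) = tlin x + tlin y"
  unfolding tlin_def by (rule setsum_keys_plus_distrib) (simp_all add: single_add)

lemma tlin_single [simp]: "tlin (Poly_Mapping.single g a) = Poly_Mapping.single (Word [g]) a"
  by (cases "a = 0") (simp_all add: tlin_def)

lemma letters_plus [simp]: "letters (v + w) = letters v @ letters w"
  by (simp add: plus_vir_word_def)

lemma phi_tensor_relator_single: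
  "phi_tensor \<alpha> \<beta> n (Poly_Mapping.single v a * U_relator g h * Poly_Mapping.single w b) = 0"
  by (cases g; cases h)
     (auto simp: U_relator_def tgen_def tlin_add mult_single phi_tensor_diff phi_tensor_add
        phi_list_append ring_distribs add.assoc algebra_simps)

lemma phi_tensor_U_ideal: "p \<in> U_ideal \<Longrightarrow> phi_tensor \<alpha> \<beta> n p = 0"
proof (induction rule: U_ideal.induct)
  case (relator a g h b)
  let ?S = "\<lambda>p :: vir_tensor. \<Sum>k\<in>Poly_Mapping.keys p. Poly_Mapping.single k (Poly_Mapping.lookup p k)"
  have "a * U_relator g h * b = ?S a * U_relator g h * ?S b"
    by (simp flip: poly_mapping_sum_single)
  also have "\<dots> = (\<Sum>k\<in>Poly_Mapping.keys a. \<Sum>l\<in>Poly_Mapping.keys b.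
      Poly_Mapping.single k (Poly_Mapping.lookup a k) * U_relator g h *
      Poly_Mapping.single l (Poly_Mapping.lookup b l))"
    by (simp add: sum_distrib_left sum_distrib_right) (rule sum.swap)
  finally show ?case
    by (simp add: phi_tensor_sum phi_tensor_relator_single)
qed (simp_all add: phi_tensor_add)

lift_definition phi_U :: "complex \<Rightarrow> complex \<Rightarrow> int \<Rightarrow> Uvir \<Rightarrow> complex" is phi_tensor
  using phi_tensor_U_ideal by (fastforce simp: U_eq_def phi_tensor_diff)

lemma phi_U_one: "phi_U \<alpha> \<beta> n 1 = 1"
  by transfer (simp flip: single_one add: zero_vir_word_def)

instance Uvir :: ring_1
proof
  have "phi_U 0 0 0 0 = 0"
    by transfer simp
  then show "(0 :: Uvir) \<noteq> 1"
    using phi_U_one[of 0 0 0] by auto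
qed

lemma prod_list_Ugen:
  "prod_list (map Ugen w) = abs_Uvir (Poly_Mapping.single (Word w) 1)"
proof (induction w)
  case Nil
  then show ?case
    by (simp add: one_Uvir.abs_eq flip: single_one add: zero_vir_word_def)
next
  case (Cons g w)
  then show ?case
    by (simp add: Ugen.abs_eq times_Uvir.abs_eq tgen_def mult_single plus_vir_word_def)
qed

lemma phi_list_rev:
  "phi_list \<alpha> \<beta> n (map (\<lambda>k. Dgen (- int k)) (rev ks)) =
     (\<Prod>j<length ks. of_nat (ks ! j) * \<beta> - \<alpha> - of_int n - of_nat (\<Sum>i\<le>j. ks ! i))"
proof (induction ks rule: rev_induct)
  case (snoc k ks)
  have deg: "list_degree (map (\<lambda>k. Dgen (- int k)) (rev ks)) = - int (\<Sum>i<length ks. ks ! i)"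
    by (induction ks rule: rev_induct) (simp_all add: nth_append)
  have "(\<Sum>i\<le>j. (ks @ [k]) ! i) = (\<Sum>i\<le>j. ks ! i)" if "j < length ks" for j
    using that by (auto simp: nth_append)
  then have "(\<Prod>j<length ks. of_nat ((ks @ [k]) ! j) * \<beta> - \<alpha> - of_int n - of_nat (\<Sum>i\<le>j. (ks @ [k]) ! i)) =
     (\<Prod>j<length ks. of_nat (ks ! j) * \<beta> - \<alpha> - of_int n - of_nat (\<Sum>i\<le>j. ks ! i))"
    by (intro prod.cong) (auto simp: nth_append)
  moreover have "(\<Sum>i\<le>length ks. of_nat ((ks @ [k]) ! i) :: complex) = of_nat k + (\<Sum>i<length ks. of_nat (ks ! i))"
    by (simp flip: lessThan_Suc_atMost add: nth_append)
  ultimately show ?case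
    using snoc by (simp add: deg algebra_simps)
qed simp

lemma is_phi_phi_U: "is_phi \<alpha> \<beta> n (phi_U \<alpha> \<beta> n)"
proof -
  have "phi_U \<alpha> \<beta> n (prod_list (map (\<lambda>k. Ugen (Dgen (- int k))) (rev ks))) =
    phi_list \<alpha> \<beta> n (map (\<lambda>k. Dgen (- int k)) (rev ks))" for ks
    using prod_list_Ugen[of "map (\<lambda>k. Dgen (- int k)) (rev ks)"]
    by (simp add: phi_U.abs_eq comp_def)
  moreover have "phi_U \<alpha> \<beta> n (x + y) = phi_U \<alpha> \<beta> n x + phi_U \<alpha> \<beta> n y" for x y
    by transfer (rule phi_tensor_add)
  moreover have "phi_U \<alpha> \<beta> n (U_scale a x) = a * phi_U \<alpha> \<beta> n x" for a x
    by transfer (rule phi_tensor_scale)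
  ultimately show ?thesis
    by (simp add: is_phi_def phi_U_one phi_list_rev)
qed

lemma is_phi_phi: "is_phi \<alpha> \<beta> n (phi \<alpha> \<beta> n)"
  using someI[of "is_phi \<alpha> \<beta> n", OF is_phi_phi_U] by (simp add: phi_def)

inductive_set U_minus_span :: "Uvir set" where
  monom: "(\<forall>k\<in>set ks. 0 < k) \<Longrightarrow>
            U_scale a (prod_list (map (\<lambda>k :: nat. Ugen (Dgen (- int k))) ks)) \<in> U_minus_span"
| add: "x \<in> U_minus_span \<Longrightarrow> y \<in> U_minus_span \<Longrightarrow> x + y \<in> U_minus_span"

lemma U_scale_simps:
  "U_scale a (x + y) = U_scale a x + U_scale a y"
  "U_scale a (U_scale b x) = U_scale (a * b) x"
  "U_scale a x * y = U_scale a (x * y)"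
  "U_scale 1 x = x"
proof -
  show "U_scale a (x + y) = U_scale a x + U_scale a y"
    by transfer (simp add: mult_map_scale_conv_mult U_eq_def ring_distribs U_ideal.zero)
  show "U_scale a (U_scale b x) = U_scale (a * b) x"
    by transfer (simp add: mult_map_scale_conv_mult U_eq_def mult_single U_ideal.zero flip: mult.assoc)
  show "U_scale a x * y = U_scale a (x * y)"
    by transfer (simp add: mult_map_scale_conv_mult U_eq_def mult.assoc U_ideal.zero)
  show "U_scale 1 x = x"
    by transfer (simp add: mult_map_scale_conv_mult U_eq_def U_ideal.zero)
qed

lemma single_zero_central:
  "p * Poly_Mapping.single 0 a = Poly_Mapping.single 0 a * (p :: vir_tensor)"
proof -
  have "Poly_Mapping.single k b * Poly_Mapping.single 0 a =
        Poly_Mapping.single 0 a * (Poly_Mapping.single k b :: vir_tensor)" for k b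
    by (simp add: mult_single mult.commute)
  then show ?thesis
    by (subst (1 2) poly_mapping_sum_single[of p]) (simp add: sum_distrib_left sum_distrib_right)
qed

lemma U_scale_right: "x * U_scale a y = U_scale a (x * y)"
  by transfer
     (simp add: mult_map_scale_conv_mult U_eq_def U_ideal.zero single_zero_central flip: mult.assoc)

lemma prod_list_U_minus:
  "(\<forall>k\<in>set ks. 0 < k) \<Longrightarrow> prod_list (map (\<lambda>k :: nat. Ugen (Dgen (- int k))) ks) \<in> U_minus"
proof (induction ks)
  case (Cons k ks)
  then have "Ugen (Dgen (- int k)) \<in> U_minus" by (intro U_minus.gen) simp
  with Cons show ?case by (simp add: U_minus.mult)
qed (simp add: U_minus.one)

lemma U_minus_eq_span: "U_minus = U_minus_span"
proof (intro equalityI subsetI)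
  have scale: "U_scale a x \<in> U_minus_span" if "x \<in> U_minus_span" for a x
    using that by induction (auto simp: U_scale_simps intro: U_minus_span.intros)
  have monom_mult: "U_scale a (prod_list (map (\<lambda>k :: nat. Ugen (Dgen (- int k))) ks)) * y \<in> U_minus_span"
    if ks: "\<forall>k\<in>set ks. 0 < k" and "y \<in> U_minus_span" for a ks y
    using that(2)
  proof induction
    case (monom ls b)
    have "\<forall>k\<in>set (ks @ ls). 0 < k" using ks monom by auto
    from U_minus_span.monom[OF this, of "b * a"] show ?case
      by (simp add: U_scale_simps U_scale_right)
  qed (auto simp: ring_distribs intro: U_minus_span.intros)
  have mult: "x * y \<in> U_minus_span" if "x \<in> U_minus_span" "y \<in> U_minus_span" for x y
    using that(1)
  proof induction
    case (monom ks a)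
    with monom_mult that(2) show ?case by blast
  qed (auto simp: ring_distribs intro: U_minus_span.intros)
  fix x assume "x \<in> U_minus"
  then show "x \<in> U_minus_span"
  proof induction
    case one
    show ?case using U_minus_span.monom[of "[]" 1] by (simp add: U_scale_simps)
  next
    case (gen k)
    then show ?case using U_minus_span.monom[of "[nat k]" 1] by (simp add: U_scale_simps)
  qed (auto intro: scale mult U_minus_span.intros)
next
  fix x assume "x \<in> U_minus_span"
  then show "x \<in> U_minus"
  proof induction
    case (monom ks a)
    then have "prod_list (map (\<lambda>k :: nat. Ugen (Dgen (- int k))) ks) \<in> U_minus"
      by (rule prod_list_U_minus)
    then show ?case by (rule U_minus.scale)
  qed (auto intro: U_minus.intros)
qed

lemma is_phi_unique:
  assumes "is_phi \<alpha> \<beta> n f" "is_phi \<alpha> \<beta> n f'" "x \<in> U_minus"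
  shows "f x = f' x"
proof -
  have val: "f1 (prod_list (map (\<lambda>k :: nat. Ugen (Dgen (- int k))) ks)) =
      (\<Prod>j<length ks. of_nat (rev ks ! j) * \<beta> - \<alpha> - of_int n - of_nat (\<Sum>i\<le>j. rev ks ! i))"
    if "is_phi \<alpha> \<beta> n f1" "\<forall>k\<in>set ks. 0 < k" for f1 ks
  proof (cases "ks = []")
    case False
    then have "rev ks \<noteq> [] \<and> (\<forall>k\<in>set (rev ks). 0 < k)" using that(2) by simp
    with that(1)[unfolded is_phi_def]
    have "f1 (prod_list (map (\<lambda>k :: nat. Ugen (Dgen (- int k))) (rev (rev ks)))) =
      (\<Prod>j<length (rev ks). of_nat (rev ks ! j) * \<beta> - \<alpha> - of_int n - of_nat (\<Sum>i\<le>j. rev ks ! i))"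
      by blast
    then show ?thesis by simp
  qed (use that(1) in \<open>simp add: is_phi_def\<close>)
  from assms(3) have "x \<in> U_minus_span" by (simp add: U_minus_eq_span)
  then show ?thesis
  proof induction
    case (monom ks a)
    have scal: "f1 (U_scale a (prod_list (map (\<lambda>k :: nat. Ugen (Dgen (- int k))) ks))) =
        a * f1 (prod_list (map (\<lambda>k :: nat. Ugen (Dgen (- int k))) ks))" if "is_phi \<alpha> \<beta> n f1" for f1
      using that prod_list_U_minus[OF monom] by (simp add: is_phi_def)
    show ?case
      by (simp only: scal[OF assms(1)] scal[OF assms(2)] val[OF assms(1) monom] val[OF assms(2) monom])
  next
    case (add x y)
    then show ?case using assms(1,2) by (simp add: is_phi_def U_minus_eq_span)
  qed
qed

section \<open>Modules over the Virasoro algebra\<close>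

abbreviation complex_ring :: "complex ring" where
  "complex_ring \<equiv> ring_of_type_algebra"

record 'a vir_rep = "(complex, 'a) module" +
  act :: "vir_gen \<Rightarrow> 'a \<Rightarrow> 'a"

locale vir_module = module complex_ring M for M :: "('a, 'm) vir_rep_scheme" (structure) +
  assumes act_closed: "x \<in> carrier M \<Longrightarrow> act M g x \<in> carrier M"
    and act_add: "x \<in> carrier M \<Longrightarrow> y \<in> carrier M \<Longrightarrow>
          act M g (x \<oplus>\<^bsub>M\<^esub> y) = act M g x \<oplus>\<^bsub>M\<^esub> act M g y"
    and act_smult: "x \<in> carrier M \<Longrightarrow> act M g (a \<odot>\<^bsub>M\<^esub> x) = a \<odot>\<^bsub>M\<^esub> act M g x"
    and act_bracket: "x \<in> carrier M \<Longrightarrow>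
          act M (Dgen m) (act M (Dgen n) x) \<ominus>\<^bsub>M\<^esub> act M (Dgen n) (act M (Dgen m) x) =
          of_int (n - m) \<odot>\<^bsub>M\<^esub> act M (Dgen (m + n)) x \<oplus>\<^bsub>M\<^esub>
          (if n = - m then of_int (m ^ 3 - m) / 12 else 0) \<odot>\<^bsub>M\<^esub> act M Cgen x"
    and act_central: "x \<in> carrier M \<Longrightarrow>
          act M Cgen (act M (Dgen m) x) = act M (Dgen m) (act M Cgen x)"

definition vir_submodule :: "'a set \<Rightarrow> ('a, 'm) vir_rep_scheme \<Rightarrow> bool" where
  "vir_submodule H M \<longleftrightarrow> submodule H complex_ring M \<and> (\<forall>g. \<forall>x\<in>H. act M g x \<in> H)"

definition vir_simple :: "('a, 'm) vir_rep_scheme \<Rightarrow> bool" where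
  "vir_simple M \<longleftrightarrow> vir_module M \<and> carrier M \<noteq> {\<zero>\<^bsub>M\<^esub>} \<and>
     (\<forall>H. vir_submodule H M \<longrightarrow> H = {\<zero>\<^bsub>M\<^esub>} \<or> H = carrier M)"

definition lin_span :: "('a, 'm) vir_rep_scheme \<Rightarrow> 'a set \<Rightarrow> 'a set" where
  "lin_span M S = (\<lambda>H. submodule H complex_ring M) hull S"

definition vir_generated :: "('a, 'm) vir_rep_scheme \<Rightarrow> 'a set \<Rightarrow> 'a set" where
  "vir_generated M S = (\<lambda>H. vir_submodule H M) hull S"

definition weight_space :: "('a, 'm) vir_rep_scheme \<Rightarrow> complex \<Rightarrow> 'a set" where
  "weight_space M \<mu> = {v \<in> carrier M. act M (Dgen 0) v = \<mu> \<odot>\<^bsub>M\<^esub> v}"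

definition finite_dim :: "('a, 'm) vir_rep_scheme \<Rightarrow> 'a set \<Rightarrow> bool" where
  "finite_dim M E \<longleftrightarrow> (\<exists>B. finite B \<and> B \<subseteq> E \<and> lin_span M B = E)"

definition singular_vector :: "('a, 'm) vir_rep_scheme \<Rightarrow> 'a \<Rightarrow> bool" where
  "singular_vector M v \<longleftrightarrow> v \<noteq> \<zero>\<^bsub>M\<^esub> \<and> (\<exists>\<mu>. v \<in> weight_space M \<mu>) \<and>
     (\<forall>i>0. act M (Dgen i) v = \<zero>\<^bsub>M\<^esub>)"

definition maximal_submodule :: "'a set \<Rightarrow> ('a, 'm) vir_rep_scheme \<Rightarrow> bool" where
  "maximal_submodule H M \<longleftrightarrow> vir_submodule H M \<and> H \<noteq> carrier M \<and>
     (\<forall>K. vir_submodule K M \<and> H \<subseteq> K \<longrightarrow> K = H \<or> K = carrier M)"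

text \<open>
  In a quotient, the operations on cosets are induced by representatives. The components
  \<^const>\<open>monoid.mult\<close> and \<^const>\<open>monoid.one\<close> of the record play no role for modules.
\<close>

definition vir_quotient :: "('a, 'm) vir_rep_scheme \<Rightarrow> 'a set \<Rightarrow> 'a set vir_rep" where
  "vir_quotient M N = \<lparr>carrier = a_rcosets\<^bsub>M\<^esub> N, monoid.mult = undefined, one = undefined,
     ring.zero = N, add = set_add M,
     module.smult = (\<lambda>a S. \<Union>x\<in>S. N +>\<^bsub>M\<^esub> (a \<odot>\<^bsub>M\<^esub> x)),
     act = (\<lambda>g S. \<Union>x\<in>S. N +>\<^bsub>M\<^esub> act M g x)\<rparr>"

text \<open>The vector space with basis \<open>A\<close>, with operators given by their values on the basis.\<close>

definition free_rep :: "'k set \<Rightarrow> (vir_gen \<Rightarrow> 'k \<Rightarrow> ('k \<Rightarrow>\<^sub>0 complex)) \<Rightarrow> ('k \<Rightarrow>\<^sub>0 complex) vir_rep"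
  where
  "free_rep A f = \<lparr>carrier = {p. Poly_Mapping.keys p \<subseteq> A}, monoid.mult = undefined,
     one = undefined, ring.zero = 0, add = (+), module.smult = (\<lambda>a. Poly_Mapping.map ((*) a)),
     act = (\<lambda>g p. \<Sum>k\<in>Poly_Mapping.keys p. Poly_Mapping.map ((*) (Poly_Mapping.lookup p k)) (f g k))\<rparr>"

abbreviation basis_vec :: "'k \<Rightarrow> ('k \<Rightarrow>\<^sub>0 complex)" where
  "basis_vec k \<equiv> Poly_Mapping.single k 1"

section \<open>Tensor products\<close>

definition bilinear_relators ::
    "(complex, 'a, 'm) module_scheme \<Rightarrow> (complex, 'b, 'n) module_scheme \<Rightarrow> ('a \<times> 'b \<Rightarrow>\<^sub>0 complex) set"
  where
  "bilinear_relators M N =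
     {basis_vec (x \<oplus>\<^bsub>M\<^esub> x', y) - basis_vec (x, y) - basis_vec (x', y) | x x' y.
        x \<in> carrier M \<and> x' \<in> carrier M \<and> y \<in> carrier N} \<union>
     {basis_vec (x, y \<oplus>\<^bsub>N\<^esub> y') - basis_vec (x, y) - basis_vec (x, y') | x y y'.
        x \<in> carrier M \<and> y \<in> carrier N \<and> y' \<in> carrier N} \<union>
     {basis_vec (a \<odot>\<^bsub>M\<^esub> x, y) - Poly_Mapping.single (x, y) a | a x y.
        x \<in> carrier M \<and> y \<in> carrier N} \<union>
     {basis_vec (x, a \<odot>\<^bsub>N\<^esub> y) - Poly_Mapping.single (x, y) a | a x y.
        x \<in> carrier M \<and> y \<in> carrier N}"

definition pair_rep ::
    "('a, 'm) vir_rep_scheme \<Rightarrow> ('b, 'n) vir_rep_scheme \<Rightarrow> ('a \<times> 'b \<Rightarrow>\<^sub>0 complex) vir_rep" where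
  "pair_rep M N = free_rep (carrier M \<times> carrier N)
     (\<lambda>g (x, y). basis_vec (act M g x, y) + basis_vec (x, act N g y))"

definition tensor_kernel ::
    "('a, 'm) vir_rep_scheme \<Rightarrow> ('b, 'n) vir_rep_scheme \<Rightarrow> ('a \<times> 'b \<Rightarrow>\<^sub>0 complex) set" where
  "tensor_kernel M N = lin_span (pair_rep M N) (bilinear_relators M N)"

definition vir_tensor_product ::
    "('a, 'm) vir_rep_scheme \<Rightarrow> ('b, 'n) vir_rep_scheme \<Rightarrow> ('a \<times> 'b \<Rightarrow>\<^sub>0 complex) set vir_rep" where
  "vir_tensor_product M N = vir_quotient (pair_rep M N) (tensor_kernel M N)"

definition pure_tensor ::
    "('a, 'm) vir_rep_scheme \<Rightarrow> ('b, 'n) vir_rep_scheme \<Rightarrow> 'a \<Rightarrow> 'b \<Rightarrow> ('a \<times> 'b \<Rightarrow>\<^sub>0 complex) set"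
  where
  "pure_tensor M N x y = tensor_kernel M N +>\<^bsub>pair_rep M N\<^esub> basis_vec (x, y)"

section \<open>Verma modules and their simple quotients\<close>

definition U_space :: "(complex, Uvir) module" where
  "U_space = \<lparr>carrier = UNIV, monoid.mult = (*), one = 1, ring.zero = 0, add = (+), module.smult = U_scale\<rparr>"

definition line_space :: "(complex, complex) module" where
  "line_space = \<lparr>carrier = UNIV, monoid.mult = (*), one = 1, ring.zero = 0, add = (+), module.smult = (*)\<rparr>"

definition borel_gens :: "vir_gen set" where
  "borel_gens = insert Cgen {Dgen i | i. 0 \<le> i}"

text \<open>The scalar by which an element of \<^const>\<open>borel_gens\<close> acts on \<open>\<complex>u\<close>.\<close>

fun highest_weight :: "complex \<Rightarrow> complex \<Rightarrow> vir_gen \<Rightarrow> complex" where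
  "highest_weight c h (Dgen i) = (if i = 0 then h else 0)"
| "highest_weight c h Cgen = c"

text \<open>
  \<open>M(c,h) = U(Vir) \<otimes> \<complex>u\<close> over \<open>U(Vir\<^sub>+ \<oplus> \<complex>d\<^sub>0 \<oplus> \<complex>C)\<close>, where \<open>z u\<close> is represented by \<open>z\<close>. Balancing
  over the generators \<^const>\<open>borel_gens\<close> implies balancing over the algebra they generate.
\<close>

definition verma_cover :: "(Uvir \<times> complex \<Rightarrow>\<^sub>0 complex) vir_rep" where
  "verma_cover = free_rep UNIV (\<lambda>g (x, z). basis_vec (Ugen g * x, z))"

definition verma_kernel :: "complex \<Rightarrow> complex \<Rightarrow> (Uvir \<times> complex \<Rightarrow>\<^sub>0 complex) set" where
  "verma_kernel c h = lin_span verma_cover (bilinear_relators U_space line_space \<union>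
     {basis_vec (x * Ugen b, z) - basis_vec (x, highest_weight c h b * z) | x b z. b \<in> borel_gens})"

definition verma :: "complex \<Rightarrow> complex \<Rightarrow> (Uvir \<times> complex \<Rightarrow>\<^sub>0 complex) set vir_rep" where
  "verma c h = vir_quotient verma_cover (verma_kernel c h)"

text \<open>The vector \<open>x u\<close> of \<open>M(c,h)\<close>, represented by \<open>x \<otimes> u\<close>.\<close>

definition verma_vec :: "complex \<Rightarrow> complex \<Rightarrow> Uvir \<Rightarrow> (Uvir \<times> complex \<Rightarrow>\<^sub>0 complex) set" where
  "verma_vec c h x = verma_kernel c h +>\<^bsub>verma_cover\<^esub> basis_vec (x, 1)"

definition verma_max :: "complex \<Rightarrow> complex \<Rightarrow> (Uvir \<times> complex \<Rightarrow>\<^sub>0 complex) set set" where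
  "verma_max c h = (THE H. maximal_submodule H (verma c h))"

definition simple_hw :: "complex \<Rightarrow> complex \<Rightarrow> (Uvir \<times> complex \<Rightarrow>\<^sub>0 complex) set set vir_rep" where
  "simple_hw c h = vir_quotient (verma c h) (verma_max c h)"

definition hw_vec :: "complex \<Rightarrow> complex \<Rightarrow> (Uvir \<times> complex \<Rightarrow>\<^sub>0 complex) set set" where
  "hw_vec c h = verma_max c h +>\<^bsub>verma c h\<^esub> verma_vec c h 1"

definition max_generators :: "complex \<Rightarrow> complex \<Rightarrow> Uvir \<Rightarrow> Uvir \<Rightarrow> bool" where
  "max_generators c h Q1 Q2 \<longleftrightarrow>
     (let M = verma c h; J = verma_max c h; UQ = (\<lambda>Q. {verma_vec c h (x * Q) | x. x \<in> U_minus}) in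
      if J = {\<zero>\<^bsub>M\<^esub>} then Q1 = 0 \<and> Q2 = 0
      else if \<exists>v. singular_vector M v \<and> J = vir_generated M {v} then
        Q1 \<in> U_minus \<and> (\<exists>m. U_homogeneous m Q1) \<and> J = UQ Q1 \<and> Q2 = Q1
      else
        Q1 \<in> U_minus \<and> Q2 \<in> U_minus \<and> (\<exists>m. U_homogeneous m Q1) \<and> (\<exists>m. U_homogeneous m Q2) \<and>
        J = UQ Q1 <+>\<^bsub>M\<^esub> UQ Q2)"

section \<open>Intermediate series modules\<close>

definition interm :: "complex \<Rightarrow> complex \<Rightarrow> (int \<Rightarrow>\<^sub>0 complex) vir_rep" where
  "interm \<alpha> \<beta> = free_rep UNIV (\<lambda>g n. case g of
     Dgen m \<Rightarrow> Poly_Mapping.single (m + n) (\<alpha> + of_int n + of_int m * \<beta>) | Cgen \<Rightarrow> 0)"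

definition interm_kernel :: "complex \<Rightarrow> complex \<Rightarrow> (int \<Rightarrow>\<^sub>0 complex) set" where
  "interm_kernel \<alpha> \<beta> = (if \<alpha> = 0 \<and> \<beta> = 0 then lin_span (interm \<alpha> \<beta>) {basis_vec 0} else {0})"

text \<open>\<open>V'\<^sub>\<alpha>\<^sub>,\<^sub>\<beta>\<close>; for \<open>(\<alpha>,\<beta>) \<noteq> (0,0)\<close> this is the quotient by \<open>{0}\<close>.\<close>

definition interm' :: "complex \<Rightarrow> complex \<Rightarrow> (int \<Rightarrow>\<^sub>0 complex) set vir_rep" where
  "interm' \<alpha> \<beta> = vir_quotient (interm \<alpha> \<beta>) (interm_kernel \<alpha> \<beta>)"

definition interm_vec :: "complex \<Rightarrow> complex \<Rightarrow> int \<Rightarrow> (int \<Rightarrow>\<^sub>0 complex) set" where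
  "interm_vec \<alpha> \<beta> n = interm_kernel \<alpha> \<beta> +>\<^bsub>interm \<alpha> \<beta>\<^esub> basis_vec n"

definition hw_tensor where
  "hw_tensor c h \<alpha> \<beta> = vir_tensor_product (simple_hw c h) (interm' \<alpha> \<beta>)"

definition W_sub where
  "W_sub c h \<alpha> \<beta> n = vir_generated (hw_tensor c h \<alpha> \<beta>)
     {pure_tensor (simple_hw c h) (interm' \<alpha> \<beta>) (hw_vec c h) (interm_vec \<alpha> \<beta> i) | i :: int. n < i}"

definition phi_zeros :: "complex \<Rightarrow> complex \<Rightarrow> Uvir \<Rightarrow> Uvir \<Rightarrow> int set" where
  "phi_zeros \<alpha> \<beta> Q1 Q2 =
     {n. (\<alpha> = 0 \<and> \<beta> = 0 \<longrightarrow> n \<noteq> 0) \<and> phi \<alpha> \<beta> n Q1 = 0 \<and> phi \<alpha> \<beta> n Q2 = 0}"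

end

theory Submission
  imports Defs
begin

text \<open>
  Let \<open>L\<close> be the annihilator of \<open>u\<close> in \<open>V(c,h)\<close>. A nonzero submodule \<open>N\<close> of the tensor product contains
  \<open>u \<otimes> v\<^sub>i\<close> for all large \<open>i\<close>: the \<open>d\<^sub>j\<close> with \<open>j\<close> large act on the second factor only, so every element of
  \<open>N\<close> can be shifted and cut down to elements \<open>x u \<otimes> v\<^sub>i\<close> with \<open>x \<notin> L\<close>, and \<open>L\<close> is a maximal left ideal
  among those containing the annihilator of \<open>u\<close> in \<open>M(c,h)\<close>. If \<open>N\<close> contains \<open>u \<otimes> v\<^sub>i\<close> for all \<open>i > n\<close>, then
  \<open>Q u \<otimes> v\<^bsub>n - deg Q\<^esub>\<close> is congruent to \<open>\<phi>\<^sub>n(Q) u \<otimes> v\<^sub>n\<close> modulo \<open>N\<close> for \<open>Q\<close> homogeneous in \<open>U(Vir\<^sub>-)\<close>; as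
  \<open>Q\<^sub>1 u = Q\<^sub>2 u = 0\<close>, descending on \<open>n\<close> only stops at a common zero of \<open>\<phi>\<^sub>n(Q\<^sub>1)\<close> and \<open>\<phi>\<^sub>n(Q\<^sub>2)\<close>. At such an
  \<open>n\<close> the functional \<open>\<phi>\<^sub>n\<close> vanishes on \<open>U(Vir\<^sub>-)Q\<^sub>1 + U(Vir\<^sub>-)Q\<^sub>2\<close> and hence defines a \<open>Vir\<^sub>-\<close>-invariant functional
  on the tensor product, which separates \<open>u \<otimes> v\<^sub>n\<close> from \<open>W\<^sup>(\<^sup>n\<^sup>)\<close>. The weight spaces of \<open>W\<^sup>(\<^sup>n\<^sup>)\<close> contain the
  vectors \<open>d\<^bsub>-k\<^esub>(u \<otimes> v\<^bsub>m+k\<^esub>)\<close>, whose components \<open>d\<^bsub>-k\<^esub> u \<otimes> v\<^bsub>m+k\<^esub>\<close> are nonzero for all large \<open>k\<close>, unless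
  \<open>c = h = 0\<close>, where \<open>d\<^bsub>-1\<^esub>, d\<^bsub>-2\<^esub> \<in> L\<close> and \<open>\<beta> \<noteq> 1\<close> exclude common zeros.
\<close>

section \<open>The enveloping algebra\<close>

text \<open>The coefficient of u, which makes L proper, and the functional that separates u
  \<otimes> v_n from W^(n) are both given on U(Vir_-) only and have to be extended so that they
  vanish on the annihilator of u in M(c,h). As U(Vir) is a quotient of the free algebra, such an
  extension is built on words and checked against the relations; the check comes down to the Jacobi
  and cocycle identities. Cutting a vector down to one term x u \<otimes> v_i cannot rely on d_0,
  since terms with different i may have the same weight. The index i is read off from the scalar
  \<alpha> + i + j \<beta> by which a large d_j acts. As this also moves i, the argument uses
  vectors all of whose sufficiently large shifts lie in N (\<open>germ\<close>). All computations
  are made with finitely supported functions from the integers to U(Vir). The modules defined by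
  cosets enter only as images of such spaces, so that submodules become stable subspaces that
  contain a fixed kernel.\<close>

abbreviation U_mono :: "vir_gen list \<Rightarrow> Uvir" where
  "U_mono w \<equiv> prod_list (map Ugen w)"

abbreviation d_cocycle :: "int \<Rightarrow> int \<Rightarrow> complex" where
  "d_cocycle m n \<equiv> (if n = - m then of_int (m ^ 3 - m) / 12 else 0)"

lemma U_scale_add_left: "U_scale (a + b) x = U_scale a x + U_scale b x"
  by transfer (simp add: mult_map_scale_conv_mult single_add distrib_right U_eq_def U_ideal.zero)

lemma U_scale_zero_left [simp]: "U_scale 0 x = 0"
  by transfer (simp add: mult_map_scale_conv_mult U_eq_def U_ideal.zero)

interpretation U: vector_space U_scale
  by standard (simp_all add: U_scale_simps U_scale_add_left)

lemma U_commutator: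
  "Ugen (Dgen m) * Ugen (Dgen n) =
     Ugen (Dgen n) * Ugen (Dgen m) + U_scale (of_int (n - m)) (Ugen (Dgen (m + n))) +
     U_scale (d_cocycle m n) (Ugen Cgen)"
proof -
  have scale: "Poly_Mapping.map ((*) a) (tgen g) = Poly_Mapping.single (Word [g]) a" for a g
    by (simp add: tgen_def mult_map_scale_conv_mult mult_single)
  have "tlin (vir_bracket (Dgen m) (Dgen n)) = Poly_Mapping.map ((*) (of_int (n - m))) (tgen (Dgen (m + n))) +
     Poly_Mapping.map ((*) (d_cocycle m n)) (tgen Cgen)"
    unfolding scale by (simp only: vir_bracket.simps tlin_add tlin_single)
  then have "U_eq (tgen (Dgen m) * tgen (Dgen n)) (tgen (Dgen n) * tgen (Dgen m) +
     Poly_Mapping.map ((*) (of_int (n - m))) (tgen (Dgen (m + n))) +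
     Poly_Mapping.map ((*) (d_cocycle m n)) (tgen Cgen))"
    using U_ideal.relator[of 1 "Dgen m" "Dgen n" 1]
    by (simp only: U_eq_def U_relator_def add.assoc mult_1_left mult_1_right diff_diff_add)
  then show ?thesis by transfer
qed

lemma U_central: "Ugen Cgen * Ugen g = Ugen g * Ugen Cgen"
proof -
  have "U_eq (tgen Cgen * tgen g) (tgen g * tgen Cgen)"
    using U_ideal.relator[of 1 Cgen g 1]
    by (simp add: U_eq_def U_relator_def)
  then show ?thesis by transfer
qed

lemma U_span_induct [case_names mono add]:
  assumes mono: "\<And>a w. P (U_scale a (U_mono w))"
    and add: "\<And>x y. P x \<Longrightarrow> P y \<Longrightarrow> P (x + y)"
  shows "P x"
proof -
  obtain p where x: "x = abs_Uvir p" by (induction x rule: Uvir.abs_induct) blast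
  have single: "abs_Uvir (Poly_Mapping.single k a) = U_scale a (U_mono (letters k))" for k a
    by (simp add: prod_list_Ugen U_scale.abs_eq mult_map_scale_conv_mult mult_single)
  have "P (abs_Uvir (\<Sum>k\<in>A. Poly_Mapping.single k (Poly_Mapping.lookup p k)))" if "finite A" for A
    using that
  proof induction
    case empty
    show ?case using mono[of 0 "[]"] by (simp add: zero_Uvir.abs_eq)
  next
    case (insert k A)
    then show ?case using add mono by (simp add: single flip: plus_Uvir.abs_eq)
  qed
  then show ?thesis
    unfolding x by (subst poly_mapping_sum_single) simp
qed

lemma U_induct [case_names one add scale gen]:
  assumes one: "P 1" and add: "\<And>x y. P x \<Longrightarrow> P y \<Longrightarrow> P (x + y)"
    and scale: "\<And>a x. P x \<Longrightarrow> P (U_scale a x)" and gen: "\<And>g x. P x \<Longrightarrow> P (Ugen g * x)"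
  shows "P x"
proof (induction x rule: U_span_induct)
  case (mono a w)
  have "P (U_mono w)" by (induction w) (simp_all add: one gen)
  then show ?case by (rule scale)
qed (rule add)

lemma U_minus_induct [consumes 1, case_names mono add]:
  assumes "x \<in> U_minus"
    and mono: "\<And>a ks. \<forall>k\<in>set ks. 0 < k \<Longrightarrow> P (U_scale a (U_mono (map (\<lambda>k :: nat. Dgen (- int k)) ks)))"
    and add: "\<And>x y. P x \<Longrightarrow> P y \<Longrightarrow> P (x + y)"
  shows "P x"
proof -
  have "x \<in> U_minus_span" using assms(1) by (simp add: U_minus_eq_span)
  then show ?thesis
  proof induction
    case (monom ks a)
    then show ?case using mono[of ks a] by (simp add: comp_def)
  qed (rule add)
qed

lemma U_minus_zero: "0 \<in> U_minus"
  using U_minus.scale[OF U_minus.one, of 0] by simp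

section \<open>Linear functionals on the enveloping algebra\<close>

definition U_functional :: "(Uvir \<Rightarrow> complex) \<Rightarrow> bool" where
  "U_functional F \<longleftrightarrow> (\<forall>x y. F (x + y) = F x + F y) \<and> (\<forall>a x. F (U_scale a x) = a * F x)"

lemma U_functionalD:
  assumes "U_functional F"
  shows "F (x + y) = F x + F y" "F (U_scale a x) = a * F x" "F 0 = 0" "F (x - y) = F x - F y"
    "F (- x) = - F x"
proof -
  show add: "F (x + y) = F x + F y" for x y using assms by (simp add: U_functional_def)
  show scale: "F (U_scale a x) = a * F x" for a x using assms by (simp add: U_functional_def)
  show "F 0 = 0" using scale[of 0 0] by simp
  show "F (x - y) = F x - F y" using add[of "x - y" y] by simp
  show "F (- x) = - F x" using scale[of "-1" x] by simp
qed

text \<open>These are the restrictions to monomials of linear functionals on U(Vir): each defining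
  relation has to hold between arbitrary words v and w.\<close>

definition word_functional :: "(vir_gen list \<Rightarrow> complex) \<Rightarrow> bool" where
  "word_functional G \<longleftrightarrow>
     (\<forall>v m n w. G (v @ Dgen m # Dgen n # w) - G (v @ Dgen n # Dgen m # w) =
        of_int (n - m) * G (v @ Dgen (m + n) # w) + d_cocycle m n * G (v @ Cgen # w)) \<and>
     (\<forall>v g w. G (v @ Cgen # g # w) = G (v @ g # Cgen # w))"

definition tensor_functional :: "(vir_gen list \<Rightarrow> complex) \<Rightarrow> vir_tensor \<Rightarrow> complex" where
  "tensor_functional G p = (\<Sum>w\<in>Poly_Mapping.keys p. Poly_Mapping.lookup p w * G (letters w))"

lemma tensor_functional_add:
  "tensor_functional G (p + q) = tensor_functional G p + tensor_functional G q"
  unfolding tensor_functional_def by (rule setsum_keys_plus_distrib) (simp_all add: algebra_simps)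

lemma tensor_functional_single [simp]:
  "tensor_functional G (Poly_Mapping.single w a) = a * G (letters w)"
  by (cases "a = 0") (simp_all add: tensor_functional_def)

lemma tensor_functional_diff:
  "tensor_functional G (p - q) = tensor_functional G p - tensor_functional G q"
  using tensor_functional_add[of G "p - q" q] by simp

lemma tensor_functional_sum:
  "tensor_functional G (\<Sum>i\<in>A. f i) = (\<Sum>i\<in>A. tensor_functional G (f i))"
  by (induction A rule: infinite_finite_induct)
     (simp_all add: tensor_functional_add, simp_all add: tensor_functional_def)

lemma tensor_functional_scale:
  "tensor_functional G (Poly_Mapping.map ((*) a) p) = a * tensor_functional G p"
proof -
  have "Poly_Mapping.map ((*) a) p =
      (\<Sum>k\<in>Poly_Mapping.keys p. Poly_Mapping.single k (a * Poly_Mapping.lookup p k))"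
    by (rule poly_mapping_eqI)
       (auto simp: lookup_sum lookup_single when_def in_keys_iff Poly_Mapping.map.rep_eq)
  then show ?thesis
    by (simp add: tensor_functional_sum) (simp add: sum_distrib_left tensor_functional_def mult.assoc)
qed

text \<open>By linearity the two cofactors of a relator may be taken to be single words, where
  \<open>word_functional\<close> applies.\<close>

lemma tensor_functional_U_ideal:
  assumes "word_functional G" "p \<in> U_ideal"
  shows "tensor_functional G p = 0"
  using assms(2)
proof (induction rule: U_ideal.induct)
  case zero
  show ?case by (simp add: tensor_functional_def)
next
  case (relator a g h b)
  have single: "tensor_functional G (Poly_Mapping.single v r * U_relator g h * Poly_Mapping.single w s) = 0"
    for v w r s
  proof (cases g)
    case (Dgen m)
    show ?thesis
    proof (cases h)
      case (Dgen n)
      define v' w' where "v' = letters v" and "w' = letters w"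
      have *: "G (v' @ Dgen m # Dgen n # w') = G (v' @ Dgen n # Dgen m # w') +
          of_int (n - m) * G (v' @ Dgen (m + n) # w') + d_cocycle m n * G (v' @ Cgen # w')"
        using assms(1) unfolding word_functional_def by (metis add.commute add.assoc diff_add_cancel)
      show ?thesis
        unfolding \<open>g = Dgen m\<close> \<open>h = Dgen n\<close>
        by (simp add: U_relator_def tgen_def tlin_add mult_single tensor_functional_diff
            tensor_functional_add ring_distribs * flip: v'_def w'_def del: of_int_diff)
    qed (use assms(1) Dgen in \<open>simp add: word_functional_def U_relator_def tgen_def mult_single
          tensor_functional_diff ring_distribs\<close>)
  qed (use assms(1) in \<open>simp add: word_functional_def U_relator_def tgen_def mult_single
          tensor_functional_diff ring_distribs\<close>)
  let ?S = "\<lambda>p :: vir_tensor. \<Sum>k\<in>Poly_Mapping.keys p. Poly_Mapping.single k (Poly_Mapping.lookup p k)"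
  have "a * U_relator g h * b = ?S a * U_relator g h * ?S b"
    by (simp flip: poly_mapping_sum_single)
  also have "\<dots> = (\<Sum>k\<in>Poly_Mapping.keys a. \<Sum>l\<in>Poly_Mapping.keys b.
      Poly_Mapping.single k (Poly_Mapping.lookup a k) * U_relator g h *
      Poly_Mapping.single l (Poly_Mapping.lookup b l))"
    by (simp add: sum_distrib_left sum_distrib_right) (rule sum.swap)
  finally show ?case
    by (simp add: tensor_functional_sum single)
qed (simp add: tensor_functional_add)

lemma word_functional_extends:
  assumes "word_functional G"
  obtains F where "U_functional F" "\<And>w. F (U_mono w) = G w"
proof
  let ?F = "\<lambda>x. tensor_functional G (rep_Uvir x)"
  have abs: "?F (abs_Uvir p) = tensor_functional G p" for p
  proof -
    have "U_eq (rep_Uvir (abs_Uvir p)) p"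
      using Quotient3_Uvir U_eq_equivp equivp_reflp
      by (metis Quotient3_def Uvir.abs_eq_iff)
    then show ?thesis
      using tensor_functional_U_ideal[OF assms, of "rep_Uvir (abs_Uvir p) - p"]
      by (simp add: U_eq_def tensor_functional_diff)
  qed
  have "?F (x + y) = ?F x + ?F y" for x y
    by (induction x rule: Uvir.abs_induct, induction y rule: Uvir.abs_induct) (simp add: abs plus_Uvir.abs_eq tensor_functional_add)
  moreover have "?F (U_scale a x) = a * ?F x" for a x
    by (induction x rule: Uvir.abs_induct) (simp add: abs U_scale.abs_eq tensor_functional_scale)
  ultimately show "U_functional ?F" by (simp add: U_functional_def)
  show "?F (U_mono w) = G w" for w
    by (simp add: prod_list_Ugen abs)
qed

section \<open>The dual Verma module\<close>

text \<open>
  The list \<open>[k\<^sub>1, \<dots>, k\<^sub>r]\<close> stands for the word \<open>d\<^bsub>-k\<^sub>1-1\<^esub> \<cdots> d\<^bsub>-k\<^sub>r-1\<^esub>\<close>; functions on such lists that satisfy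
  \<open>minus_functional\<close> are the linear functionals on \<open>U(Vir\<^sub>-)\<close>, that is, on the Verma module. For such
  a function \<open>f\<close>, \<open>dual_act c h w m f\<close> is the value of \<open>f\<close> at \<open>d\<^sub>m w u\<close>. That this is well defined
  replaces the Poincare-Birkhoff-Witt theorem.
\<close>

abbreviation neg_index :: "nat \<Rightarrow> int" where
  "neg_index k \<equiv> - int k - 1"

text \<open>With m = -p-1 and n = -q-1 this is [d_m, d_n] = (n - m) d_(m+n): n - m equals p - q, and
  m + n is encoded by p + q + 1. The shift by one makes every list of naturals a legal word; there
  is no central term because m + n < 0.\<close>

definition minus_functional :: "(nat list \<Rightarrow> complex) \<Rightarrow> bool" where
  "minus_functional f \<longleftrightarrow> (\<forall>v p q w. f (v @ p # q # w) - f (v @ q # p # w) =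
     (of_nat p - of_nat q) * f (v @ (p + q + 1) # w))"

primrec dual_act :: "complex \<Rightarrow> complex \<Rightarrow> nat list \<Rightarrow> int \<Rightarrow> (nat list \<Rightarrow> complex) \<Rightarrow> complex" where
  "dual_act c h [] m f = (if m < 0 then f [nat (- m - 1)] else if m = 0 then h * f [] else 0)"
| "dual_act c h (l # w) m f = (if m < 0 then f (nat (- m - 1) # l # w)
     else dual_act c h w m (\<lambda>v. f (l # v)) + of_int (neg_index l - m) * dual_act c h w (m + neg_index l) f +
       d_cocycle m (neg_index l) * c * f w)"

context
  fixes c h :: complex
begin

abbreviation DA :: "int \<Rightarrow> (nat list \<Rightarrow> complex) \<Rightarrow> nat list \<Rightarrow> complex" where
  "DA m f w \<equiv> dual_act c h w m f"

lemma DA_neg: "m < 0 \<Longrightarrow> DA m f w = f (nat (- m - 1) # w)"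
  by (cases w) simp_all

lemma DA_add: "DA m (\<lambda>v. f v + g v) w = DA m f w + DA m g w"
  by (induction w arbitrary: m f g) (simp_all add: algebra_simps)

lemma DA_scale: "DA m (\<lambda>v. a * f v) w = a * DA m f w"
  by (induction w arbitrary: m f) (simp_all add: algebra_simps)

lemma minus_functional_Cons: "minus_functional f \<Longrightarrow> minus_functional (\<lambda>v. f (l # v))"
  unfolding minus_functional_def by (metis append_Cons)

text \<open>\<open>DA m f\<close> is the functional x \<mapsto> f(d_m x), so operators compose in
  reverse order and the left side is f([d_p, d_q] w u). If both indices are negative this is the
  hypothesis on f. If just one is, that operator merely prepends a letter, and the recursion of
  \<open>dual_act\<close> is the relation. If none is, both are moved past the first letter and the
  error terms match by the Jacobi and cocycle identities.\<close>

lemma DA_commutator: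
  assumes "minus_functional f"
  shows "DA q (DA p f) w - DA p (DA q f) w =
    of_int (q - p) * DA (p + q) f w + d_cocycle p q * c * f w"
  using assms
proof (induction w arbitrary: p q f)
  case Nil
  have neg: "f [nat (- p - 1), nat (- q - 1)] - f [nat (- q - 1), nat (- p - 1)] =
    of_int (q - p) * f [nat (- (p + q) - 1)]" if "p < 0" "q < 0"
  proof -
    have "nat (- p - 1) + nat (- q - 1) + 1 = nat (- (p + q) - 1)" using that by linarith
    moreover have "(of_nat (nat (- p - 1)) - of_nat (nat (- q - 1)) :: complex) = of_int (q - p)"
      using that by (simp add: of_nat_nat)
    ultimately show ?thesis
      using Nil[unfolded minus_functional_def, rule_format, of "[]" "nat (- p - 1)" "nat (- q - 1)" "[]"]
      by simp
  qed
  show ?case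
  proof (cases "p < 0 \<and> q < 0")
    case True
    then show ?thesis using neg by (simp add: DA_neg)
  next
    case F: False
    show ?thesis
    proof (cases "p \<ge> 0 \<and> q \<ge> 0")
      case True
      then show ?thesis by (cases "p = 0"; cases "q = 0") auto
    next
      case False
      with F consider "p \<ge> 0" "q < 0" | "p < 0" "q \<ge> 0" by linarith
      then show ?thesis
      proof cases
        case 1
        show ?thesis
        proof (cases "p + q = 0")
          case True
          then have "q = - p" by simp
          with 1 show ?thesis by (auto simp: DA_neg field_simps)
        next
          case F2: False
          with 1 show ?thesis by (auto simp: DA_neg algebra_simps)
        qed
      next
        case 2
        show ?thesis
        proof (cases "p + q = 0")
          case True
          then have "p = - q" by simp
          with 2 show ?thesis by (auto simp: DA_neg field_simps)
        next
          case F2: False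
          with 2 show ?thesis by (auto simp: DA_neg algebra_simps)
        qed
      qed
    qed
  qed
next
  case (Cons l w)
  have f: "minus_functional f" by fact
  let ?fl = "\<lambda>v. f (l # v)"
  have fl: "minus_functional ?fl" using f by (rule minus_functional_Cons)
  have mixed: "DA q (DA p f) (l # w) - DA p (DA q f) (l # w) =
      of_int (q - p) * DA (p + q) f (l # w) + d_cocycle p q * c * f (l # w)"
    if "p \<ge> 0" "q < 0" for p q
  proof -
    have "neg_index (nat (- q - 1)) = q" using that by simp
    moreover have "(\<lambda>v. DA q f v) = (\<lambda>v. f (nat (- q - 1) # v))" using that by (simp add: DA_neg)
    ultimately show ?thesis
      using that by (simp only: DA_neg[of q] dual_act.simps(2)[of c h "nat (- q - 1)" "l # w"]) simp
  qed
  consider "p < 0" "q < 0" | "p \<ge> 0" "q < 0" | "p < 0" "q \<ge> 0" | "p \<ge> 0" "q \<ge> 0" by linarith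
  then show ?case
  proof cases
    case 1
    have "nat (- p - 1) + nat (- q - 1) + 1 = nat (- (p + q) - 1)" using 1 by linarith
    moreover have "(of_nat (nat (- p - 1)) - of_nat (nat (- q - 1)) :: complex) = of_int (q - p)"
      using 1 by (simp add: of_nat_nat)
    ultimately show ?thesis
      using 1 f[unfolded minus_functional_def, rule_format, of "[]" "nat (- p - 1)" "nat (- q - 1)" "l # w"]
      by (simp add: DA_neg)
  next
    case 2
    then show ?thesis by (rule mixed)
  next
    case 3
    have "d_cocycle p q = - d_cocycle q p" by simp
    with mixed[OF 3(2,1)] show ?thesis by (simp add: algebra_simps)
  next
    case 4
    define L where "L = neg_index l"
    have ext: "(\<lambda>v. DA m f (l # v)) =
        (\<lambda>v. DA m ?fl v + of_int (L - m) * DA (m + L) f v + d_cocycle m L * c * f v)"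
      if "m \<ge> 0" for m
      using that by (simp add: L_def)
    have step: "DA m g (l # w) = DA m (\<lambda>v. g (l # v)) w + of_int (L - m) * DA (m + L) g w +
        d_cocycle m L * c * g w" if "m \<ge> 0" for m g
      using that by (simp add: L_def)
    have exp: "DA q (DA p f) (l # w) = DA q (DA p ?fl) w
        + of_int (L - p) * DA q (DA (p + L) f) w
        + d_cocycle p L * c * DA q f w
        + of_int (L - q) * DA (q + L) (DA p f) w
        + d_cocycle q L * c * DA p f w" if "p \<ge> 0" "q \<ge> 0" for p q
      by (simp only: step[OF that(2)] ext[OF that(1)] DA_add DA_scale)
    \<comment> \<open>The 2-cocycle identity for d_p, d_q, d_L. Only p + q + L = 0 needs a
      computation; otherwise all three terms vanish.\<close>
    have coc: "of_int (L - p) * d_cocycle (p + L) q + of_int (L - q) * d_cocycle p (q + L) =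
        of_int (q - p) * d_cocycle (p + q) L"
    proof (cases "p + q + L = 0")
      case True
      then have L: "L = - p - q" by simp
      show ?thesis unfolding L by (simp add: field_simps power3_eq_cube)
    next
      case False
      then have "q \<noteq> - (p + L)" "q + L \<noteq> - p" "L \<noteq> - (p + q)" by linarith+
      then show ?thesis by simp
    qed
    note IH1 = Cons.IH[OF fl, where q = q and p = p] and IH2 = Cons.IH[OF f, where q = q and p = "p + L"]
      and IH3 = Cons.IH[OF f, where q = "q + L" and p = p]
    have "DA q (DA p f) (l # w) - DA p (DA q f) (l # w) =
       (DA q (DA p ?fl) w - DA p (DA q ?fl) w)
       + of_int (L - p) * (DA q (DA (p + L) f) w - DA (p + L) (DA q f) w)
       + of_int (L - q) * (DA (q + L) (DA p f) w - DA p (DA (q + L) f) w)"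
      by (simp only: exp[OF 4] exp[OF 4(2,1)]) (simp add: algebra_simps)
    also have "\<dots> = of_int (q - p) * DA (p + q) ?fl w + d_cocycle p q * c * ?fl w
       + (of_int (L - p) * of_int (q - (p + L)) + of_int (L - q) * of_int (q + L - p)) * DA (p + q + L) f w
       + (of_int (L - p) * d_cocycle (p + L) q + of_int (L - q) * d_cocycle p (q + L)) * c * f w"
      unfolding IH1 IH2 IH3 by (simp add: ring_distribs ac_simps del: of_int_diff of_int_add)
    also have "of_int (L - p) * of_int (q - (p + L)) + of_int (L - q) * of_int (q + L - p) =
        (of_int (q - p) * of_int (L - (p + q)) :: complex)"
      by (simp add: algebra_simps)
    finally show ?thesis
      unfolding coc using 4 by (subst step) (auto simp: ring_distribs mult.assoc simp del: of_int_diff of_int_add)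
  qed
qed

text \<open>This closure lets the dual action be iterated. Letters at the front of a word are
  operators \<open>DA\<close> of negative index, so exchanging them with d_m reduces to
  \<open>DA_commutator\<close> and the Jacobi identity; letters further inside are reached by
  induction on v through the recursion of \<open>dual_act\<close>.\<close>

lemma minus_functional_DA:
  assumes "minus_functional f"
  shows "minus_functional (DA m f)"
  unfolding minus_functional_def
proof (intro allI)
  fix v p q w
  show "DA m f (v @ p # q # w) - DA m f (v @ q # p # w) = (of_nat p - of_nat q) * DA m f (v @ (p + q + 1) # w)"
    using assms
  proof (induction v arbitrary: m f)
    case Nil
    let ?p = "neg_index p" and ?q = "neg_index q"
    have ins: "g (k # u) = DA (neg_index k) g u" for g k u by (simp add: DA_neg)
    have comm: "DA (neg_index k) (DA m f) =
       (\<lambda>u. DA m (DA (neg_index k) f) u + of_int (neg_index k - m) * DA (m + neg_index k) f u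
         + d_cocycle m (neg_index k) * c * f u)" for k
      using DA_commutator[OF Nil, where q = "neg_index k" and p = m] by (auto simp: algebra_simps)
    have two: "DA m f (k # l # w) = DA (neg_index l) (DA m (DA (neg_index k) f)) w
        + of_int (neg_index k - m) * DA (neg_index l) (DA (m + neg_index k) f) w
        + d_cocycle m (neg_index k) * c * DA (neg_index l) f w" for k l
      by (simp only: ins[of "DA m f"] ins[of "DA (neg_index k) (DA m f)"] comm DA_add DA_scale)
    have swap: "DA (neg_index l) (DA m (DA (neg_index k) f)) w = DA m (DA (neg_index l) (DA (neg_index k) f)) w
        + of_int (neg_index l - m) * DA (m + neg_index l) (DA (neg_index k) f) w
        + d_cocycle m (neg_index l) * c * DA (neg_index k) f w" for k l
    proof -
      have "minus_functional (DA (neg_index k) f)"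
        using minus_functional_Cons[OF Nil, of k] by (simp add: DA_neg)
      from DA_commutator[OF this, where q = "neg_index l" and p = m and w = w]
      show ?thesis by (simp add: algebra_simps)
    qed
    have PQ: "neg_index (p + q + 1) = ?p + ?q" by simp
    have pq: "(of_nat p - of_nat q :: complex) = of_int (?q - ?p)" by simp
    have "(\<lambda>u. DA ?q (DA ?p f) u) = (\<lambda>u. DA ?p (DA ?q f) u + of_int (?q - ?p) * DA (?p + ?q) f u)"
      using DA_commutator[OF Nil, where q = ?q and p = ?p] by (auto simp: algebra_simps)
    then have main: "DA m (DA ?q (DA ?p f)) w = DA m (DA ?p (DA ?q f)) w + of_int (?q - ?p) * DA m (DA (?p + ?q) f) w"
      by (simp only: DA_add DA_scale)
    note C1 = DA_commutator[OF Nil, where q = ?q and p = "m + ?p" and w = w]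
      and C2 = DA_commutator[OF Nil, where q = "m + ?q" and p = ?p and w = w]
      and C3 = DA_commutator[OF Nil, where q = "?p + ?q" and p = m and w = w]
    have coc: "of_int (P - m) * d_cocycle (m + P) Q + of_int (Q - m) * d_cocycle P (m + Q) =
        of_int (Q - P) * d_cocycle m (P + Q)" for P Q
    proof (cases "P + Q + m = 0")
      case True
      then have m: "m = - P - Q" by simp
      show ?thesis unfolding m by (simp add: field_simps power3_eq_cube)
    next
      case False
      then have "Q \<noteq> - (m + P)" "m + Q \<noteq> - P" "P + Q \<noteq> - m" by linarith+
      then show ?thesis by simp
    qed
    have "DA m f (p # q # w) - DA m f (q # p # w) =
       (DA m (DA ?q (DA ?p f)) w - DA m (DA ?p (DA ?q f)) w)
       + of_int (?p - m) * (DA ?q (DA (m + ?p) f) w - DA (m + ?p) (DA ?q f) w)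
       + of_int (?q - m) * (DA (m + ?q) (DA ?p f) w - DA ?p (DA (m + ?q) f) w)"
      by (simp only: two swap) (simp add: algebra_simps)
    also have "\<dots> = of_int (?q - ?p) * DA m (DA (?p + ?q) f) w
       + (of_int (?p - m) * of_int (?q - (m + ?p)) + of_int (?q - m) * of_int (m + ?q - ?p)) * DA (m + (?p + ?q)) f w
       + (of_int (?p - m) * d_cocycle (m + ?p) ?q + of_int (?q - m) * d_cocycle ?p (m + ?q)) * c * f w"
      unfolding C1 C2 main by (simp add: ring_distribs ac_simps del: of_int_diff of_int_add)
    also have "of_int (?p - m) * of_int (?q - (m + ?p)) + of_int (?q - m) * of_int (m + ?q - ?p) =
        (of_int (?q - ?p) * of_int (?p + ?q - m) :: complex)"
      by (simp add: algebra_simps)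
    also have "of_int (?q - ?p) * DA m (DA (?p + ?q) f) w
       + of_int (?q - ?p) * of_int (?p + ?q - m) * DA (m + (?p + ?q)) f w
       + (of_int (?p - m) * d_cocycle (m + ?p) ?q + of_int (?q - m) * d_cocycle ?p (m + ?q)) * c * f w
       = of_int (?q - ?p) * (DA m (DA (?p + ?q) f) w
         + (of_int (?p + ?q - m) * DA (m + (?p + ?q)) f w + d_cocycle m (?p + ?q) * c * f w))"
      unfolding coc by (simp only: ring_distribs mult.assoc add.assoc)
    also have "\<dots> = of_int (?q - ?p) * DA (?p + ?q) (DA m f) w"
      unfolding C3[symmetric] by simp
    also have "\<dots> = (of_nat p - of_nat q) * DA m f ((p + q + 1) # w)"
      unfolding ins[of "DA m f" "p + q + 1"] PQ pq ..
    finally show ?case by simp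
  next
    case (Cons l v)
    show ?case
    proof (cases "m < 0")
      case True
      then show ?thesis
        using Cons.prems[unfolded minus_functional_def, rule_format, of "nat (- m - 1) # l # v" p q w]
        by (simp add: DA_neg)
    next
      case False
      note IH1 = Cons.IH[OF minus_functional_Cons[OF Cons.prems, of l], of m]
        and IH2 = Cons.IH[OF Cons.prems, of "m + neg_index l"]
        and P = Cons.prems[unfolded minus_functional_def, rule_format, of v p q w]
      show ?thesis
      proof -
        have step: "DA m f ((l # v) @ u) = DA m (\<lambda>v. f (l # v)) (v @ u) +
            of_int (neg_index l - m) * DA (m + neg_index l) f (v @ u) + d_cocycle m (neg_index l) * c * f (v @ u)" for u
          using False by simp
        have lin: "(a1 + r * a2 + s * a3) - (b1 + r * b2 + s * b3) = t * (c1 + r * c2 + s * c3)"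
          if "a1 - b1 = t * c1" "a2 - b2 = t * c2" "a3 - b3 = t * c3"
          for a1 a2 a3 b1 b2 b3 c1 c2 c3 r s t :: complex
        proof -
          have "(a1 + r * a2 + s * a3) - (b1 + r * b2 + s * b3) = (a1 - b1) + r * (a2 - b2) + s * (a3 - b3)"
            by (simp add: algebra_simps)
          then show ?thesis unfolding that by (simp add: algebra_simps)
        qed
        show ?thesis
          unfolding step by (rule lin[OF IH1 IH2]) (use P minus_functional_Cons[OF Cons.prems, of l, unfolded minus_functional_def] in blast)
      qed
    qed
  qed
qed

section \<open>From the dual action to functionals on U(Vir)\<close>

fun dual_gen :: "vir_gen \<Rightarrow> (nat list \<Rightarrow> complex) \<Rightarrow> nat list \<Rightarrow> complex" where
  "dual_gen (Dgen m) f = DA m f"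
| "dual_gen Cgen f = (\<lambda>w. c * f w)"

text \<open>This is f(g_1 ... g_r u): letters are stripped from the left, each time passing to the
  functional x \<mapsto> f(g x).\<close>

fun dual_eval :: "vir_gen list \<Rightarrow> (nat list \<Rightarrow> complex) \<Rightarrow> complex" where
  "dual_eval [] f = f []"
| "dual_eval (g # w) f = dual_eval w (dual_gen g f)"

lemma dual_gen_add: "dual_gen g (\<lambda>v. f v + f' v) = (\<lambda>w. dual_gen g f w + dual_gen g f' w)"
  by (cases g) (simp_all add: DA_add algebra_simps)

lemma dual_gen_scale: "dual_gen g (\<lambda>v. a * f v) = (\<lambda>w. a * dual_gen g f w)"
  by (cases g) (simp_all add: DA_scale algebra_simps)

lemma dual_eval_add: "dual_eval w (\<lambda>v. f v + f' v) = dual_eval w f + dual_eval w f'"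
  by (induction w arbitrary: f f') (simp_all add: dual_gen_add)

lemma dual_eval_scale: "dual_eval w (\<lambda>v. a * f v) = a * dual_eval w f"
  by (induction w arbitrary: f) (simp_all add: dual_gen_scale)

lemma minus_functional_dual_gen: "minus_functional f \<Longrightarrow> minus_functional (dual_gen g f)"
proof (cases g)
  case Cgen
  assume "minus_functional f"
  then have "c * (f (v @ p # q # w) - f (v @ q # p # w)) = c * ((of_nat p - of_nat q) * f (v @ (p + q + 1) # w))" for v p q w
    by (simp only: minus_functional_def)
  then show ?thesis unfolding Cgen minus_functional_def dual_gen.simps
    by (metis mult.left_commute right_diff_distrib)
qed (simp add: minus_functional_DA)

lemma dual_eval_append_rel:
  assumes "minus_functional f"
    and "\<And>f. minus_functional f \<Longrightarrow> dual_eval x f = a * dual_eval y f + b * dual_eval z f + e * dual_eval u f"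
  shows "dual_eval (v @ x) f = a * dual_eval (v @ y) f + b * dual_eval (v @ z) f + e * dual_eval (v @ u) f"
  using assms(1)
  by (induction v arbitrary: f) (simp_all add: assms(2) minus_functional_dual_gen)

lemma word_functional_dual_eval:
  assumes "minus_functional f"
  shows "word_functional (\<lambda>w. dual_eval w f)"
  unfolding word_functional_def
proof (intro conjI allI)
  fix v m n w g
  have "dual_eval (v @ Dgen m # Dgen n # w) f = 1 * dual_eval (v @ Dgen n # Dgen m # w) f +
      of_int (n - m) * dual_eval (v @ Dgen (m + n) # w) f + d_cocycle m n * dual_eval (v @ Cgen # w) f"
    using assms
  proof (rule dual_eval_append_rel)
    fix f :: "nat list \<Rightarrow> complex" assume f: "minus_functional f"
    have "DA n (DA m f) = (\<lambda>w. (DA m (DA n f) w + of_int (n - m) * DA (m + n) f w) + d_cocycle m n * (c * f w))"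
      using DA_commutator[OF f, where q = n and p = m] by (auto simp: algebra_simps)
    then show "dual_eval (Dgen m # Dgen n # w) f = 1 * dual_eval (Dgen n # Dgen m # w) f +
      of_int (n - m) * dual_eval (Dgen (m + n) # w) f + d_cocycle m n * dual_eval (Cgen # w) f"
      by (simp only: dual_eval.simps dual_gen.simps dual_eval_add dual_eval_scale mult_1_left)
  qed
  then show "dual_eval (v @ Dgen m # Dgen n # w) f - dual_eval (v @ Dgen n # Dgen m # w) f =
      of_int (n - m) * dual_eval (v @ Dgen (m + n) # w) f + d_cocycle m n * dual_eval (v @ Cgen # w) f"
    by (simp only: mult_1_left) (simp only: algebra_simps)
  have "dual_eval (v @ Cgen # g # w) f = 1 * dual_eval (v @ g # Cgen # w) f + 0 * dual_eval [] f + 0 * dual_eval [] f"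
    by (induction v arbitrary: f) (simp_all add: dual_gen_scale)
  then show "dual_eval (v @ Cgen # g # w) f = dual_eval (v @ g # Cgen # w) f"
    by simp
qed

lemma dual_eval_highest_weight:
  "b \<in> borel_gens \<Longrightarrow> dual_eval (w @ [b]) f = highest_weight c h b * dual_eval w f"
  by (induction w arbitrary: f) (auto simp: borel_gens_def)

lemma dual_eval_minus: "dual_eval (map (\<lambda>k. Dgen (neg_index k)) ks) f = f ks"
  by (induction ks arbitrary: f) (simp_all add: DA_neg)

end

text \<open>\<open>dual_eval\<close> respects all relations of U(Vir), and a Borel letter at the
  right end meets u directly; so a functional on U(Vir_-) becomes one on M(c,h).\<close>

lemma minus_functional_extends:
  assumes "minus_functional f"
  obtains F where "U_functional F" "\<And>ks. F (U_mono (map (\<lambda>k. Dgen (neg_index k)) ks)) = f ks"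
    "\<And>x b. b \<in> borel_gens \<Longrightarrow> F (x * Ugen b) = highest_weight c h b * F x"
proof -
  obtain F where F: "U_functional F" "\<And>w. F (U_mono w) = dual_eval c h w f"
    using word_functional_extends[OF word_functional_dual_eval[OF assms, of c h]] by metis
  have "F (x * Ugen b) = highest_weight c h b * F x" if "b \<in> borel_gens" for x b
  proof (induction x rule: U_span_induct)
    case (mono a w)
    have "U_mono w * Ugen b = U_mono (w @ [b])" by simp
    then show ?case
      by (simp only: U_scale_simps U_functionalD[OF F(1)] F(2) dual_eval_highest_weight[OF that]) simp
  qed (simp add: distrib_left distrib_right U_functionalD[OF F(1)])
  with F show thesis by (intro that[of F]) (simp_all only: dual_eval_minus)
qed

section \<open>The left ideals of the Verma module and of its simple quotient\<close>

definition left_ideal :: "Uvir set \<Rightarrow> bool" where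
  "left_ideal S \<longleftrightarrow> 0 \<in> S \<and> (\<forall>x\<in>S. \<forall>y\<in>S. x + y \<in> S) \<and> (\<forall>a. \<forall>x\<in>S. a * x \<in> S)"

lemma left_idealD:
  assumes "left_ideal S"
  shows "0 \<in> S" "x \<in> S \<Longrightarrow> y \<in> S \<Longrightarrow> x + y \<in> S" "x \<in> S \<Longrightarrow> a * x \<in> S"
    "x \<in> S \<Longrightarrow> U_scale r x \<in> S" "x \<in> S \<Longrightarrow> - x \<in> S" "x \<in> S \<Longrightarrow> y \<in> S \<Longrightarrow> x - y \<in> S"
proof -
  show "0 \<in> S" and add: "\<And>x y. x \<in> S \<Longrightarrow> y \<in> S \<Longrightarrow> x + y \<in> S"
    and mult: "\<And>a x. x \<in> S \<Longrightarrow> a * x \<in> S"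
    using assms by (auto simp: left_ideal_def)
  show "x \<in> S \<Longrightarrow> U_scale r x \<in> S" using mult[of x "U_scale r 1"] by (simp add: U_scale_simps)
  show minus: "x \<in> S \<Longrightarrow> - x \<in> S" for x using mult[of x "- 1"] by simp
  show "x \<in> S \<Longrightarrow> y \<in> S \<Longrightarrow> x - y \<in> S" using add[of x "- y"] minus[of y] by simp
qed

lemma left_idealI:
  assumes "0 \<in> S" "\<And>x y. x \<in> S \<Longrightarrow> y \<in> S \<Longrightarrow> x + y \<in> S" "\<And>r x. x \<in> S \<Longrightarrow> U_scale r x \<in> S"
    and "\<And>g x. x \<in> S \<Longrightarrow> Ugen g * x \<in> S"
  shows "left_ideal S"
proof -
  have "a * x \<in> S" if "x \<in> S" for a x
    using that by (induction a rule: U_induct) (auto simp: assms distrib_right U_scale_simps mult.assoc)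
  then show ?thesis using assms by (simp add: left_ideal_def)
qed

section \<open>The annihilator of u in M(c,h)\<close>

context
  fixes c h :: complex
begin

text \<open>Left multiples are built into the rule for the relations, so closing under sums
  suffices. That the coset construction of M(c,h) leads to the same left ideal is shown in
  \<open>VK_iff\<close>.\<close>

inductive_set verma_ideal :: "Uvir set" where
  zero: "0 \<in> verma_ideal"
| rel: "b \<in> borel_gens \<Longrightarrow> x * Ugen b - U_scale (highest_weight c h b) x \<in> verma_ideal"
| add: "x \<in> verma_ideal \<Longrightarrow> y \<in> verma_ideal \<Longrightarrow> x + y \<in> verma_ideal"

lemma left_ideal_verma_ideal: "left_ideal verma_ideal"
proof -
  have "a * x \<in> verma_ideal" if "x \<in> verma_ideal" for a x
    using that
  proof induction
    case (rel b x)
    then show ?case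
      using verma_ideal.rel[of b "a * x"] by (simp add: right_diff_distrib U_scale_right mult.assoc)
  qed (auto simp: distrib_left intro: verma_ideal.intros)
  then show ?thesis by (auto simp: left_ideal_def intro: verma_ideal.intros)
qed

lemmas verma_idealD = left_idealD[OF left_ideal_verma_ideal]

lemma verma_ideal_trans: "x - y \<in> verma_ideal \<Longrightarrow> y - z \<in> verma_ideal \<Longrightarrow> x - z \<in> verma_ideal"
  using verma_idealD(2)[of "x - y" "y - z"] by simp

lemma verma_ideal_cong_left: "x - y \<in> verma_ideal \<Longrightarrow> a * x - a * y \<in> verma_ideal"
  using verma_idealD(3)[of "x - y" a] by (simp add: right_diff_distrib)

lemma verma_ideal_gen:
  "b \<in> borel_gens \<Longrightarrow> Ugen b - U_scale (highest_weight c h b) 1 \<in> verma_ideal"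
  using verma_ideal.rel[of b 1] by simp

lemma verma_ideal_pos: "0 < m \<Longrightarrow> Ugen (Dgen m) \<in> verma_ideal"
  using verma_ideal_gen[of "Dgen m"] by (simp add: borel_gens_def)

text \<open>The spanning half of the triangular decomposition: a generator in front of a word in
  Vir_- is commuted to the right until it joins the word or meets u. Commutator terms are generators
  in front of a shorter word, hence the induction for all generators at once.\<close>

lemma U_minus_plus_verma_ideal: "\<exists>y\<in>U_minus. x - y \<in> verma_ideal"
proof -
  define S where "S = {x. \<exists>y\<in>U_minus. x - y \<in> verma_ideal}"
  have SI: "x \<in> S" if "x - y \<in> verma_ideal" "y \<in> S" for x y
    using that verma_ideal_trans unfolding S_def by blast
  have S_minus: "x \<in> S" if "x \<in> U_minus" for x
    using that verma_idealD(1) by (force simp: S_def)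
  have S_add: "x + y \<in> S" if "x \<in> S" "y \<in> S" for x y
  proof -
    from that obtain x' y' where "x' \<in> U_minus" "y' \<in> U_minus" "x - x' \<in> verma_ideal" "y - y' \<in> verma_ideal"
      unfolding S_def by blast
    then show ?thesis using verma_idealD(2)[of "x - x'" "y - y'"] U_minus.add[of x' y']
      by (auto simp: S_def algebra_simps intro!: bexI[of _ "x' + y'"])
  qed
  have S_mult: "a * x \<in> S" if "x \<in> S" "a \<in> U_minus" for a x
    using that verma_ideal_cong_left U_minus.mult unfolding S_def by blast
  have S_scale: "U_scale r x \<in> S" if "x \<in> S" for r x
    using S_mult[OF that U_minus.scale[OF U_minus.one]] by (simp add: U_scale_simps)
  have mono: "Ugen g * U_mono (map (\<lambda>k :: nat. Dgen (- int k)) ks) \<in> S" if "\<forall>k\<in>set ks. 0 < k" for g ks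
    using that
  proof (induction ks arbitrary: g)
    case Nil
    show ?case
    proof (cases "g \<in> borel_gens")
      case True
      from SI[OF verma_ideal_gen[OF True]] show ?thesis
        by (simp add: S_minus U_minus.one U_minus.scale)
    next
      case False
      then obtain m where "g = Dgen m" "m < 0" by (cases g) (auto simp: borel_gens_def)
      then show ?thesis using U_minus.gen[of "- m"] by (simp add: S_minus)
    qed
  next
    case (Cons k ks)
    let ?x = "U_mono (map (\<lambda>k :: nat. Dgen (- int k)) ks)"
    have k: "Ugen (Dgen (- int k)) \<in> U_minus" using Cons.prems by (intro U_minus.gen) simp
    have IH: "Ugen g * ?x \<in> S" for g using Cons by simp
    show ?case
    proof (cases g)
      case (Dgen m)
      have "Ugen g * (Ugen (Dgen (- int k)) * ?x) = Ugen (Dgen (- int k)) * (Ugen (Dgen m) * ?x)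
         + U_scale (of_int (- int k - m)) (Ugen (Dgen (m + - int k)) * ?x)
         + U_scale (d_cocycle m (- int k)) (Ugen Cgen * ?x)"
        unfolding Dgen mult.assoc[symmetric] U_commutator[of m "- int k"] distrib_right U_scale_simps(3) ..
      then show ?thesis
        using IH k by (simp add: S_add S_mult S_scale del: of_int_diff)
    next
      case Cgen
      have "Ugen g * (Ugen (Dgen (- int k)) * ?x) = Ugen (Dgen (- int k)) * (Ugen g * ?x)"
        unfolding Cgen mult.assoc[symmetric] U_central ..
      then show ?thesis
        using IH k by (simp add: S_mult)
    qed
  qed
  have "x \<in> S"
  proof (induction x rule: U_induct)
    case one
    show ?case by (simp add: S_minus U_minus.one)
  next
    case (gen g x)
    then obtain y where y: "y \<in> U_minus" "x - y \<in> verma_ideal" unfolding S_def by blast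
    from y(1) have "Ugen g * y \<in> S"
      by (induction rule: U_minus_induct) (auto simp: U_scale_right distrib_left simp del: map_map intro: S_scale S_add mono)
    with y(2) show ?case using SI verma_ideal_cong_left by blast
  qed (auto intro: S_add S_scale)
  then show ?thesis by (simp add: S_def)
qed

lemma annihilated_by_large: "\<exists>J. \<forall>j\<ge>J. Ugen (Dgen j) * x \<in> verma_ideal"
proof (induction x rule: U_induct)
  case one
  show ?case using verma_ideal_pos by (intro exI[of _ 1]) simp
next
  case (add x y)
  then obtain J J' where "\<forall>j\<ge>J. Ugen (Dgen j) * x \<in> verma_ideal" "\<forall>j\<ge>J'. Ugen (Dgen j) * y \<in> verma_ideal"
    by blast
  then show ?case by (intro exI[of _ "max J J'"]) (auto simp: distrib_left intro: verma_idealD(2))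
next
  case (scale a x)
  then obtain J where "\<forall>j\<ge>J. Ugen (Dgen j) * x \<in> verma_ideal" by blast
  then show ?case by (intro exI[of _ J]) (simp add: U_scale_right verma_idealD(4))
next
  case (gen g x)
  then obtain J where J: "\<And>j. j \<ge> J \<Longrightarrow> Ugen (Dgen j) * x \<in> verma_ideal" by blast
  show ?case
  proof (cases g)
    case (Dgen m)
    show ?thesis
    \<comment> \<open>\<open>J - m\<close> lets d_(j+m) annihilate x u as well, and
      \<open>1 - m\<close> forces j + m > 0, so that no central term arises.\<close>
    proof (intro exI[of _ "max J (max (J - m) (1 - m))"] allI impI)
      fix j assume j: "max J (max (J - m) (1 - m)) \<le> j"
      then have "m \<noteq> - j" by simp
      then have "Ugen (Dgen j) * (Ugen g * x) = Ugen (Dgen m) * (Ugen (Dgen j) * x)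
         + U_scale (of_int (m - j)) (Ugen (Dgen (j + m)) * x)"
        unfolding Dgen mult.assoc[symmetric] U_commutator[of j m] by (simp add: distrib_right U_scale_simps)
      moreover have "Ugen (Dgen j) * x \<in> verma_ideal" "Ugen (Dgen (j + m)) * x \<in> verma_ideal"
        using j by (auto intro!: J)
      ultimately show "Ugen (Dgen j) * (Ugen g * x) \<in> verma_ideal"
        by (simp only: verma_idealD)
    qed
  next
    case Cgen
    have "Ugen (Dgen j) * (Ugen g * x) = Ugen g * (Ugen (Dgen j) * x)" for j
      unfolding Cgen mult.assoc[symmetric] U_central ..
    then show ?thesis using J verma_idealD(3) by (intro exI[of _ J]) simp
  qed
qed

section \<open>Weights of M(c,h)\<close>

lemma d0_mono: "Ugen (Dgen 0) * U_mono w = U_mono w * Ugen (Dgen 0) + U_scale (of_int (list_degree w)) (U_mono w)"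
proof (induction w)
  case (Cons g w)
  have "Ugen (Dgen 0) * Ugen g = Ugen g * Ugen (Dgen 0) + U_scale (of_int (gen_degree g)) (Ugen g)"
  proof (cases g)
    case (Dgen m)
    have "d_cocycle 0 m = 0" by simp
    then show ?thesis using U_commutator[of 0 m] by (simp add: Dgen del: power3_eq_cube)
  qed (simp add: U_central)
  then have "Ugen (Dgen 0) * (Ugen g * U_mono w) =
      Ugen g * (Ugen (Dgen 0) * U_mono w) + U_scale (of_int (gen_degree g)) (Ugen g * U_mono w)"
    by (simp flip: mult.assoc add: distrib_right U_scale_simps)
  then show ?case
    by (simp add: Cons distrib_left U_scale_right U_scale_add_left mult.assoc)
qed simp

text \<open>Removes the components of weight h + d for all d in the list, and multiplies u itself by
  the product of the numbers -d.\<close>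

definition weight_prod :: "int list \<Rightarrow> Uvir" where
  "weight_prod ds = prod_list (map (\<lambda>d. Ugen (Dgen 0) - U_scale (h + of_int d) 1) ds)"

lemma weight_factor_commute:
  "(Ugen (Dgen 0) - U_scale a 1) * (Ugen (Dgen 0) - U_scale b 1) =
   (Ugen (Dgen 0) - U_scale b 1) * (Ugen (Dgen 0) - U_scale a 1)"
  by (simp add: left_diff_distrib right_diff_distrib U_scale_simps U_scale_right mult.commute U.scale_right_diff_distrib)

lemma weight_prod_commute: "weight_prod ds * weight_prod es = weight_prod es * weight_prod ds"
proof -
  have *: "(Ugen (Dgen 0) - U_scale a 1) * weight_prod es = weight_prod es * (Ugen (Dgen 0) - U_scale a 1)" for a es
  proof (induction es)
    case (Cons d es)
    let ?f = "\<lambda>a. Ugen (Dgen 0) - U_scale a 1"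
    have "?f a * (?f (h + of_int d) * weight_prod es) = ?f (h + of_int d) * (?f a * weight_prod es)"
      by (simp only: mult.assoc[symmetric] weight_factor_commute)
    also have "\<dots> = ?f (h + of_int d) * weight_prod es * ?f a"
      by (simp only: Cons mult.assoc)
    finally show ?case by (simp add: weight_prod_def mult.assoc)
  qed (simp add: weight_prod_def)
  show ?thesis
  proof (induction ds)
    case (Cons d ds)
    let ?f = "Ugen (Dgen 0) - U_scale (h + of_int d) 1"
    have "?f * weight_prod ds * weight_prod es = ?f * weight_prod es * weight_prod ds"
      by (simp only: mult.assoc Cons)
    also have "\<dots> = weight_prod es * (?f * weight_prod ds)"
      by (simp only: * mult.assoc)
    finally show ?case by (simp add: weight_prod_def)
  qed (simp add: weight_prod_def)
qed

lemma weight_prod_append: "weight_prod (ds @ es) = weight_prod ds * weight_prod es"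
  by (simp add: weight_prod_def)

lemma weight_prod_one: "weight_prod ds - U_scale (\<Prod>d\<leftarrow>ds. - of_int d) 1 \<in> verma_ideal"
proof (induction ds)
  case Nil
  show ?case by (simp add: weight_prod_def verma_idealD)
next
  case (Cons d ds)
  let ?f = "Ugen (Dgen 0) - U_scale (h + of_int d) 1" and ?a = "\<Prod>d\<leftarrow>ds. - of_int d :: complex"
  have "?f - U_scale (- of_int d) 1 \<in> verma_ideal"
    using verma_ideal_gen[of "Dgen 0"] by (simp add: borel_gens_def U_scale_add_left algebra_simps)
  then have "U_scale ?a ?f - U_scale ?a (U_scale (- of_int d) 1) \<in> verma_ideal"
    using verma_idealD(4) by (metis U.scale_right_diff_distrib)
  moreover have "?f * weight_prod ds - ?f * U_scale ?a 1 \<in> verma_ideal"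
    by (rule verma_ideal_cong_left) fact
  moreover have "?f * U_scale ?a 1 = U_scale ?a ?f" by (simp add: U_scale_right)
  ultimately have "?f * weight_prod ds - U_scale ?a (U_scale (- of_int d) 1) \<in> verma_ideal"
    using verma_ideal_trans[of "?f * weight_prod ds" "U_scale ?a ?f"] by (simp only:)
  moreover have "U_scale ?a (U_scale (- of_int d) 1) = U_scale (\<Prod>d\<leftarrow>d # ds. - of_int d) 1"
    by (simp add: mult.commute)
  moreover have "weight_prod (d # ds) = ?f * weight_prod ds"
    by (simp add: weight_prod_def)
  ultimately show ?case by (simp only:)
qed

text \<open>A word of degree d sends u to a vector of weight h + d, which the factor for d kills. A
  sum is killed by the concatenated lists, since the factors commute.\<close>

lemma weight_prod_annihilates: "\<exists>ds. weight_prod ds * x \<in> verma_ideal"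
proof (induction x rule: U_span_induct)
  case (mono a w)
  have "U_mono w * Ugen (Dgen 0) - U_scale h (U_mono w) \<in> verma_ideal"
    using verma_ideal.rel[of "Dgen 0" "U_mono w"] by (simp add: borel_gens_def)
  moreover have "weight_prod [list_degree w] * U_mono w = U_mono w * Ugen (Dgen 0) - U_scale h (U_mono w)"
    by (simp add: weight_prod_def left_diff_distrib distrib_right d0_mono U_scale_add_left U_scale_simps)
  ultimately have "weight_prod [list_degree w] * U_scale a (U_mono w) \<in> verma_ideal"
    using verma_idealD(4) by (simp only: U_scale_right)
  then show ?case by blast
next
  case (add x y)
  then obtain ds es where "weight_prod ds * x \<in> verma_ideal" "weight_prod es * y \<in> verma_ideal" by blast
  then have "weight_prod (ds @ es) * (x + y) \<in> verma_ideal"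
  proof -
    assume x: "weight_prod ds * x \<in> verma_ideal" and y: "weight_prod es * y \<in> verma_ideal"
    have "weight_prod (ds @ es) * (x + y) = weight_prod es * (weight_prod ds * x) + weight_prod ds * (weight_prod es * y)"
      by (simp only: weight_prod_append distrib_left weight_prod_commute[of es ds] mult.assoc[symmetric])
    then show ?thesis using x y by (simp only: verma_idealD(2,3))
  qed
  then show ?case by blast
qed

section \<open>Functionals on U(Vir_-) as functionals on M(c,h)\<close>

lemma verma_extend_exists:
  assumes G: "U_functional G"
  shows "\<exists>F. U_functional F \<and> (\<forall>x\<in>U_minus. F x = G x) \<and>
    (\<forall>x. \<forall>b\<in>borel_gens. F (x * Ugen b) = highest_weight c h b * F x)"
proof -
  let ?f = "\<lambda>ks. G (U_mono (map (\<lambda>k. Dgen (neg_index k)) ks))"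
  have "minus_functional ?f"
    unfolding minus_functional_def
  proof (intro allI)
    fix v p q w
    let ?v = "U_mono (map (\<lambda>k. Dgen (neg_index k)) v)" and ?w = "U_mono (map (\<lambda>k. Dgen (neg_index k)) w)"
    have neg: "neg_index p + neg_index q = neg_index (p + q + 1)" by simp
    have "d_cocycle (neg_index p) (neg_index q) = 0" by simp
    then have "Ugen (Dgen (neg_index p)) * Ugen (Dgen (neg_index q)) =
      Ugen (Dgen (neg_index q)) * Ugen (Dgen (neg_index p)) +
      U_scale (of_nat p - of_nat q) (Ugen (Dgen (neg_index (p + q + 1))))"
      using U_commutator[of "neg_index p" "neg_index q"] unfolding neg by simp
    from arg_cong[OF this, of "\<lambda>x. G (?v * (x * ?w))"]
    show "?f (v @ p # q # w) - ?f (v @ q # p # w) = (of_nat p - of_nat q) * ?f (v @ (p + q + 1) # w)"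
      by (simp add: U_functionalD[OF G] distrib_left distrib_right U_scale_simps U_scale_right mult.assoc)
  qed
  then obtain F where F: "U_functional F" "\<And>ks. F (U_mono (map (\<lambda>k. Dgen (neg_index k)) ks)) = ?f ks"
    "\<And>x b. b \<in> borel_gens \<Longrightarrow> F (x * Ugen b) = highest_weight c h b * F x"
    by (rule minus_functional_extends[where c = c and h = h]) (rule that)
  have "F x = G x" if "x \<in> U_minus" for x
    using that
  proof (induction rule: U_minus_induct)
    case (mono a ks)
    have "map (\<lambda>k :: nat. Dgen (- int k)) ks = map (\<lambda>k. Dgen (neg_index k)) (map (\<lambda>k. k - 1) ks)"
      using mono by (auto simp: of_nat_diff)
    then show ?case by (simp only: U_functionalD[OF F(1)] U_functionalD[OF G] F(2))
  qed (simp add: U_functionalD[OF F(1)] U_functionalD[OF G])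
  with F show ?thesis by blast
qed

text \<open>Keeps the values of G on U(Vir_-) and replaces all others by those that the highest
  weight relations force. By \<open>U_minus_plus_verma_ideal\<close> these conditions determine the
  result.\<close>

definition verma_extend :: "(Uvir \<Rightarrow> complex) \<Rightarrow> Uvir \<Rightarrow> complex" where
  "verma_extend G = (SOME F. U_functional F \<and> (\<forall>x\<in>U_minus. F x = G x) \<and>
    (\<forall>x. \<forall>b\<in>borel_gens. F (x * Ugen b) = highest_weight c h b * F x))"

lemma verma_extend:
  assumes "U_functional G"
  shows "U_functional (verma_extend G)" "x \<in> U_minus \<Longrightarrow> verma_extend G x = G x"
    "b \<in> borel_gens \<Longrightarrow> verma_extend G (x * Ugen b) = highest_weight c h b * verma_extend G x"
    "x \<in> verma_ideal \<Longrightarrow> verma_extend G x = 0"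
proof -
  note * = someI_ex[OF verma_extend_exists[OF assms], folded verma_extend_def]
  show F: "U_functional (verma_extend G)" by (rule conjunct1[OF *])
  show "x \<in> U_minus \<Longrightarrow> verma_extend G x = G x"
    by (rule bspec[OF conjunct1[OF conjunct2[OF *]]])
  show rel: "b \<in> borel_gens \<Longrightarrow> verma_extend G (x * Ugen b) = highest_weight c h b * verma_extend G x" for b x
    using conjunct2[OF conjunct2[OF *]] by blast
  show "x \<in> verma_ideal \<Longrightarrow> verma_extend G x = 0"
    by (induction rule: verma_ideal.induct) (simp_all add: U_functionalD[OF F] rel)
qed

end

text \<open>The counit of U(Vir). It kills every nonempty word, so both sides of every relation are
  0.\<close>

definition augmentation :: "Uvir \<Rightarrow> complex" where
  "augmentation = (SOME F. U_functional F \<and> (\<forall>w. F (U_mono w) = (if w = [] then 1 else 0)))"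

lemma augmentation:
  "U_functional augmentation" "augmentation (U_mono w) = (if w = [] then 1 else 0)"
proof -
  have "word_functional (\<lambda>w. if w = [] then 1 else 0)"
    by (simp add: word_functional_def)
  then have "\<exists>F. U_functional F \<and> (\<forall>w. F (U_mono w) = (if w = [] then 1 else 0))"
    by (rule word_functional_extends) blast
  from someI_ex[OF this, folded augmentation_def]
  show "U_functional augmentation" "augmentation (U_mono w) = (if w = [] then 1 else 0)"
    by blast+
qed

section \<open>The maximal left ideal and the simple quotient\<close>

context
  fixes c h :: complex
begin

abbreviation "VI \<equiv> verma_ideal c h"

text \<open>The coefficient of \<open>u\<close>; its radical is the left ideal of the simple quotient.\<close>

definition verma_coeff :: "Uvir \<Rightarrow> complex" where
  "verma_coeff = verma_extend c h augmentation"

definition verma_radical :: "Uvir set" where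
  "verma_radical = {x. \<forall>y. verma_coeff (y * x) = 0}"

lemma verma_coeff_functional: "U_functional verma_coeff"
  unfolding verma_coeff_def by (rule verma_extend(1)[OF augmentation(1)])

lemmas verma_coeffD = U_functionalD[OF verma_coeff_functional]

lemma verma_coeff_VI: "x \<in> VI \<Longrightarrow> verma_coeff x = 0"
  unfolding verma_coeff_def by (rule verma_extend(4)[OF augmentation(1)])

lemma verma_coeff_borel: "b \<in> borel_gens \<Longrightarrow> verma_coeff (x * Ugen b) = highest_weight c h b * verma_coeff x"
  unfolding verma_coeff_def by (rule verma_extend(3)[OF augmentation(1)])

lemma verma_coeff_mono:
  assumes "\<forall>k\<in>set ks. 0 < k"
  shows "verma_coeff (U_mono (map (\<lambda>k :: nat. Dgen (- int k)) ks)) = (if ks = [] then 1 else 0)"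
proof -
  have "U_mono (map (\<lambda>k :: nat. Dgen (- int k)) ks) \<in> U_minus"
    using prod_list_U_minus[OF assms] by (simp add: comp_def)
  from verma_extend(2)[OF augmentation(1) this] show ?thesis
    unfolding verma_coeff_def augmentation(2) by simp
qed

lemma verma_coeff_one: "verma_coeff 1 = 1"
  using verma_coeff_mono[of "[]"] by simp

lemma left_ideal_radical: "left_ideal verma_radical"
  by (auto simp: left_ideal_def verma_radical_def verma_coeffD distrib_left simp flip: mult.assoc)

lemmas verma_radicalD = left_idealD[OF left_ideal_radical]

lemma VI_subset_radical: "x \<in> VI \<Longrightarrow> x \<in> verma_radical"
  using verma_idealD(3) verma_coeff_VI by (auto simp: verma_radical_def)

text \<open>The coefficient of u in u is 1, a value secured by extending the counit from U(Vir_-) to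
  M(c,h); so u does not vanish in V(c,h).\<close>

lemma one_notin_radical: "1 \<notin> verma_radical"
  by (auto simp: verma_radical_def verma_coeff_one intro!: exI[of _ 1])

lemma weight_prod_mono:
  "weight_prod h [list_degree w] * U_mono w = U_mono w * Ugen (Dgen 0) - U_scale h (U_mono w)"
  by (simp add: weight_prod_def left_diff_distrib distrib_right d0_mono U_scale_add_left U_scale_simps)

text \<open>A projection of x u to the line of u. Each nonempty word in Vir_- has negative degree,
  so a factor with nonzero d kills it; keeping 0 out of the list keeps the scalar in front of u
  nonzero.\<close>

lemma weight_prod_coeff:
  "\<exists>ds. 0 \<notin> set ds \<and> weight_prod h ds * x - U_scale ((\<Prod>d\<leftarrow>ds. - of_int d) * verma_coeff x) 1 \<in> VI"
proof -
  obtain y where y: "y \<in> U_minus" "x - y \<in> VI" using U_minus_plus_verma_ideal by blast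
  have "\<exists>ds. 0 \<notin> set ds \<and> weight_prod h ds * y - U_scale ((\<Prod>d\<leftarrow>ds. - of_int d) * verma_coeff y) 1 \<in> VI"
    using y(1)
  proof (induction rule: U_minus_induct)
    case (mono a ks)
    show ?case
    proof (cases "ks = []")
      case True
      then show ?thesis
        by (intro exI[of _ "[]"]) (simp add: weight_prod_def verma_coeffD verma_coeff_one verma_idealD)
    next
      case False
      let ?w = "map (\<lambda>k :: nat. Dgen (- int k)) ks"
      have "list_degree ?w < 0" using False mono
      proof (induction ks)
        case (Cons k ks)
        then show ?case by (cases "ks = []") auto
      qed simp
      moreover have "U_mono ?w * Ugen (Dgen 0) - U_scale h (U_mono ?w) \<in> VI"
        using verma_ideal.rel[of "Dgen 0" "U_mono ?w" c h] by (simp add: borel_gens_def)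
      ultimately have "weight_prod h [list_degree ?w] * U_scale a (U_mono ?w) \<in> VI"
        using verma_idealD(4) by (simp only: U_scale_right weight_prod_mono)
      moreover have "verma_coeff (U_scale a (U_mono ?w)) = 0"
        by (simp only: verma_coeffD verma_coeff_mono[OF mono]) (simp add: False)
      ultimately show ?thesis
        using \<open>list_degree ?w < 0\<close> by (intro exI[of _ "[list_degree ?w]"]) simp
    qed
  next
    case (add x y)
    then obtain ds es where ds: "0 \<notin> set ds" "0 \<notin> set es"
      "weight_prod h ds * x - U_scale ((\<Prod>d\<leftarrow>ds. - of_int d) * verma_coeff x) 1 \<in> VI"
      "weight_prod h es * y - U_scale ((\<Prod>d\<leftarrow>es. - of_int d) * verma_coeff y) 1 \<in> VI" by blast
    let ?a = "\<Prod>d\<leftarrow>ds. - of_int d :: complex" and ?b = "\<Prod>d\<leftarrow>es. - of_int d :: complex"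
    let ?D = "weight_prod h ds" and ?E = "weight_prod h es"
    \<comment> \<open>Each operator reduces its own summand to a multiple of 1; the other operator
      then acts on this remainder through \<open>weight_prod_one\<close>.\<close>
    have 1: "?E * (?D * x) - U_scale (?a * verma_coeff x) ?E \<in> VI"
      using verma_ideal_cong_left[OF ds(3), of ?E] by (simp add: U_scale_right)
    have 2: "U_scale (?a * verma_coeff x) ?E - U_scale (?a * verma_coeff x) (U_scale ?b 1) \<in> VI"
      using verma_idealD(4)[OF weight_prod_one[of h es c], of "?a * verma_coeff x"]
      by (simp only: U.scale_right_diff_distrib)
    have 3: "?D * (?E * y) - U_scale (?b * verma_coeff y) ?D \<in> VI"
      using verma_ideal_cong_left[OF ds(4), of ?D] by (simp add: U_scale_right)
    have 4: "U_scale (?b * verma_coeff y) ?D - U_scale (?b * verma_coeff y) (U_scale ?a 1) \<in> VI"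
      using verma_idealD(4)[OF weight_prod_one[of h ds c], of "?b * verma_coeff y"]
      by (simp only: U.scale_right_diff_distrib)
    from verma_idealD(2)[OF verma_ideal_trans[OF 1 2] verma_ideal_trans[OF 3 4]]
    have "(?E * (?D * x) + ?D * (?E * y)) - U_scale (?a * ?b * (verma_coeff x + verma_coeff y)) 1 \<in> VI"
      by (simp add: U_scale_simps U_scale_add_left algebra_simps)
    moreover have "weight_prod h (ds @ es) * (x + y) = ?E * (?D * x) + ?D * (?E * y)"
      by (simp only: weight_prod_append distrib_left weight_prod_commute[of h es ds] mult.assoc[symmetric])
    ultimately have "weight_prod h (ds @ es) * (x + y) - U_scale ((\<Prod>d\<leftarrow>ds @ es. - of_int d) * verma_coeff (x + y)) 1 \<in> VI"
      by (simp add: verma_coeffD)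
    with ds(1,2) show ?case by (intro exI[of _ "ds @ es"]) simp
  qed
  then obtain ds where ds: "0 \<notin> set ds"
    "weight_prod h ds * y - U_scale ((\<Prod>d\<leftarrow>ds. - of_int d) * verma_coeff y) 1 \<in> VI" by blast
  have "verma_coeff x = verma_coeff y"
    using verma_coeff_VI[OF y(2)] by (simp add: verma_coeffD)
  with ds verma_ideal_trans[OF verma_ideal_cong_left[OF y(2), of "weight_prod h ds"] ds(2)]
  show ?thesis by auto
qed

text \<open>Some y x u has a nonzero coefficient at u, and \<open>weight_prod_coeff\<close> isolates
  it; thus x u generates u already in M(c,h).\<close>

lemma notin_radical_generates:
  assumes "x \<notin> verma_radical"
  shows "\<exists>t. t * x - 1 \<in> VI"
proof -
  from assms obtain y where y: "verma_coeff (y * x) \<noteq> 0" by (auto simp: verma_radical_def)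
  obtain ds where ds: "0 \<notin> set ds"
    "weight_prod h ds * (y * x) - U_scale ((\<Prod>d\<leftarrow>ds. - of_int d) * verma_coeff (y * x)) 1 \<in> VI"
    using weight_prod_coeff by blast
  let ?a = "(\<Prod>d\<leftarrow>ds. - of_int d) * verma_coeff (y * x)"
  have "(\<Prod>d\<leftarrow>ds. - of_int d :: complex) \<noteq> 0" using ds(1) by (induction ds) auto
  then have "?a \<noteq> 0" using y by simp
  with verma_idealD(4)[OF ds(2), of "1 / ?a"]
  have "U_scale (1 / ?a) (weight_prod h ds * y) * x - 1 \<in> VI"
    by (simp add: U.scale_right_diff_distrib U_scale_simps mult.assoc)
  then show ?thesis by blast
qed

lemma left_ideal_eq_UNIV:
  assumes "left_ideal S" "verma_radical \<subseteq> S" "x \<in> S" "x \<notin> verma_radical"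
  shows "S = UNIV"
proof -
  obtain t where t: "t * x - 1 \<in> VI" using notin_radical_generates[OF assms(4)] by blast
  then have "t * x - (t * x - 1) \<in> S"
    using assms VI_subset_radical left_idealD(3,6)[OF assms(1)] by blast
  then have "1 \<in> S" by simp
  then show ?thesis using left_idealD(3)[OF assms(1), of 1] by auto
qed

lemma proper_left_ideal_subset_radical:
  assumes "left_ideal S" "VI \<subseteq> S" "S \<noteq> UNIV"
  shows "S \<subseteq> verma_radical"
proof
  fix x assume x: "x \<in> S"
  show "x \<in> verma_radical"
  proof (rule ccontr)
    assume "x \<notin> verma_radical"
    then obtain t where t: "t * x - 1 \<in> VI" using notin_radical_generates by blast
    then have "t * x - (t * x - 1) \<in> S"
      using assms x left_idealD(3,6)[OF assms(1)] by blast
    then have "1 \<in> S" by simp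
    then have "S = UNIV" using left_idealD(3)[OF assms(1), of 1] by auto
    with assms(3) show False by simp
  qed
qed

text \<open>In M(c,h), d_k d_(-k) u = k (-2 h + (k^2 - 1) c / 12) u for k > 0, and this vanishes for
  at most finitely many k unless c = h = 0.\<close>

lemma d_neg_notin_radical:
  assumes "c \<noteq> 0 \<or> h \<noteq> 0"
  shows "\<exists>K. \<forall>k\<ge>K. Ugen (Dgen (- k)) \<notin> verma_radical"
proof -
  have val: "verma_coeff (Ugen (Dgen k) * Ugen (Dgen (- k))) = of_int k * (- 2 * h + of_int (k ^ 2 - 1) * c / 12)"
    if "k > 0" for k
  proof -
    have "verma_coeff (Ugen (Dgen k)) = 0" "verma_coeff (Ugen (Dgen 0)) = h" "verma_coeff (Ugen Cgen) = c"
      using verma_coeff_borel[of _ 1] that by (auto simp: borel_gens_def verma_coeff_one)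
    moreover have "verma_coeff (Ugen (Dgen (- k)) * Ugen (Dgen k)) = 0"
      using verma_coeff_borel[of "Dgen k" "Ugen (Dgen (- k))"] that by (simp add: borel_gens_def)
    ultimately show ?thesis
      using arg_cong[OF U_commutator[of k "- k"], of verma_coeff]
      by (simp add: verma_coeffD) (simp add: field_simps power2_eq_square power3_eq_cube)
  qed
  \<comment> \<open>A zero k satisfies (k^2 - 1) c = 24 h. If c is nonzero, k \<ge> K makes k^2 - 1
    exceed the norm of 24 h / c. If c = 0, the quotient is 0 by convention, K = 2, and h = 0 would
    follow.\<close>
  define K :: int where "K = 2 + \<lceil>norm (24 * h / c)\<rceil>"
  have "Ugen (Dgen (- k)) \<notin> verma_radical" if k: "k \<ge> K" for k
  proof
    have K2: "K \<ge> 2" unfolding K_def using norm_ge_zero[of "24 * h / c"] by linarith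
    assume "Ugen (Dgen (- k)) \<in> verma_radical"
    then have "of_int k * (- 2 * h + of_int (k ^ 2 - 1) * c / 12) = 0"
      using val[of k] k K2 by (simp add: verma_radical_def)
    then have "- 2 * h + of_int (k ^ 2 - 1) * c / 12 = 0"
      using k K2 by (metis mult_eq_0_iff not_numeral_le_zero of_int_eq_0_iff order_trans)
    then have eq: "of_int (k ^ 2 - 1) * c = 24 * h"
      by (simp add: field_simps)
    show False
    proof (cases "c = 0")
      case True
      then show False using eq assms by simp
    next
      case False
      then have "of_int (k ^ 2 - 1) = 24 * h / c" using eq by (simp add: field_simps)
      then have "norm (of_int (k ^ 2 - 1) :: complex) = norm (24 * h / c)" by simp
      then have "real_of_int \<bar>k ^ 2 - 1\<bar> = norm (24 * h / c)" by (simp only: norm_of_int)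
      also have "\<dots> \<le> of_int (K - 2)" unfolding K_def by linarith
      finally have "k ^ 2 - 1 \<le> K - 2" by linarith
      moreover have "k ^ 2 \<ge> 2 * k" unfolding power2_eq_square using k K2 by (intro mult_right_mono) auto
      ultimately show False using k K2 by linarith
    qed
  qed
  then show ?thesis by blast
qed

text \<open>Some \<open>weight_prod\<close> annihilates x u, yet on an eigenvector of d_0 with
  eigenvalue \<mu> it acts as the product of the numbers \<mu> - (h + d); one of these must
  vanish.\<close>

lemma weight_vector_in_radical:
  assumes "Ugen (Dgen 0) * x - U_scale \<mu> x \<in> verma_radical" "x \<notin> verma_radical"
  shows "\<exists>d::int. \<mu> = h + of_int d"
proof (rule ccontr)
  assume "\<not> ?thesis"
  then have ne: "\<mu> - (h + of_int d) \<noteq> 0" for d :: int by (metis eq_iff_diff_eq_0)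
  have *: "weight_prod h ds * x - U_scale (\<Prod>d\<leftarrow>ds. \<mu> - (h + of_int d)) x \<in> verma_radical" for ds
  proof (induction ds)
    case Nil
    show ?case by (simp add: weight_prod_def U_scale_simps verma_radicalD)
  next
    case (Cons d ds)
    let ?a = "\<Prod>d\<leftarrow>ds. \<mu> - (h + of_int d)" and ?f = "Ugen (Dgen 0) - U_scale (h + of_int d) 1"
    have 1: "?f * (weight_prod h ds * x - U_scale ?a x) \<in> verma_radical" by (rule verma_radicalD(3)) fact
    have 2: "U_scale ?a (Ugen (Dgen 0) * x - U_scale \<mu> x) \<in> verma_radical" by (rule verma_radicalD(4)) fact
    have "?f * (weight_prod h ds * x - U_scale ?a x) + U_scale ?a (Ugen (Dgen 0) * x - U_scale \<mu> x)
        = weight_prod h (d # ds) * x - U_scale (\<Prod>d\<leftarrow>d # ds. \<mu> - (h + of_int d)) x"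
      by (simp add: weight_prod_def right_diff_distrib left_diff_distrib U_scale_right U_scale_simps
          U.scale_right_diff_distrib U.scale_left_diff_distrib U_scale_add_left mult.assoc algebra_simps)
    with verma_radicalD(2)[OF 1 2] show ?case by simp
  qed
  obtain ds where ds: "weight_prod h ds * x \<in> VI" using weight_prod_annihilates by blast
  let ?a = "\<Prod>d\<leftarrow>ds. \<mu> - (h + of_int d)"
  have "?a \<noteq> 0" using ne by (induction ds) auto
  have "weight_prod h ds * x - (weight_prod h ds * x - U_scale ?a x) \<in> verma_radical"
    by (rule verma_radicalD(6)[OF VI_subset_radical[OF ds] *])
  then have "U_scale (1 / ?a) (U_scale ?a x) \<in> verma_radical"
    by (intro verma_radicalD(4)[of "U_scale ?a x"]) simp
  with \<open>?a \<noteq> 0\<close> assms(2) show False by (simp add: U_scale_simps)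
qed

end

text \<open>For c = h = 0 every Borel generator acts on u by 0. The counit then vanishes on the
  annihilator of u, so it is the coefficient of u, and it kills every product that ends in a
  generator.\<close>

lemma radical_trivial: "Ugen g \<in> verma_radical 0 0"
proof -
  have aug: "augmentation (x * Ugen g) = 0" for x g
  proof (induction x rule: U_span_induct)
    case (mono a w)
    have "U_mono w * Ugen g = U_mono (w @ [g])" by simp
    then show ?case by (simp only: U_functionalD[OF augmentation(1)] U_scale_simps augmentation(2)) simp
  qed (simp add: distrib_right U_functionalD[OF augmentation(1)])
  have VI: "augmentation x = 0" if "x \<in> verma_ideal 0 0" for x
    using that
  proof induction
    case (rel b x)
    have "highest_weight 0 0 b = 0" by (cases b) simp_all
    then show ?case by (simp add: aug)
  qed (simp_all add: U_functionalD[OF augmentation(1)])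
  have "verma_coeff 0 0 x = augmentation x" for x
  proof -
    obtain y where y: "y \<in> U_minus" "x - y \<in> verma_ideal 0 0" using U_minus_plus_verma_ideal by blast
    have "verma_coeff 0 0 y = augmentation y"
      unfolding verma_coeff_def by (rule verma_extend(2)[OF augmentation(1) y(1)])
    moreover have "verma_coeff 0 0 x = verma_coeff 0 0 y"
      using verma_coeff_VI[OF y(2)] by (simp add: verma_coeffD)
    moreover have "augmentation x = augmentation y"
      using VI[OF y(2)] by (simp add: U_functionalD[OF augmentation(1)])
    ultimately show ?thesis by simp
  qed
  then show ?thesis by (simp add: verma_radical_def aug)
qed

section \<open>Homogeneous parts of \<open>\<phi>\<^sub>n\<close>\<close>

context
  fixes \<alpha> \<beta> :: complex
begin

text \<open>phi_n cut down to words of degree d; well defined because \<open>phi_list\<close>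
  respects the relations and these are homogeneous. The parts are needed separately since the
  functional on the tensor product evaluates only the degree n - i part at v_i.\<close>

definition phi_part :: "int \<Rightarrow> int \<Rightarrow> Uvir \<Rightarrow> complex" where
  "phi_part n d = (SOME F. U_functional F \<and>
     (\<forall>w. F (U_mono w) = (if list_degree w = d then phi_list \<alpha> \<beta> n w else 0)))"

lemma phi_part:
  "U_functional (phi_part n d)"
  "phi_part n d (U_mono w) = (if list_degree w = d then phi_list \<alpha> \<beta> n w else 0)"
proof -
  have "word_functional (\<lambda>w. if list_degree w = d then phi_list \<alpha> \<beta> n w else 0)"
    unfolding word_functional_def
    by (auto simp: phi_list_append algebra_simps)
  then have "\<exists>F. U_functional F \<and> (\<forall>w. F (U_mono w) = (if list_degree w = d then phi_list \<alpha> \<beta> n w else 0))"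
    by (rule word_functional_extends) blast
  from someI_ex[OF this, folded phi_part_def]
  show "U_functional (phi_part n d)"
    "phi_part n d (U_mono w) = (if list_degree w = d then phi_list \<alpha> \<beta> n w else 0)"
    by blast+
qed

lemmas phi_partD = U_functionalD[OF phi_part(1)]

lemma phi_U_functional: "U_functional (phi_U \<alpha> \<beta> n)"
proof -
  have "phi_U \<alpha> \<beta> n (x + y) = phi_U \<alpha> \<beta> n x + phi_U \<alpha> \<beta> n y" for x y
    by transfer (rule phi_tensor_add)
  moreover have "phi_U \<alpha> \<beta> n (U_scale a x) = a * phi_U \<alpha> \<beta> n x" for a x
    by transfer (rule phi_tensor_scale)
  ultimately show ?thesis by (simp add: U_functional_def)
qed

lemma phi_U_mono: "phi_U \<alpha> \<beta> n (U_mono w) = phi_list \<alpha> \<beta> n w"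
  by (simp add: prod_list_Ugen phi_U.abs_eq)

lemma phi_eq_phi_U: "x \<in> U_minus \<Longrightarrow> phi \<alpha> \<beta> n x = phi_U \<alpha> \<beta> n x"
  by (rule is_phi_unique[OF is_phi_phi is_phi_phi_U])

lemma phi_part_mult:
  "phi_part n d (U_mono w * x) =
     phi_list \<alpha> \<beta> (n - (d - list_degree w)) w * phi_part n (d - list_degree w) x"
proof (induction x rule: U_span_induct)
  case (mono a v)
  have "U_mono w * U_mono v = U_mono (w @ v)" by simp
  moreover have "phi_part n d (U_mono (w @ v)) =
     phi_list \<alpha> \<beta> (n - (d - list_degree w)) w * phi_part n (d - list_degree w) (U_mono v)"
    unfolding phi_part(2) phi_list_append list_degree_simps by auto
  ultimately show ?case
    by (simp only: U_scale_right phi_partD mult.left_commute)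
qed (simp only: distrib_left phi_partD)

text \<open>Composing \<open>phi_part n d\<close> with x \<mapsto> [d_0, x] multiplies it by d,
  whereas homogeneity of x yields the factor m.\<close>

lemma phi_part_homogeneous:
  assumes "U_homogeneous m x" "d \<noteq> m"
  shows "phi_part n d x = 0"
proof -
  have "phi_part n d (Ugen (Dgen 0) * x - x * Ugen (Dgen 0)) = of_int d * phi_part n d x" for x
  proof (induction x rule: U_span_induct)
    case (mono a w)
    then show ?case
      by (simp add: U_scale_right U_scale_simps d0_mono phi_partD phi_part(2))
  qed (simp only: distrib_left distrib_right phi_partD, simp add: algebra_simps)
  then have "of_int m * phi_part n d x = of_int d * phi_part n d x"
    using assms(1) unfolding U_homogeneous_def by (metis phi_partD(2))
  with assms(2) show ?thesis by simp
qed

text \<open>Stated for all finite supersets so that the degree sets of two summands can be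
  merged.\<close>

lemma phi_U_sum_parts: "\<exists>A. finite A \<and> (\<forall>B. finite B \<and> A \<subseteq> B \<longrightarrow> phi_U \<alpha> \<beta> n x = (\<Sum>d\<in>B. phi_part n d x))"
proof (induction x rule: U_span_induct)
  case (mono a w)
  show ?case
    by (intro exI[of _ "{list_degree w}"])
       (auto simp: U_functionalD[OF phi_U_functional] phi_partD phi_U_mono phi_part(2) sum.delta if_distrib cong: if_cong)
next
  case (add x y)
  then obtain A A' where "finite A" "\<forall>B. finite B \<and> A \<subseteq> B \<longrightarrow> phi_U \<alpha> \<beta> n x = (\<Sum>d\<in>B. phi_part n d x)"
    "finite A'" "\<forall>B. finite B \<and> A' \<subseteq> B \<longrightarrow> phi_U \<alpha> \<beta> n y = (\<Sum>d\<in>B. phi_part n d y)"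
    by blast
  then show ?case
    by (intro exI[of _ "A \<union> A'"]) (auto simp: U_functionalD[OF phi_U_functional] phi_partD sum.distrib)
qed

lemma phi_U_homogeneous:
  assumes "U_homogeneous m x"
  shows "phi_U \<alpha> \<beta> n x = phi_part n m x"
proof -
  obtain A where A: "finite A" "\<forall>B. finite B \<and> A \<subseteq> B \<longrightarrow> phi_U \<alpha> \<beta> n x = (\<Sum>d\<in>B. phi_part n d x)"
    using phi_U_sum_parts[of n x] by (elim exE conjE)
  have "phi_U \<alpha> \<beta> n x = (\<Sum>d\<in>insert m A. phi_part n d x)" by (rule A(2)[rule_format]) (use A(1) in auto)
  also have "\<dots> = (\<Sum>d\<in>{m}. phi_part n d x)"
    using A(1) phi_part_homogeneous[OF assms] by (intro sum.mono_neutral_right) auto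
  finally show ?thesis by simp
qed

text \<open>phi_n records the action on the n-th dual basis vector of V_(\<alpha>,\<beta>). A
  homogeneous Q with phi_n(Q) = 0 annihilates this vector, hence so does every x Q.\<close>

lemma phi_part_left_multiple_zero:
  assumes "U_homogeneous m Q" "phi_U \<alpha> \<beta> n Q = 0"
  shows "phi_part n d (x * Q) = 0"
proof (induction x rule: U_span_induct)
  case (mono a w)
  have "phi_part n (d - list_degree w) Q = 0"
    using phi_part_homogeneous[OF assms(1)] assms(2) phi_U_homogeneous[OF assms(1)] by metis
  then show ?case by (simp add: U_scale_simps phi_partD phi_part_mult)
qed (simp add: distrib_right phi_partD)

end

text \<open>\<open>phi_part\<close> comes from the dual of V_(\<alpha>,\<beta>), where C and Vir_+
  do not act as they do on u. Its values on U(Vir_-) are kept and all others are adapted to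
  M(c,h).\<close>

definition verma_phi :: "complex \<Rightarrow> complex \<Rightarrow> complex \<Rightarrow> complex \<Rightarrow> int \<Rightarrow> int \<Rightarrow> Uvir \<Rightarrow> complex" where
  "verma_phi c h \<alpha> \<beta> n d = verma_extend c h (phi_part \<alpha> \<beta> n d)"

context
  fixes c h \<alpha> \<beta> :: complex
begin

lemma verma_phi_functional: "U_functional (verma_phi c h \<alpha> \<beta> n d)"
  unfolding verma_phi_def by (rule verma_extend(1)[OF phi_part(1)])

lemmas verma_phiD = U_functionalD[OF verma_phi_functional]

lemma verma_phi_U_minus: "x \<in> U_minus \<Longrightarrow> verma_phi c h \<alpha> \<beta> n d x = phi_part \<alpha> \<beta> n d x"
  unfolding verma_phi_def by (rule verma_extend(2)[OF phi_part(1)])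

lemma verma_phi_VI: "x \<in> verma_ideal c h \<Longrightarrow> verma_phi c h \<alpha> \<beta> n d x = 0"
  unfolding verma_phi_def by (rule verma_extend(4)[OF phi_part(1)])

lemma verma_phi_cong: "x - y \<in> verma_ideal c h \<Longrightarrow> verma_phi c h \<alpha> \<beta> n d x = verma_phi c h \<alpha> \<beta> n d y"
  using verma_phi_VI[of "x - y"] by (simp add: verma_phiD)

lemma verma_phi_d_neg:
  assumes "k > 0"
  shows "verma_phi c h \<alpha> \<beta> n d (Ugen (Dgen (- k)) * x) =
    (of_int k * \<beta> - \<alpha> - of_int (n - d)) * verma_phi c h \<alpha> \<beta> n (d + k) x"
proof -
  obtain y where y: "y \<in> U_minus" "x - y \<in> verma_ideal c h" using U_minus_plus_verma_ideal by blast
  have "phi_part \<alpha> \<beta> n d (Ugen (Dgen (- k)) * y) =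
    (of_int k * \<beta> - \<alpha> - of_int (n - d)) * phi_part \<alpha> \<beta> n (d + k) y"
    using phi_part_mult[of \<alpha> \<beta> n d "[Dgen (- k)]" y] by (simp add: algebra_simps)
  then show ?thesis
    using verma_phi_cong[OF y(2)] verma_phi_cong[OF verma_ideal_cong_left[OF y(2), of "Ugen (Dgen (- k))"]]
      verma_phi_U_minus[OF y(1)] verma_phi_U_minus[OF U_minus.mult[OF U_minus.gen[OF assms] y(1)]]
    by simp
qed

lemma verma_phi_one: "verma_phi c h \<alpha> \<beta> n d 1 = (if d = 0 then 1 else 0)"
  using verma_phi_U_minus[OF U_minus.one] phi_part(2)[of \<alpha> \<beta> n d "[]"] by simp

end

text \<open>In a word of total degree n the leftmost letter contributes -(n - n) = 0 when \<alpha> =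
  \<beta> = 0. So the functional does not see the component at index 0, as it must since v_0 = 0 in
  V'_(0,0).\<close>

lemma verma_phi_trivial:
  assumes "n \<noteq> 0"
  shows "verma_phi c h 0 0 n n x = 0"
proof -
  have "phi_part 0 0 n n y = 0" for y
  proof (induction y rule: U_span_induct)
    case (mono a w)
    have "phi_list 0 0 n w = 0" if "list_degree w = n"
    proof (cases w)
      case (Cons g v)
      then show ?thesis using that by (cases g) auto
    qed (use that assms in simp)
    then show ?case by (simp add: phi_partD phi_part(2))
  qed (simp add: phi_partD)
  moreover obtain y where "y \<in> U_minus" "x - y \<in> verma_ideal c h" using U_minus_plus_verma_ideal by blast
  ultimately show ?thesis using verma_phi_cong verma_phi_U_minus by metis
qed

text \<open>What \<open>max_generators c h Q1 Q2\<close> says in terms of left ideals.\<close>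

definition radical_generators :: "complex \<Rightarrow> complex \<Rightarrow> Uvir \<Rightarrow> Uvir \<Rightarrow> bool" where
  "radical_generators c h Q1 Q2 \<longleftrightarrow> Q1 \<in> U_minus \<inter> verma_radical c h \<and> Q2 \<in> U_minus \<inter> verma_radical c h \<and>
     (\<exists>m. U_homogeneous m Q1) \<and> (\<exists>m. U_homogeneous m Q2) \<and>
     (\<forall>x\<in>verma_radical c h. \<exists>a\<in>U_minus. \<exists>b\<in>U_minus. x - (a * Q1 + b * Q2) \<in> verma_ideal c h)"

lemma verma_phi_radical:
  assumes "radical_generators c h Q1 Q2" "phi \<alpha> \<beta> n Q1 = 0" "phi \<alpha> \<beta> n Q2 = 0" "x \<in> verma_radical c h"
  shows "verma_phi c h \<alpha> \<beta> n d x = 0"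
proof -
  have Q: "Q1 \<in> U_minus" "Q2 \<in> U_minus" "\<exists>m. U_homogeneous m Q1" "\<exists>m. U_homogeneous m Q2"
    using assms(1) by (auto simp: radical_generators_def)
  obtain a b where ab: "a \<in> U_minus" "b \<in> U_minus" "x - (a * Q1 + b * Q2) \<in> verma_ideal c h"
    using assms(1,4) by (auto simp: radical_generators_def)
  have "verma_phi c h \<alpha> \<beta> n d x = phi_part \<alpha> \<beta> n d (a * Q1) + phi_part \<alpha> \<beta> n d (b * Q2)"
    using verma_phi_cong[OF ab(3)] verma_phi_U_minus[OF U_minus.mult] ab Q by (simp add: verma_phiD)
  also have "\<dots> = 0"
    using Q assms(2,3) phi_part_left_multiple_zero phi_eq_phi_U by (metis add.right_neutral)
  finally show ?thesis .
qed

lemma phi_U_radical: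
  assumes "radical_generators c h Q1 Q2" "phi \<alpha> \<beta> n Q1 = 0" "phi \<alpha> \<beta> n Q2 = 0"
    and "x \<in> verma_radical c h" "x \<in> U_minus"
  shows "phi_U \<alpha> \<beta> n x = 0"
proof -
  have "phi_part \<alpha> \<beta> n d x = 0" for d
    using verma_phi_radical[OF assms(1-4)] verma_phi_U_minus[OF assms(5)] by simp
  then show ?thesis using phi_U_sum_parts[of \<alpha> \<beta> n x] by auto
qed

lemma no_phi_zero_trivial:
  assumes "radical_generators 0 0 Q1 Q2" "phi \<alpha> \<beta> n Q1 = 0" "phi \<alpha> \<beta> n Q2 = 0"
  shows "\<beta> = 1"
proof -
  have "phi_U \<alpha> \<beta> n (Ugen (Dgen (- k))) = 0" if "k > 0" for k
    using phi_U_radical[OF assms radical_trivial U_minus.gen[OF that]] .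
  moreover have "phi_U \<alpha> \<beta> n (Ugen (Dgen (- k))) = of_int k * \<beta> - \<alpha> - of_int n - of_int k" for k
    using phi_U_mono[of \<alpha> \<beta> n "[Dgen (- k)]"] by (simp add: algebra_simps)
  ultimately have "\<beta> - \<alpha> - of_int n - 1 = 0" "2 * \<beta> - \<alpha> - of_int n - 2 = 0"
    by (metis of_int_1 mult_1_left zero_less_one, metis of_int_numeral zero_less_numeral)
  moreover have "\<beta> - 1 = (2 * \<beta> - \<alpha> - of_int n - 2) - (\<beta> - \<alpha> - of_int n - 1)" by simp
  ultimately show ?thesis by simp
qed

section \<open>The tensor product before taking the quotient\<close>

text \<open>The finitely supported function \<open>single i x\<close> stands for \<open>x u \<otimes> v\<^sub>i\<close>.\<close>

type_synonym tensor_cover = "int \<Rightarrow>\<^sub>0 Uvir"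

abbreviation e_tensor :: "int \<Rightarrow> Uvir \<Rightarrow> tensor_cover" where
  "e_tensor \<equiv> Poly_Mapping.single"

lemma tensor_cover_induct [case_names single add]:
  assumes "\<And>i x. P (e_tensor i x)" "\<And>f g. P f \<Longrightarrow> P g \<Longrightarrow> P (f + g)"
  shows "P (f :: tensor_cover)"
proof -
  have *: "P (\<Sum>i\<in>A. e_tensor i (Poly_Mapping.lookup f i))" if "finite A" for A
    using that
  proof induction
    case empty
    show ?case using assms(1)[of 0 0] by simp
  qed (simp add: assms)
  have "f = (\<Sum>i\<in>Poly_Mapping.keys f. e_tensor i (Poly_Mapping.lookup f i))"
    by (rule poly_mapping_eqI) (auto simp: lookup_sum lookup_single when_def in_keys_iff)
  with * show ?thesis by (metis finite_keys)
qed

definition lin_ext :: "(int \<Rightarrow> Uvir \<Rightarrow> 'a::ab_group_add) \<Rightarrow> tensor_cover \<Rightarrow> 'a" where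
  "lin_ext t f = (\<Sum>i\<in>Poly_Mapping.keys f. t i (Poly_Mapping.lookup f i))"

definition additive_family :: "(int \<Rightarrow> Uvir \<Rightarrow> 'a::ab_group_add) \<Rightarrow> bool" where
  "additive_family t \<longleftrightarrow> (\<forall>i x y. t i (x + y) = t i x + t i y)"

lemma lin_ext:
  assumes "additive_family t"
  shows "lin_ext t (f + g) = lin_ext t f + lin_ext t g" "lin_ext t (e_tensor i x) = t i x" "lin_ext t 0 = 0"
proof -
  have add: "t i (x + y) = t i x + t i y" for i x y using assms by (simp add: additive_family_def)
  have zero: "t i 0 = 0" for i using add[of i 0 0] by simp
  show "lin_ext t (f + g) = lin_ext t f + lin_ext t g"
    unfolding lin_ext_def by (rule setsum_keys_plus_distrib) (simp_all add: zero add)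
  show "lin_ext t (e_tensor i x) = t i x"
    by (cases "x = 0") (simp_all add: lin_ext_def zero)
  show "lin_ext t 0 = 0" by (simp add: lin_ext_def)
qed

definition E_scale :: "complex \<Rightarrow> tensor_cover \<Rightarrow> tensor_cover" where
  "E_scale a = lin_ext (\<lambda>i x. e_tensor i (U_scale a x))"

definition E_shift :: "int \<Rightarrow> tensor_cover \<Rightarrow> tensor_cover" where
  "E_shift s = lin_ext (\<lambda>i x. e_tensor (i + s) x)"

definition E_weight :: "(int \<Rightarrow> complex) \<Rightarrow> tensor_cover \<Rightarrow> tensor_cover" where
  "E_weight w = lin_ext (\<lambda>i x. e_tensor i (U_scale (w i) x))"

definition E_left :: "Uvir \<Rightarrow> tensor_cover \<Rightarrow> tensor_cover" where
  "E_left a = lin_ext (\<lambda>i x. e_tensor i (a * x))"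

lemma additive_families:
  "additive_family (\<lambda>i x. e_tensor i (U_scale a x))"
  "additive_family (\<lambda>i x. e_tensor (i + s) x)"
  "additive_family (\<lambda>i x. e_tensor i (U_scale (w i) x))"
  "additive_family (\<lambda>i x. e_tensor i (y * x))"
  by (simp_all add: additive_family_def single_add U_scale_simps distrib_left)

lemmas E_scale = lin_ext[OF additive_families(1), of a for a, folded E_scale_def]
lemmas E_shift = lin_ext[OF additive_families(2), folded E_shift_def]
lemmas E_weight = lin_ext[OF additive_families(3), folded E_weight_def]
lemmas E_left = lin_ext[OF additive_families(4), folded E_left_def]

lemma lookup_E_scale: "Poly_Mapping.lookup (E_scale a f) j = U_scale a (Poly_Mapping.lookup f j)"
  by (induction f rule: tensor_cover_induct)
     (auto simp: E_scale lookup_add lookup_single when_def U_scale_simps)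

lemma lookup_E_shift: "Poly_Mapping.lookup (E_shift s f) j = Poly_Mapping.lookup f (j - s)"
  by (induction f rule: tensor_cover_induct) (auto simp: E_shift lookup_add lookup_single when_def)

lemma lookup_E_weight: "Poly_Mapping.lookup (E_weight w f) j = U_scale (w j) (Poly_Mapping.lookup f j)"
  by (induction f rule: tensor_cover_induct)
     (auto simp: E_weight lookup_add lookup_single when_def U_scale_simps)

lemma lookup_E_left: "Poly_Mapping.lookup (E_left a f) j = a * Poly_Mapping.lookup f j"
  by (induction f rule: tensor_cover_induct)
     (auto simp: E_left lookup_add lookup_single when_def distrib_left)

interpretation E: vector_space E_scale
  by standard (auto intro!: poly_mapping_eqI simp: lookup_E_scale lookup_add U_scale_simps U_scale_add_left)

context
  fixes \<alpha> \<beta> :: complex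
begin

fun gen_tensor :: "vir_gen \<Rightarrow> int \<Rightarrow> Uvir \<Rightarrow> tensor_cover" where
  "gen_tensor (Dgen m) i x = e_tensor i (Ugen (Dgen m) * x) +
     e_tensor (m + i) (U_scale (\<alpha> + of_int i + of_int m * \<beta>) x)"
| "gen_tensor Cgen i x = e_tensor i (Ugen Cgen * x)"

definition E_act :: "vir_gen \<Rightarrow> tensor_cover \<Rightarrow> tensor_cover" where
  "E_act g = lin_ext (gen_tensor g)"

lemma additive_gen_tensor: "additive_family (gen_tensor g)"
  unfolding additive_family_def
  by (cases g) (auto simp: distrib_left single_add U_scale_simps algebra_simps)

lemmas E_act = lin_ext[OF additive_gen_tensor, folded E_act_def]

lemma E_act_scale: "E_act g (E_scale a f) = E_scale a (E_act g f)"
proof (induction f rule: tensor_cover_induct)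
  case (single i x)
  show ?case by (cases g) (simp_all add: E_act E_scale U_scale_right U_scale_simps mult.commute)
qed (simp add: E_act E_scale)

lemma E_act_diff: "E_act g (f - f') = E_act g f - E_act g f'"
  using E_act(1)[of g "f - f'" f'] by simp

lemma E_act_bracket:
  "E_act (Dgen m) (E_act (Dgen n) f) = E_act (Dgen n) (E_act (Dgen m) f) +
     E_scale (of_int (n - m)) (E_act (Dgen (m + n)) f) + E_scale (d_cocycle m n) (E_act Cgen f)"
proof (induction f rule: tensor_cover_induct)
  case (single i x)
  have "Ugen (Dgen m) * (Ugen (Dgen n) * x) = Ugen (Dgen n) * (Ugen (Dgen m) * x) +
     U_scale (of_int (n - m)) (Ugen (Dgen (m + n)) * x) + U_scale (d_cocycle m n) (Ugen Cgen * x)"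
    unfolding mult.assoc[symmetric] U_commutator[of m n] distrib_right U_scale_simps(3) ..
  then have U: "e_tensor i (Ugen (Dgen m) * (Ugen (Dgen n) * x)) = e_tensor i (Ugen (Dgen n) * (Ugen (Dgen m) * x)) +
     e_tensor i (U_scale (of_int (n - m)) (Ugen (Dgen (m + n)) * x)) + e_tensor i (U_scale (d_cocycle m n) (Ugen Cgen * x))"
    by (simp only: single_add)
  have V: "(\<alpha> + of_int (n + i) + of_int m * \<beta>) * (\<alpha> + of_int i + of_int n * \<beta>) =
      (\<alpha> + of_int (m + i) + of_int n * \<beta>) * (\<alpha> + of_int i + of_int m * \<beta>) +
      of_int (n - m) * (\<alpha> + of_int i + of_int (m + n) * \<beta>)"
    by (simp add: algebra_simps)
  have W: "e_tensor (m + (n + i)) (U_scale ((\<alpha> + of_int (n + i) + of_int m * \<beta>) * (\<alpha> + of_int i + of_int n * \<beta>)) x) =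
      e_tensor (n + (m + i)) (U_scale ((\<alpha> + of_int (m + i) + of_int n * \<beta>) * (\<alpha> + of_int i + of_int m * \<beta>)) x) +
      e_tensor (m + n + i) (U_scale (of_int (n - m)) (U_scale (\<alpha> + of_int i + of_int (m + n) * \<beta>) x))"
    unfolding V by (subst U_scale_add_left) (simp only: single_add U_scale_simps(2) ac_simps)
  show ?case
    by (simp only: E_act gen_tensor.simps E_scale U_scale_simps U_scale_right U W single_add) (simp only: ac_simps)
next
  case (add f g)
  then show ?case by (simp only: E_act E_scale) (simp only: ac_simps)
qed

lemma E_act_central: "E_act Cgen (E_act (Dgen m) f) = E_act (Dgen m) (E_act Cgen f)"
proof (induction f rule: tensor_cover_induct)
  case (single i x)
  have "Ugen Cgen * (Ugen (Dgen m) * x) = Ugen (Dgen m) * (Ugen Cgen * x)"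
    unfolding mult.assoc[symmetric] U_central ..
  then show ?case by (simp add: E_act U_scale_right)
qed (simp add: E_act)

lemma lookup_E_act:
  "Poly_Mapping.lookup (E_act (Dgen m) f) j = Ugen (Dgen m) * Poly_Mapping.lookup f j +
     U_scale (\<alpha> + of_int (j - m) + of_int m * \<beta>) (Poly_Mapping.lookup f (j - m))"
  "Poly_Mapping.lookup (E_act Cgen f) j = Ugen Cgen * Poly_Mapping.lookup f j"
proof -
  show "Poly_Mapping.lookup (E_act (Dgen m) f) j = Ugen (Dgen m) * Poly_Mapping.lookup f j +
     U_scale (\<alpha> + of_int (j - m) + of_int m * \<beta>) (Poly_Mapping.lookup f (j - m))"
  proof (induction f rule: tensor_cover_induct)
    case (single i x)
    show ?case by (auto simp: E_act lookup_add lookup_single when_def)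
  next
    case (add f g)
    then show ?case by (simp only: E_act lookup_add distrib_left U_scale_simps) (simp only: ac_simps)
  qed
  show "Poly_Mapping.lookup (E_act Cgen f) j = Ugen Cgen * Poly_Mapping.lookup f j"
    by (induction f rule: tensor_cover_induct)
       (auto simp: E_act lookup_add lookup_single when_def distrib_left)
qed

lemma E_act_shift:
  "E_act (Dgen m) (E_shift s f) = E_shift s (E_left (Ugen (Dgen m)) f) +
     E_shift (s + m) (E_weight (\<lambda>i. \<alpha> + of_int i + of_int s + of_int m * \<beta>) f)"
  "E_act Cgen (E_shift s f) = E_shift s (E_left (Ugen Cgen) f)"
  by (auto intro!: poly_mapping_eqI simp: lookup_E_act lookup_E_shift lookup_E_left lookup_E_weight lookup_add
      algebra_simps)

definition E_stable :: "tensor_cover set \<Rightarrow> bool" where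
  "E_stable N \<longleftrightarrow> 0 \<in> N \<and> (\<forall>f\<in>N. \<forall>g\<in>N. f + g \<in> N) \<and> (\<forall>a. \<forall>f\<in>N. E_scale a f \<in> N) \<and>
     (\<forall>g. \<forall>f\<in>N. E_act g f \<in> N)"

lemma E_stableD:
  assumes "E_stable N"
  shows "0 \<in> N" "f \<in> N \<Longrightarrow> f' \<in> N \<Longrightarrow> f + f' \<in> N" "f \<in> N \<Longrightarrow> E_scale a f \<in> N"
    "f \<in> N \<Longrightarrow> E_act g f \<in> N" "f \<in> N \<Longrightarrow> - f \<in> N" "f \<in> N \<Longrightarrow> f' \<in> N \<Longrightarrow> f - f' \<in> N"
proof -
  show "0 \<in> N" and add: "\<And>f f'. f \<in> N \<Longrightarrow> f' \<in> N \<Longrightarrow> f + f' \<in> N"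
    and scale: "\<And>f a. f \<in> N \<Longrightarrow> E_scale a f \<in> N" and "\<And>f. f \<in> N \<Longrightarrow> E_act g f \<in> N"
    using assms by (auto simp: E_stable_def)
  have "E_scale (- 1) f = - f" for f by simp
  then show minus: "f \<in> N \<Longrightarrow> - f \<in> N" for f using scale[of f "- 1"] by simp
  show "f \<in> N \<Longrightarrow> f' \<in> N \<Longrightarrow> f - f' \<in> N" using add[of f "- f'"] minus[of f'] by simp
qed

lemma E_stable_cong: "E_stable N \<Longrightarrow> f - f' \<in> N \<Longrightarrow> f \<in> N \<longleftrightarrow> f' \<in> N"
  using E_stableD(2)[of N "f - f'" f'] E_stableD(6)[of N f "f - f'"] by auto

end

section \<open>Stable subspaces of the tensor product\<close>

locale hw_interm =
  fixes c h \<alpha> \<beta> :: complex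
  assumes Re_alpha: "0 \<le> Re \<alpha>" "Re \<alpha> < 1" and beta_ne_1: "\<beta> \<noteq> 1"
begin

abbreviation "L \<equiv> verma_radical c h"
abbreviation "act_E \<equiv> E_act \<alpha> \<beta>"

text \<open>The index with v_i = 0 in V'; it lets the case (\<alpha>,\<beta>) = (0,0) run along with
  all others.\<close>

definition degenerate :: "int \<Rightarrow> bool" where
  "degenerate i \<longleftrightarrow> \<alpha> = 0 \<and> \<beta> = 0 \<and> i = 0"

text \<open>The vectors that vanish in V(c,h) \<otimes> V', as \<open>cover_in_TK_iff\<close>
  confirms; at a degenerate index the coefficient is arbitrary.\<close>

definition E_kernel :: "tensor_cover set" where
  "E_kernel = {f. \<forall>i. \<not> degenerate i \<longrightarrow> Poly_Mapping.lookup f i \<in> L}"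

text \<open>The normalization 0 \<le> Re \<alpha> < 1 leaves 0 as the only integer value of
  \<alpha>.\<close>

lemma alpha_plus_int: "\<alpha> + of_int i = 0 \<Longrightarrow> \<alpha> = 0 \<and> i = 0"
proof -
  assume "\<alpha> + of_int i = 0"
  then have \<alpha>: "\<alpha> = - of_int i" by (simp add: eq_neg_iff_add_eq_0)
  then have "i = 0" using Re_alpha by simp
  then show ?thesis using \<alpha> by simp
qed

lemma E_stable_kernel: "E_stable \<alpha> \<beta> E_kernel"
proof -
  have "act_E g f \<in> E_kernel" if "f \<in> E_kernel" for g f
  proof (cases g)
    case (Dgen m)
    show ?thesis
      unfolding Dgen E_kernel_def mem_Collect_eq
    proof (intro allI impI)
      fix j assume "\<not> degenerate j"
      then have 1: "Poly_Mapping.lookup f j \<in> L" using that by (simp add: E_kernel_def)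
      have 2: "U_scale (\<alpha> + of_int (j - m) + of_int m * \<beta>) (Poly_Mapping.lookup f (j - m)) \<in> L"
      proof (cases "degenerate (j - m)")
        \<comment> \<open>The scalar is 0 here because Vir kills v_0 when \<alpha> = \<beta> =
          0.\<close>
        case True
        then show ?thesis by (simp add: degenerate_def verma_radicalD(1))
      next
        case False
        then show ?thesis using that by (auto simp: E_kernel_def intro: verma_radicalD(4))
      qed
      show "Poly_Mapping.lookup (act_E (Dgen m) f) j \<in> L"
        unfolding lookup_E_act using 1 2 by (intro verma_radicalD(2) verma_radicalD(3))
    qed
  next
    case Cgen
    then show ?thesis using that by (auto simp: E_kernel_def lookup_E_act intro: verma_radicalD(3))
  qed
  then show ?thesis
    by (auto simp: E_stable_def E_kernel_def lookup_add lookup_E_scale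
        intro: verma_radicalD(1,2,4))
qed

lemmas E_kernelD = E_stableD[OF E_stable_kernel]

lemma single_in_kernel: "x \<in> L \<Longrightarrow> e_tensor i x \<in> E_kernel"
  by (auto simp: E_kernel_def lookup_single when_def verma_radicalD(1))

lemma single_degenerate_in_kernel: "degenerate i \<Longrightarrow> e_tensor i x \<in> E_kernel"
  by (simp add: E_kernel_def lookup_single when_def verma_radicalD(1))

lemma single_one_notin_kernel: "\<not> degenerate i \<Longrightarrow> e_tensor i 1 \<notin> E_kernel"
  using one_notin_radical by (force simp: E_kernel_def lookup_single when_def)

text \<open>For large j, d_j kills x u for all coefficients x of f, and \<open>E_shift\<close> and
  \<open>E_weight\<close> change coefficients only by position and scalars. Hence one J serves all s
  and w, which permits repeated application.\<close>

lemma large_d_action: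
  "\<exists>J. \<forall>j\<ge>J. \<forall>s w. act_E (Dgen j) (E_shift s (E_weight w f)) -
     E_shift (s + j) (E_weight (\<lambda>i. (\<alpha> + of_int i + of_int s + of_int j * \<beta>) * w i) f) \<in> E_kernel"
proof -
  have "\<exists>J. \<forall>j\<ge>J. \<forall>i. Ugen (Dgen j) * Poly_Mapping.lookup f i \<in> verma_ideal c h"
  proof (induction f rule: tensor_cover_induct)
    case (single i x)
    obtain J where "\<forall>j\<ge>J. Ugen (Dgen j) * x \<in> verma_ideal c h" using annihilated_by_large by blast
    then show ?case
      by (intro exI[of _ J]) (auto simp: lookup_single when_def verma_ideal.zero)
  next
    case (add f g)
    then obtain J J' where "\<forall>j\<ge>J. \<forall>i. Ugen (Dgen j) * Poly_Mapping.lookup f i \<in> verma_ideal c h"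
      "\<forall>j\<ge>J'. \<forall>i. Ugen (Dgen j) * Poly_Mapping.lookup g i \<in> verma_ideal c h" by blast
    then show ?case
      by (intro exI[of _ "max J J'"]) (auto simp: lookup_add distrib_left intro: verma_ideal.add)
  qed
  then obtain J where J: "\<And>j i. j \<ge> J \<Longrightarrow> Ugen (Dgen j) * Poly_Mapping.lookup f i \<in> verma_ideal c h" by blast
  have "act_E (Dgen j) (E_shift s (E_weight w f)) -
     E_shift (s + j) (E_weight (\<lambda>i. (\<alpha> + of_int i + of_int s + of_int j * \<beta>) * w i) f) \<in> E_kernel" if "j \<ge> J" for j s w
  proof -
    have "E_weight (\<lambda>i. \<alpha> + of_int i + of_int s + of_int j * \<beta>) (E_weight w f) =
        E_weight (\<lambda>i. (\<alpha> + of_int i + of_int s + of_int j * \<beta>) * w i) f"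
      by (rule poly_mapping_eqI) (simp add: lookup_E_weight U_scale_simps)
    then have "act_E (Dgen j) (E_shift s (E_weight w f)) -
       E_shift (s + j) (E_weight (\<lambda>i. (\<alpha> + of_int i + of_int s + of_int j * \<beta>) * w i) f) =
       E_shift s (E_left (Ugen (Dgen j)) (E_weight w f))"
      by (simp add: E_act_shift)
    also have "\<dots> \<in> E_kernel"
      unfolding E_kernel_def mem_Collect_eq lookup_E_shift lookup_E_left lookup_E_weight U_scale_right
      using J[OF that] by (intro allI impI VI_subset_radical verma_idealD(4))
    finally show ?thesis .
  qed
  then show ?thesis by blast
qed

text \<open>A large d_j always moves indices. Asking only that all far shifts of f lie in N absorbs
  this movement, and the resulting space is stable under multiplication by the index and under
  U(Vir) acting on the first factor alone.\<close>

definition germ :: "tensor_cover set \<Rightarrow> tensor_cover set" where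
  "germ N = {f. \<exists>S. \<forall>s\<ge>S. E_shift s f \<in> N}"

context
  fixes N assumes N: "E_stable \<alpha> \<beta> N" and ker: "E_kernel \<subseteq> N"
begin

lemmas ND = E_stableD[OF N]

lemma germ_add: "f \<in> germ N \<Longrightarrow> g \<in> germ N \<Longrightarrow> f + g \<in> germ N"
  unfolding germ_def mem_Collect_eq
  by (elim exE, rename_tac S S', rule_tac x = "max S S'" in exI) (auto simp: E_shift ND)

lemma E_shift_scale: "E_shift s (E_scale a f) = E_scale a (E_shift s f)"
  by (rule poly_mapping_eqI) (simp add: lookup_E_shift lookup_E_scale)

lemma germ_scale: "f \<in> germ N \<Longrightarrow> E_scale a f \<in> germ N"
  unfolding germ_def mem_Collect_eq E_shift_scale by (elim exE, rule exI) (auto simp: ND)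

lemma E_weight_one: "E_weight (\<lambda>_. 1) f = f"
  by (rule poly_mapping_eqI) (simp add: lookup_E_weight U_scale_simps)

lemma E_weight_affine:
  "E_shift t (E_weight (\<lambda>i. a + b * w i) f) = E_scale a (E_shift t f) + E_scale b (E_shift t (E_weight w f))"
  by (rule poly_mapping_eqI)
     (simp add: lookup_E_shift lookup_E_scale lookup_E_weight lookup_add U_scale_add_left U_scale_simps)

text \<open>Applied to the shift by s = t - J, d_J yields the shift by t with component i scaled by
  (\<alpha> + s + J \<beta>) + i; the constant part is a multiple of a vector already in N.\<close>

lemma germ_index:
  assumes "f \<in> germ N"
  shows "E_weight of_int f \<in> germ N"
proof -
  obtain S where S: "\<And>s. s \<ge> S \<Longrightarrow> E_shift s f \<in> N" using assms by (auto simp: germ_def)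
  obtain J where J: "\<And>j s w. j \<ge> J \<Longrightarrow> act_E (Dgen j) (E_shift s (E_weight w f)) -
     E_shift (s + j) (E_weight (\<lambda>i. (\<alpha> + of_int i + of_int s + of_int j * \<beta>) * w i) f) \<in> E_kernel"
    using large_d_action[of f] by blast
  have "E_shift t (E_weight of_int f) \<in> N" if t: "t \<ge> max S (S + J)" for t
  proof -
    define s where "s = t - J"
    have s: "s \<ge> S" "t \<ge> S" "s + J = t" using t by (auto simp: s_def)
    let ?a = "\<alpha> + of_int s + of_int J * \<beta>"
    have "act_E (Dgen J) (E_shift s f) - E_shift t (E_weight (\<lambda>i. ?a + 1 * of_int i) f) \<in> N"
      using J[of J s "\<lambda>_. 1"] ker s(3) by (simp add: E_weight_one add.assoc add.left_commute add.commute subset_iff)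
    then have "E_shift t (E_weight (\<lambda>i. ?a + 1 * of_int i) f) \<in> N"
      using E_stable_cong[OF N] ND(4)[OF S[OF s(1)]] by blast
    then have "E_scale ?a (E_shift t f) + E_shift t (E_weight of_int f) \<in> N"
      unfolding E_weight_affine by simp
    then have "E_scale ?a (E_shift t f) + E_shift t (E_weight of_int f) - E_scale ?a (E_shift t f) \<in> N"
      by (rule ND(6)) (intro ND(3) S s(2))
    then show ?thesis by simp
  qed
  then show ?thesis unfolding germ_def by blast
qed

text \<open>The part of d_m that acts on the second factor is a shift with weights affine in i, so
  it lies in N by \<open>germ_index\<close>; subtracting it leaves the action on the first
  factor.\<close>

lemma germ_left:
  assumes "f \<in> germ N"
  shows "E_left (Ugen g) f \<in> germ N"
proof -
  obtain S where S: "\<And>s. s \<ge> S \<Longrightarrow> E_shift s f \<in> N" using assms by (auto simp: germ_def)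
  show ?thesis
  proof (cases g)
    case (Dgen m)
    obtain S' where S': "\<And>s. s \<ge> S' \<Longrightarrow> E_shift s (E_weight of_int f) \<in> N"
      using germ_index[OF assms] by (auto simp: germ_def)
    have "E_shift s (E_left (Ugen g) f) \<in> N" if s: "s \<ge> max S (max (S - m) (S' - m))" for s
    proof -
      let ?a = "\<alpha> + of_int s + of_int m * \<beta>"
      have "E_shift (s + m) (E_weight (\<lambda>i. ?a + 1 * of_int i) f) \<in> N"
        unfolding E_weight_affine using s by (intro ND(2) ND(3) S S') auto
      moreover have "(\<lambda>i. \<alpha> + of_int i + of_int s + of_int m * \<beta>) = (\<lambda>i. ?a + 1 * of_int i)"
        by (simp add: add.assoc add.left_commute add.commute)
      then have "act_E (Dgen m) (E_shift s f) = E_shift s (E_left (Ugen (Dgen m)) f) +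
          E_shift (s + m) (E_weight (\<lambda>i. ?a + 1 * of_int i) f)"
        using E_act_shift(1) by metis
      moreover have "act_E (Dgen m) (E_shift s f) \<in> N" using s by (intro ND(4) S) auto
      ultimately show ?thesis
        using ND(6) unfolding Dgen by (metis add_diff_cancel_right')
    qed
    then show ?thesis unfolding germ_def by blast
  next
    case Cgen
    then show ?thesis
      using ND(4)[OF S, of _ Cgen] by (auto simp: germ_def E_act_shift)
  qed
qed

lemma germ_kernel: "x \<in> L \<Longrightarrow> e_tensor i x \<in> germ N"
  using ker single_in_kernel by (auto simp: germ_def E_shift subset_iff)

text \<open>A polynomial in the index that vanishes at all other indices of f isolates x u \<otimes>
  v_i with x outside L. The coefficients possible at i form a left ideal that contains L and this x,
  hence everything.\<close>

lemma germ_component_one: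
  assumes "f \<in> germ N" "Poly_Mapping.lookup f i \<notin> L"
  shows "e_tensor i 1 \<in> germ N"
proof -
  have prod: "E_weight (\<lambda>j. \<Prod>a\<in>A. of_int j - of_int a) f \<in> germ N" if "finite A" for A
    using that
  proof (induction A)
    case empty
    show ?case using assms(1) by (simp add: E_weight_one)
  next
    case (insert a A)
    let ?f = "E_weight (\<lambda>j. \<Prod>a\<in>A. of_int j - of_int a) f"
    have "E_weight of_int ?f + E_scale (- of_int a) ?f \<in> germ N"
      using insert by (intro germ_add germ_index germ_scale)
    moreover have "E_weight of_int ?f + E_scale (- of_int a) ?f = E_weight (\<lambda>j. \<Prod>a\<in>insert a A. of_int j - of_int a) f"
      using insert by (intro poly_mapping_eqI)
        (simp add: lookup_add lookup_E_weight lookup_E_scale lookup_minus U_scale_simps left_diff_distrib U.scale_left_diff_distrib)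
    ultimately show ?case by simp
  qed
  let ?A = "Poly_Mapping.keys f - {i}"
  let ?p = "\<lambda>j. \<Prod>a\<in>?A. of_int j - of_int a :: complex"
  let ?x = "U_scale (?p i) (Poly_Mapping.lookup f i)"
  have "E_weight ?p f = e_tensor i ?x"
  proof (rule poly_mapping_eqI)
    fix j
    have "?p j = 0" if "j \<noteq> i" "j \<in> Poly_Mapping.keys f" using that by simp
    then show "Poly_Mapping.lookup (E_weight ?p f) j = Poly_Mapping.lookup (e_tensor i ?x) j"
      by (cases "j = i"; cases "j \<in> Poly_Mapping.keys f")
         (simp_all add: lookup_E_weight lookup_single in_keys_iff del: prod_zero_iff)
  qed
  then have x: "e_tensor i ?x \<in> germ N" using prod[of ?A] by simp
  have "?p i \<noteq> 0" by simp
  have "?x \<notin> L"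
  proof
    assume "?x \<in> L"
    then have "U_scale (1 / ?p i) ?x \<in> L" by (rule verma_radicalD(4))
    then show False using \<open>?p i \<noteq> 0\<close> assms(2) by (simp add: U_scale_simps del: prod_zero_iff)
  qed
  let ?S = "{x. e_tensor i x \<in> germ N}"
  have "left_ideal ?S"
  proof (rule left_idealI)
    show "0 \<in> ?S" using germ_kernel[OF verma_radicalD(1)] by simp
    show "x \<in> ?S \<Longrightarrow> y \<in> ?S \<Longrightarrow> x + y \<in> ?S" for x y using germ_add by (simp add: single_add)
    show "x \<in> ?S \<Longrightarrow> U_scale r x \<in> ?S" for r x using germ_scale[of "e_tensor i x" r] by (simp add: E_scale)
    show "x \<in> ?S \<Longrightarrow> Ugen g * x \<in> ?S" for g x using germ_left[of "e_tensor i x" g] by (simp add: E_left)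
  qed
  then have "?S = UNIV"
    by (rule left_ideal_eq_UNIV[where c = c and h = h and x = ?x]) (use x \<open>?x \<notin> L\<close> germ_kernel in auto)
  then show ?thesis by blast
qed

end

text \<open>
  For large \<open>j\<close>, \<open>d\<^sub>j\<close> acts on the second factor only. So does \<open>d\<^bsub>s-l\<^esub> d\<^sub>l\<close>, with a coefficient that
  is quadratic in \<open>l\<close> and has leading coefficient \<open>\<beta>(1-\<beta>)\<close> at every index: if \<open>\<beta> \<noteq> 0\<close>, a second
  difference in \<open>l\<close> yields the shift by \<open>s\<close>.
\<close>

lemma stable_contains_large:
  assumes N: "E_stable \<alpha> \<beta> N" "E_kernel \<subseteq> N" and f: "f \<in> N" "f \<notin> E_kernel"
  shows "\<exists>S. \<forall>s\<ge>S. e_tensor s 1 \<in> N"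
proof -
  obtain i where i: "\<not> degenerate i" "Poly_Mapping.lookup f i \<notin> L" using f(2) by (auto simp: E_kernel_def)
  obtain J where J: "\<And>j s w. j \<ge> J \<Longrightarrow> act_E (Dgen j) (E_shift s (E_weight w f)) -
     E_shift (s + j) (E_weight (\<lambda>i. (\<alpha> + of_int i + of_int s + of_int j * \<beta>) * w i) f) \<in> E_kernel"
    using large_d_action[of f] by blast
  have f0: "E_shift 0 (E_weight (\<lambda>_. 1) f) = f"
    by (rule poly_mapping_eqI) (simp add: lookup_E_shift lookup_E_weight U_scale_simps)
  have step: "E_shift (s + j) (E_weight (\<lambda>i. (\<alpha> + of_int i + of_int s + of_int j * \<beta>) * w i) f) \<in> N"
    if "j \<ge> J" "E_shift s (E_weight w f) \<in> N" for j s w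
    using E_stable_cong[OF N(1)] J[OF that(1), of s w] N(2) E_stableD(4)[OF N(1) that(2)] by blast
  have f1: "E_shift j (E_weight (\<lambda>i. \<alpha> + of_int i + of_int j * \<beta>) f) \<in> N" if "j \<ge> J" for j
    using step[OF that, of 0 "\<lambda>_. 1"] f0 f(1) by simp
  have "\<exists>w. w i \<noteq> 0 \<and> E_weight w f \<in> germ N"
  proof (cases "\<beta> = 0")
    case True
    \<comment> \<open>For \<beta> = 0 every large d_j scales component i by the same \<alpha> + i,
      which is nonzero because i is not degenerate.\<close>
    have "\<alpha> + of_int i \<noteq> 0" using i(1) True alpha_plus_int[of i] unfolding degenerate_def by blast
    moreover have "E_weight (\<lambda>i. \<alpha> + of_int i) f \<in> germ N"
      unfolding germ_def using f1 True by (auto intro!: exI[of _ J])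
    ultimately show ?thesis by (intro exI[of _ "\<lambda>i. \<alpha> + of_int i"] conjI)
  next
    case False
    define q where "q = (\<lambda>s l i. (\<alpha> + of_int i + of_int l + of_int (s - l) * \<beta>) * (\<alpha> + of_int i + of_int l * \<beta>))"
    have f2: "E_shift s (E_weight (q s l) f) \<in> N" if "l \<ge> J" "s - l \<ge> J" for s l
      using step[OF that(2) f1[OF that(1)]] by (simp add: q_def)
    let ?w = "\<lambda>i :: int. 2 * \<beta> * (1 - \<beta>)"
    have "E_shift s (E_weight ?w f) \<in> N" if s: "s \<ge> 2 * J + 2" for s
    proof -
      \<comment> \<open>The second difference at l = J, J + 1, J + 2; the bound 2 J + 2 on s keeps s
        - l \<ge> J for all three.\<close>
      have q: "?w = (\<lambda>i. q s (J + 2) i + q s J i + (- 2) * q s (J + 1) i)"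
        by (rule ext) (simp add: q_def algebra_simps)
      have "E_shift s (E_weight ?w f) = E_shift s (E_weight (q s (J + 2)) f) + E_shift s (E_weight (q s J) f) +
          E_scale (- 2) (E_shift s (E_weight (q s (J + 1)) f))"
        unfolding q
        by (rule poly_mapping_eqI)
           (simp only: lookup_add lookup_E_shift lookup_E_weight lookup_E_scale U_scale_add_left U_scale_simps(2))
      also have "\<dots> \<in> N"
        using s by (intro E_stableD[OF N(1)] f2) auto
      finally show ?thesis .
    qed
    then have "E_weight ?w f \<in> germ N" unfolding germ_def by blast
    moreover have "2 * \<beta> * (1 - \<beta>) \<noteq> 0" using False beta_ne_1 by simp
    ultimately show ?thesis by (intro exI[of _ ?w] conjI)
  qed
  then obtain w where w: "w i \<noteq> 0" "E_weight w f \<in> germ N" by blast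
  have "Poly_Mapping.lookup (E_weight w f) i \<notin> L"
  proof
    assume "Poly_Mapping.lookup (E_weight w f) i \<in> L"
    then have "U_scale (1 / w i) (U_scale (w i) (Poly_Mapping.lookup f i)) \<in> L"
      by (intro verma_radicalD(4)[of "U_scale (w i) _"]) (simp add: lookup_E_weight)
    then show False using w(1) i(2) by (simp add: U_scale_simps)
  qed
  then have "e_tensor i 1 \<in> germ N" using germ_component_one[OF N w(2)] by blast
  then obtain S where S: "\<And>s. s \<ge> S \<Longrightarrow> e_tensor (i + s) 1 \<in> N" by (auto simp: germ_def E_shift)
  have "e_tensor s 1 \<in> N" if "s \<ge> S + i" for s
    using S[of "s - i"] that by simp
  then show ?thesis by blast
qed

section \<open>Words in Vir_- modulo a stable subspace\<close>

abbreviation neg_word :: "nat list \<Rightarrow> vir_gen list" where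
  "neg_word ks \<equiv> map (\<lambda>k. Dgen (- int k)) ks"

text \<open>Index plus degree is m. Applying d_(-k) to the vector known for m + k yields the longer
  word plus a multiple of the shorter one for m, so the induction runs over all m > n
  together.\<close>

lemma stable_mono_above:
  assumes N: "E_stable \<alpha> \<beta> N" and e: "\<And>i. i > n \<Longrightarrow> e_tensor i 1 \<in> N"
  shows "\<forall>k\<in>set ks. 0 < k \<Longrightarrow> m > n \<Longrightarrow> e_tensor (m - list_degree (neg_word ks)) (U_mono (neg_word ks)) \<in> N"
proof (induction ks arbitrary: m)
  case (Cons k ks)
  let ?w = "neg_word ks"
  let ?m = "m - list_degree (neg_word (k # ks))"
  have deg: "- int k + ?m = m - list_degree ?w" "?m = m + int k - list_degree ?w" by simp_all
  have "e_tensor ?m (U_mono ?w) \<in> N" unfolding deg(2) using Cons by simp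
  then have "act_E (Dgen (- int k)) (e_tensor ?m (U_mono ?w)) \<in> N" by (rule E_stableD(4)[OF N])
  then have "e_tensor ?m (U_mono (neg_word (k # ks))) +
     E_scale (\<alpha> + of_int ?m + of_int (- int k) * \<beta>) (e_tensor (m - list_degree ?w) (U_mono ?w)) \<in> N"
    unfolding E_act gen_tensor.simps deg(1) by (simp only: E_scale list.map prod_list.Cons)
  moreover have "E_scale (\<alpha> + of_int ?m + of_int (- int k) * \<beta>) (e_tensor (m - list_degree ?w) (U_mono ?w)) \<in> N"
    using Cons by (intro E_stableD(3)[OF N]) simp
  ultimately show ?case using E_stableD(6)[OF N] by (metis add_diff_cancel_right')
qed (use e in simp)

text \<open>Here the shorter word sits at m = n, where it is known only as a multiple of u \<otimes>
  v_n. Each letter contributes -(\<alpha> + i - k \<beta>), with i the index acted on, which is the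
  recursion of \<open>phi_list\<close>.\<close>

lemma stable_mono_at:
  assumes N: "E_stable \<alpha> \<beta> N" and e: "\<And>i. i > n \<Longrightarrow> e_tensor i 1 \<in> N"
  shows "\<forall>k\<in>set ks. 0 < k \<Longrightarrow> e_tensor (n - list_degree (neg_word ks)) (U_mono (neg_word ks)) -
     E_scale (phi_list \<alpha> \<beta> n (neg_word ks)) (e_tensor n 1) \<in> N"
proof (induction ks)
  case Nil
  show ?case using E_stableD(1)[OF N] by simp
next
  case (Cons k ks)
  let ?w = "neg_word ks"
  let ?m = "n - list_degree (neg_word (k # ks))"
  let ?a = "\<alpha> + of_int ?m + of_int (- int k) * \<beta>"
  let ?x = "e_tensor ?m (U_mono (neg_word (k # ks)))" and ?y = "e_tensor (n - list_degree ?w) (U_mono ?w)"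
  let ?z = "E_scale (phi_list \<alpha> \<beta> n ?w) (e_tensor n 1)"
  have deg: "- int k + ?m = n - list_degree ?w" "?m = n + int k - list_degree ?w" by simp_all
  have "e_tensor ?m (U_mono ?w) \<in> N"
    unfolding deg(2) using Cons.prems by (intro stable_mono_above[OF N e]) auto
  then have "act_E (Dgen (- int k)) (e_tensor ?m (U_mono ?w)) \<in> N" by (rule E_stableD(4)[OF N])
  then have 1: "?x + E_scale ?a ?y \<in> N"
    unfolding E_act gen_tensor.simps deg(1) by (simp only: E_scale list.map prod_list.Cons)
  have 2: "E_scale ?a (?y - ?z) \<in> N"
    using Cons by (intro E_stableD(3)[OF N]) simp
  have "phi_list \<alpha> \<beta> n (neg_word (k # ks)) = - ?a * phi_list \<alpha> \<beta> n ?w"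
    by (simp add: algebra_simps)
  then have 3: "E_scale (phi_list \<alpha> \<beta> n (neg_word (k # ks))) (e_tensor n 1) = - E_scale ?a ?z"
    by (simp only: E.scale_scale[symmetric] E.scale_minus_left)
  have "?x - E_scale (phi_list \<alpha> \<beta> n (neg_word (k # ks))) (e_tensor n 1) = (?x + E_scale ?a ?y) - E_scale ?a (?y - ?z)"
    unfolding 3 E.scale_right_diff_distrib by simp
  then show ?case by (rule ssubst) (rule E_stableD(6)[OF N 1 2])
qed

lemma U_homogeneousD: "U_homogeneous m x \<Longrightarrow> Ugen (Dgen 0) * x - x * Ugen (Dgen 0) = U_scale (of_int m) x"
  by (simp add: U_homogeneous_def)

text \<open>Eigenvectors of ad d_0 for distinct eigenvalues: applying ad d_0 - a removes the summand
  of degree a and rescales every other one by d - a.\<close>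

lemma homogeneous_independent:
  assumes "finite D" "\<And>d. d \<in> D \<Longrightarrow> U_homogeneous d (z d)" "(\<Sum>d\<in>D. z d) = 0" "d \<in> D"
  shows "z d = 0"
  using assms
proof (induction D arbitrary: z d)
  case (insert a D)
  let ?ad = "\<lambda>x. Ugen (Dgen 0) * x - x * Ugen (Dgen 0) - U_scale (of_int a) x"
  have ad: "?ad (z d) = U_scale (of_int (d - a)) (z d)" if "d \<in> insert a D" for d
    using U_homogeneousD[OF insert.prems(1)[OF that]] by (simp add: U.scale_left_diff_distrib)
  have "(\<Sum>d\<in>insert a D. U_scale (of_int (d - a)) (z d)) = ?ad (\<Sum>d\<in>insert a D. z d)"
    by (simp only: ad[symmetric] sum_distrib_left sum_distrib_right U.scale_sum_right sum_subtractf cong: sum.cong)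
  also have "\<dots> = 0" using insert.prems(2) by simp
  finally have "(\<Sum>d\<in>D. U_scale (of_int (d - a)) (z d)) = 0" using insert.hyps by simp
  moreover have "U_homogeneous d (U_scale r (z d))" if "d \<in> D" for d r
    using U_homogeneousD[OF insert.prems(1)[of d]] that unfolding U_homogeneous_def
    by (simp add: U_scale_right U_scale_simps mult.commute flip: U.scale_right_diff_distrib)
  ultimately have "U_scale (of_int (d - a)) (z d) = 0" if "d \<in> D" for d
    using insert.IH[of "\<lambda>d. U_scale (of_int (d - a)) (z d)" d] that by blast
  then have zero: "z d = 0" if "d \<in> D" for d
    using that insert.hyps by (auto dest!: spec[of _ d])
  then have "z a = 0" using insert.prems(2) insert.hyps by simp
  with zero show ?case using insert.prems(3) by blast
qed simp

text \<open>Homogeneity is a condition on [d_0, x] and does not present x through words of its own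
  degree. The word expansion is grouped by degree, and \<open>homogeneous_independent\<close> shows
  that the group of degree m is x itself.\<close>

lemma stable_homogeneous:
  assumes N: "E_stable \<alpha> \<beta> N" and e: "\<And>i. i > n \<Longrightarrow> e_tensor i 1 \<in> N"
    and x: "x \<in> U_minus" "U_homogeneous m x"
  shows "e_tensor (n - m) x - E_scale (phi_U \<alpha> \<beta> n x) (e_tensor n 1) \<in> N"
proof -
  define S where "S = (\<lambda>d. {y. U_homogeneous d y \<and> e_tensor (n - d) y - E_scale (phi_U \<alpha> \<beta> n y) (e_tensor n 1) \<in> N})"
  have hom_add: "U_homogeneous d (x + y)" if "U_homogeneous d x" "U_homogeneous d y" for d x y
    using that unfolding U_homogeneous_def by (simp add: distrib_left distrib_right U_scale_simps algebra_simps)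
  have S_add: "x + y \<in> S d" if "x \<in> S d" "y \<in> S d" for d x y
  proof -
    have "(e_tensor (n - d) x - E_scale (phi_U \<alpha> \<beta> n x) (e_tensor n 1)) +
      (e_tensor (n - d) y - E_scale (phi_U \<alpha> \<beta> n y) (e_tensor n 1)) \<in> N"
      using that by (intro E_stableD(2)[OF N]) (auto simp: S_def)
    then have "e_tensor (n - d) (x + y) - E_scale (phi_U \<alpha> \<beta> n (x + y)) (e_tensor n 1) \<in> N"
      by (simp add: single_add U_functionalD[OF phi_U_functional] E.scale_left_distrib algebra_simps)
    then show ?thesis using that hom_add by (simp add: S_def)
  qed
  have S_scale: "U_scale a x \<in> S d" if "x \<in> S d" for a d x
  proof -
    have "E_scale a (e_tensor (n - d) x - E_scale (phi_U \<alpha> \<beta> n x) (e_tensor n 1)) \<in> N"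
      using that by (intro E_stableD(3)[OF N]) (auto simp: S_def)
    then have "e_tensor (n - d) (U_scale a x) - E_scale (phi_U \<alpha> \<beta> n (U_scale a x)) (e_tensor n 1) \<in> N"
      by (simp only: E.scale_right_diff_distrib E_scale E.scale_scale U_functionalD[OF phi_U_functional] U_scale_simps(2))
    moreover have "U_homogeneous d (U_scale a x)"
      using that unfolding S_def U_homogeneous_def
      by (simp add: U_scale_right U_scale_simps mult.commute flip: U.scale_right_diff_distrib)
    ultimately show ?thesis by (simp add: S_def)
  qed
  have S_zero: "0 \<in> S d" for d
    using E_stableD(1)[OF N] by (simp add: S_def U_homogeneous_def U_functionalD[OF phi_U_functional])
  have "\<exists>D y. finite D \<and> (\<forall>d. y d \<in> S d) \<and> (\<forall>d. d \<notin> D \<longrightarrow> y d = 0) \<and> x = (\<Sum>d\<in>D. y d)"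
    using x(1)
  proof (induction rule: U_minus_induct)
    case (mono a ks)
    let ?w = "neg_word ks"
    have "U_mono ?w \<in> S (list_degree ?w)"
      unfolding S_def mem_Collect_eq U_homogeneous_def d0_mono phi_U_mono
      using stable_mono_at[OF N e mono] by simp
    then show ?case
      by (intro exI[of _ "{list_degree ?w}"] exI[of _ "\<lambda>d. if d = list_degree ?w then U_scale a (U_mono ?w) else 0"])
         (auto simp: S_scale S_zero simp del: map_map)
  next
    case (add x y)
    then obtain D y1 D' y2 where
      1: "finite D" "\<And>d. y1 d \<in> S d" "\<And>d. d \<notin> D \<Longrightarrow> y1 d = 0" "x = (\<Sum>d\<in>D. y1 d)" and
      2: "finite D'" "\<And>d. y2 d \<in> S d" "\<And>d. d \<notin> D' \<Longrightarrow> y2 d = 0" "y = (\<Sum>d\<in>D'. y2 d)" by metis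
    have "x = (\<Sum>d\<in>D \<union> D'. y1 d)" "y = (\<Sum>d\<in>D \<union> D'. y2 d)"
      unfolding 1(4) 2(4) using 1 2 by (auto intro!: sum.mono_neutral_left)
    then show ?case using 1 2
      by (intro exI[of _ "D \<union> D'"] exI[of _ "\<lambda>d. y1 d + y2 d"]) (auto simp: S_add sum.distrib)
  qed
  then obtain D y where y: "finite D" "\<And>d. y d \<in> S d" "\<And>d. d \<notin> D \<Longrightarrow> y d = 0" "x = (\<Sum>d\<in>D. y d)" by metis
  let ?z = "\<lambda>d. if d = m then y m - x else y d"
  have "U_homogeneous m (y m - x)"
    using y(2)[of m] x(2) unfolding S_def U_homogeneous_def
    by (simp add: left_diff_distrib right_diff_distrib U.scale_right_diff_distrib algebra_simps)
  then have hom: "U_homogeneous d (?z d)" for d using y(2)[of d] by (auto simp: S_def)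
  have "(\<Sum>d\<in>insert m D. y d) = x" using y by (cases "m \<in> D") (auto simp: insert_absorb)
  then have "(\<Sum>d\<in>insert m D. ?z d) = 0"
    using y(1) by (simp add: sum.insert_remove[of D] cong: sum.cong) (simp add: algebra_simps)
  then have "?z m = 0"
    using homogeneous_independent[of "insert m D" ?z m] y(1) hom by blast
  then have "x = y m" by simp
  then show ?thesis using y(2)[of m] by (simp add: S_def)
qed

text \<open>The preimage of W^(n), see \<open>pull_W_sub\<close>.\<close>

definition E_sub :: "int \<Rightarrow> tensor_cover set" where
  "E_sub n = \<Inter>{N. E_stable \<alpha> \<beta> N \<and> E_kernel \<subseteq> N \<and> (\<forall>i>n. e_tensor i 1 \<in> N)}"

lemma E_stable_sub: "E_stable \<alpha> \<beta> (E_sub n)"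
  unfolding E_sub_def E_stable_def by blast

lemma E_kernel_subset_sub: "E_kernel \<subseteq> E_sub n"
  unfolding E_sub_def by blast

lemma e_tensor_in_sub: "i > n \<Longrightarrow> e_tensor i 1 \<in> E_sub n"
  unfolding E_sub_def by blast

lemma E_sub_least: "E_stable \<alpha> \<beta> N \<Longrightarrow> E_kernel \<subseteq> N \<Longrightarrow> (\<And>i. i > n \<Longrightarrow> e_tensor i 1 \<in> N) \<Longrightarrow> E_sub n \<subseteq> N"
  unfolding E_sub_def by blast

lemma E_sub_ne_kernel: "E_sub n \<noteq> E_kernel"
proof -
  \<comment> \<open>An index above n that avoids 0, the only possibly degenerate one.\<close>
  have "\<bar>n\<bar> + 1 \<noteq> 0" by linarith
  then have "\<not> degenerate (\<bar>n\<bar> + 1)" by (simp add: degenerate_def)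
  then have "e_tensor (\<bar>n\<bar> + 1) 1 \<notin> E_kernel" by (rule single_one_notin_kernel)
  moreover have "e_tensor (\<bar>n\<bar> + 1) 1 \<in> E_sub n" by (rule e_tensor_in_sub) simp
  ultimately show ?thesis by blast
qed

text \<open>The x with x u \<otimes> v_i in N for all i at once form a left ideal: the second-factor
  term of d_m carries the same x at another index.\<close>

lemma stable_all:
  assumes N: "E_stable \<alpha> \<beta> N" and e: "\<And>i. e_tensor i 1 \<in> N"
  shows "N = UNIV"
proof -
  let ?S = "{x. \<forall>i. e_tensor i x \<in> N}"
  have "left_ideal ?S"
  proof (rule left_idealI)
    show "0 \<in> ?S" using E_stableD(1)[OF N] by simp
    show "x \<in> ?S \<Longrightarrow> y \<in> ?S \<Longrightarrow> x + y \<in> ?S" for x y using E_stableD(2)[OF N] by (simp add: single_add)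
    show scale: "x \<in> ?S \<Longrightarrow> U_scale r x \<in> ?S" for r x
      unfolding mem_Collect_eq E_scale(2)[symmetric] using E_stableD(3)[OF N] by blast
    show "Ugen g * x \<in> ?S" if x: "x \<in> ?S" for g x
    proof (cases g)
      case (Dgen m)
      have "e_tensor i (Ugen g * x) \<in> N" for i
      proof -
        have "act_E g (e_tensor i x) \<in> N" using x E_stableD(4)[OF N] by simp
        then have "e_tensor i (Ugen g * x) + e_tensor (m + i) (U_scale (\<alpha> + of_int i + of_int m * \<beta>) x) \<in> N"
          by (simp add: E_act Dgen)
        moreover have "e_tensor (m + i) (U_scale (\<alpha> + of_int i + of_int m * \<beta>) x) \<in> N"
          using scale[OF x] by simp
        ultimately show ?thesis using E_stableD(6)[OF N] by (metis add_diff_cancel_right')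
      qed
      then show ?thesis by simp
    next
      case Cgen
      then show ?thesis
        using E_stableD(4)[OF N, of "e_tensor _ x" Cgen] x by (simp add: E_act)
    qed
  qed
  then have "?S = UNIV" using e left_idealD(3)[of ?S 1] by auto
  then have "e_tensor i x \<in> N" for i x by blast
  then have "f \<in> N" for f by (induction f rule: tensor_cover_induct) (auto intro: E_stableD(2)[OF N])
  then show ?thesis by blast
qed

section \<open>Descent to the largest common zero, and the obstruction there\<close>

definition zero_index :: "Uvir \<Rightarrow> Uvir \<Rightarrow> int \<Rightarrow> bool" where
  "zero_index Q1 Q2 n \<longleftrightarrow> \<not> degenerate n \<and> phi \<alpha> \<beta> n Q1 = 0 \<and> phi \<alpha> \<beta> n Q2 = 0"

context
  fixes Q1 Q2 :: Uvir
  assumes Q: "radical_generators c h Q1 Q2"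
begin

lemma stable_contains_next:
  assumes N: "E_stable \<alpha> \<beta> N" "E_kernel \<subseteq> N" and e: "\<And>i. i > n \<Longrightarrow> e_tensor i 1 \<in> N"
    and n: "\<not> zero_index Q1 Q2 n"
  shows "e_tensor n 1 \<in> N"
proof (cases "degenerate n")
  case True
  then show ?thesis using single_degenerate_in_kernel N(2) by blast
next
  case False
  have "\<exists>q. q \<in> U_minus \<and> q \<in> L \<and> (\<exists>m. U_homogeneous m q) \<and> phi \<alpha> \<beta> n q \<noteq> 0"
    using False n Q unfolding zero_index_def radical_generators_def by blast
  then obtain q m where m: "q \<in> U_minus" "q \<in> L" "U_homogeneous m q" and nonzero: "phi \<alpha> \<beta> n q \<noteq> 0"
    by (elim conjE exE)
  have "e_tensor (n - m) q - E_scale (phi_U \<alpha> \<beta> n q) (e_tensor n 1) \<in> N"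
    by (rule stable_homogeneous[OF N(1) e m(1,3)])
  moreover have "e_tensor (n - m) q \<in> N" using single_in_kernel[OF m(2)] N(2) by blast
  ultimately have "E_scale (phi_U \<alpha> \<beta> n q) (e_tensor n 1) \<in> N" using E_stable_cong[OF N(1)] by blast
  then have "E_scale (1 / phi_U \<alpha> \<beta> n q) (E_scale (phi_U \<alpha> \<beta> n q) (e_tensor n 1)) \<in> N"
    by (rule E_stableD(3)[OF N(1)])
  then show ?thesis using nonzero phi_eq_phi_U[OF m(1)] by simp
qed

lemma stable_contains_above:
  assumes N: "E_stable \<alpha> \<beta> N" "E_kernel \<subseteq> N" "N \<noteq> E_kernel" and n: "\<And>m. m > n \<Longrightarrow> \<not> zero_index Q1 Q2 m"
    and i: "i > n"
  shows "e_tensor i 1 \<in> N"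
proof -
  obtain f where "f \<in> N" "f \<notin> E_kernel" using N(2,3) by blast
  then obtain S where S: "\<And>s. s \<ge> S \<Longrightarrow> e_tensor s 1 \<in> N" using stable_contains_large[OF N(1,2)] by blast
  \<comment> \<open>The descent by k steps below the bound S, written as an induction on k.\<close>
  have "\<forall>j\<ge>S - int k. j > n \<longrightarrow> e_tensor j 1 \<in> N" for k
  proof (induction k)
    case (Suc k)
    show ?case
    proof (intro allI impI)
      fix j assume j: "S - int (Suc k) \<le> j" "n < j"
      show "e_tensor j 1 \<in> N"
      proof (rule stable_contains_next[OF N(1,2)])
        show "e_tensor i 1 \<in> N" if "i > j" for i using Suc j that by simp
        show "\<not> zero_index Q1 Q2 j" using n j by blast
      qed
    qed
  qed (use S in simp)
  from this[of "nat (S - i)"] i show ?thesis by auto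
qed

text \<open>
  The functional \<open>x u \<otimes> v\<^sub>i \<mapsto> \<phi>\<^sub>n(x)\<close> (for the degree \<open>n - i\<close> part of \<open>x\<close>) is invariant under
  \<open>Vir\<^sub>-\<close>, hence vanishes on the submodule generated by the \<open>u \<otimes> v\<^sub>i\<close> with \<open>i > n\<close>.
\<close>

definition coinvariant :: "int \<Rightarrow> tensor_cover \<Rightarrow> complex" where
  "coinvariant n = lin_ext (\<lambda>i. verma_phi c h \<alpha> \<beta> n (n - i))"

lemma coinvariant:
  "coinvariant n (f + g) = coinvariant n f + coinvariant n g"
  "coinvariant n (e_tensor i x) = verma_phi c h \<alpha> \<beta> n (n - i) x"
  "coinvariant n 0 = 0"
  unfolding coinvariant_def by (rule lin_ext; simp add: additive_family_def verma_phiD)+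

lemma coinvariant_scale: "coinvariant n (E_scale a f) = a * coinvariant n f"
  by (induction f rule: tensor_cover_induct) (simp_all add: coinvariant E_scale verma_phiD algebra_simps)

text \<open>The two summands of d_(-k) (x u \<otimes> v_i) contribute k \<beta> - \<alpha> - i and
  \<alpha> + i - k \<beta>, times the same value at x.\<close>

lemma coinvariant_d_neg: "k > 0 \<Longrightarrow> coinvariant n (act_E (Dgen (- k)) f) = 0"
proof (induction f rule: tensor_cover_induct)
  case (single i x)
  have "n - (- k + i) = n - i + k" by simp
  then show ?case
    using single by (simp only: E_act gen_tensor.simps coinvariant verma_phi_d_neg verma_phiD) (simp add: algebra_simps)
qed (simp add: E_act coinvariant)

lemma coinvariant_kernel:
  assumes "zero_index Q1 Q2 n" "f \<in> E_kernel"
  shows "coinvariant n f = 0"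
proof -
  have "verma_phi c h \<alpha> \<beta> n (n - i) (Poly_Mapping.lookup f i) = 0" for i
  proof (cases "degenerate i")
    case True
    \<comment> \<open>This is why n = 0 is excluded for (\<alpha>,\<beta>) = (0,0): the functional
      for n = 0 is 1 at u \<otimes> v_0, which is zero in the module.\<close>
    then have "\<alpha> = 0" "\<beta> = 0" "i = 0" "n \<noteq> 0"
      using assms(1) unfolding degenerate_def zero_index_def by blast+
    then show ?thesis using verma_phi_trivial by simp
  next
    case False
    then show ?thesis
      using assms verma_phi_radical[OF Q] by (simp add: zero_index_def E_kernel_def)
  qed
  then show ?thesis by (simp add: coinvariant_def lin_ext_def)
qed

text \<open>Up to the kernel, W^(n) is spanned by words in Vir_- applied to the u \<otimes> v_i with
  i > n. This description matches \<open>coinvariant\<close>, whose invariance concerns Vir_-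
  alone.\<close>

inductive_set neg_span :: "int \<Rightarrow> tensor_cover set" for n where
  base: "i > n \<Longrightarrow> e_tensor i 1 \<in> neg_span n"
| kernel: "f \<in> E_kernel \<Longrightarrow> f \<in> neg_span n"
| add: "f \<in> neg_span n \<Longrightarrow> g \<in> neg_span n \<Longrightarrow> f + g \<in> neg_span n"
| scale: "f \<in> neg_span n \<Longrightarrow> E_scale a f \<in> neg_span n"
| neg: "f \<in> neg_span n \<Longrightarrow> k > 0 \<Longrightarrow> act_E (Dgen (- k)) f \<in> neg_span n"

text \<open>Modulo the kernel, a Borel generator turns u \<otimes> v_i into a combination of vectors
  u \<otimes> v_j with j \<ge> i. In front of d_(-k) a generator is commuted inward; the commutator
  is another generator, hence the induction for all g at once.\<close>

lemma E_stable_neg_span: "E_stable \<alpha> \<beta> (neg_span n)"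
proof -
  have "act_E g f \<in> neg_span n" if "f \<in> neg_span n" for f g
    using that
  proof (induction arbitrary: g)
    case (base i)
    have e_scale: "e_tensor j (U_scale r 1) \<in> neg_span n" if "j > n" for j r
      using neg_span.scale[OF neg_span.base[OF that], of r] by (simp add: E_scale)
    have borel: "e_tensor i (Ugen b) \<in> neg_span n" if "b \<in> borel_gens" for b
    proof -
      have "e_tensor i (Ugen b - U_scale (highest_weight c h b) 1) \<in> neg_span n"
        by (intro neg_span.kernel single_in_kernel VI_subset_radical verma_ideal_gen that)
      from neg_span.add[OF this e_scale[OF base, of "highest_weight c h b"]] show ?thesis
        by (simp only: single_add[symmetric] diff_add_cancel)
    qed
    show ?case
    proof (cases "g \<in> borel_gens")
      case True
      show ?thesis
      proof (cases g)
        case (Dgen m)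
        then have "m \<ge> 0" using True by (simp add: borel_gens_def)
        then have "e_tensor (m + i) (U_scale (\<alpha> + of_int i + of_int m * \<beta>) 1) \<in> neg_span n"
          using base by (intro e_scale) simp
        with borel[OF True] show ?thesis by (simp add: E_act Dgen neg_span.add)
      next
        case Cgen
        then show ?thesis using borel[OF True] by (simp add: E_act)
      qed
    next
      case False
      then obtain m where "g = Dgen (- m)" "m > 0"
        by (cases g) (auto simp: borel_gens_def intro: that[of "- _"])
      then show ?thesis using neg_span.neg[OF neg_span.base[OF base]] by simp
    qed
  next
    case (kernel f)
    then show ?case using E_kernelD(4) neg_span.kernel by blast
  next
    case (neg f k)
    show ?case
    proof (cases g)
      case (Dgen m)
      show ?thesis
        unfolding Dgen E_act_bracket[of \<alpha> \<beta> m "- k"] using neg by (intro neg_span.add neg_span.scale neg_span.neg)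
    next
      case Cgen
      show ?thesis
        unfolding Cgen E_act_central using neg by (intro neg_span.neg)
    qed
  qed (auto simp: E_act E_act_scale intro: neg_span.add neg_span.scale)
  then show ?thesis
    unfolding E_stable_def using neg_span.kernel[OF E_kernelD(1)] neg_span.add neg_span.scale by blast
qed

lemma e_tensor_notin_sub:
  assumes "zero_index Q1 Q2 n"
  shows "e_tensor n 1 \<notin> E_sub n"
proof
  assume "e_tensor n 1 \<in> E_sub n"
  then have "e_tensor n 1 \<in> neg_span n"
    using E_sub_least[OF E_stable_neg_span, of n n] neg_span.kernel neg_span.base by blast
  moreover have "coinvariant n f = 0" if "f \<in> neg_span n" for f
    using that by induction
      (simp_all add: coinvariant coinvariant_scale coinvariant_d_neg coinvariant_kernel[OF assms] verma_phi_one)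
  ultimately have "coinvariant n (e_tensor n 1) = 0" by blast
  then show False by (simp add: coinvariant verma_phi_one)
qed

lemma E_simple_iff:
  "(\<forall>N. E_stable \<alpha> \<beta> N \<and> E_kernel \<subseteq> N \<longrightarrow> N = E_kernel \<or> N = UNIV) \<longleftrightarrow> \<not> (\<exists>n. zero_index Q1 Q2 n)"
proof
  assume *: "\<forall>N. E_stable \<alpha> \<beta> N \<and> E_kernel \<subseteq> N \<longrightarrow> N = E_kernel \<or> N = UNIV"
  show "\<not> (\<exists>n. zero_index Q1 Q2 n)"
  proof
    assume "\<exists>n. zero_index Q1 Q2 n"
    then obtain n where "e_tensor n 1 \<notin> E_sub n" using e_tensor_notin_sub by blast
    moreover have "E_sub n = UNIV"
      using *[rule_format, OF conjI[OF E_stable_sub E_kernel_subset_sub], of n] E_sub_ne_kernel by blast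
    ultimately show False by simp
  qed
next
  assume no: "\<not> (\<exists>n. zero_index Q1 Q2 n)"
  show "\<forall>N. E_stable \<alpha> \<beta> N \<and> E_kernel \<subseteq> N \<longrightarrow> N = E_kernel \<or> N = UNIV"
  proof (intro allI impI)
    fix N assume N: "E_stable \<alpha> \<beta> N \<and> E_kernel \<subseteq> N"
    show "N = E_kernel \<or> N = UNIV"
    proof (cases "N = E_kernel")
      case False
      have "e_tensor i 1 \<in> N" for i
        using stable_contains_above[of N "i - 1" i] N False no by simp
      then show ?thesis using stable_all N by blast
    qed simp
  qed
qed

lemma E_sub_minimal:
  assumes "\<And>m. zero_index Q1 Q2 m \<Longrightarrow> m \<le> n" "E_stable \<alpha> \<beta> N" "E_kernel \<subseteq> N" "N \<noteq> E_kernel"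
  shows "E_sub n \<subseteq> N"
proof (rule E_sub_least[OF assms(2,3)])
  fix i assume "i > n"
  moreover have "\<not> zero_index Q1 Q2 m" if "m > n" for m using assms(1)[of m] that by auto
  ultimately show "e_tensor i 1 \<in> N" by (intro stable_contains_above[OF assms(2,3,4)])
qed

text \<open>The given eigenvector shows that \<mu> = \<alpha> + h + m for an integer m. Then d_(m-j)
  (u \<otimes> v_j) has weight \<mu>, and its component at j is d_(m-j) u.\<close>

lemma weight_vectors_unbounded:
  assumes n: "zero_index Q1 Q2 n" and f: "f \<notin> E_kernel" "act_E (Dgen 0) f - E_scale \<mu> f \<in> E_kernel"
  shows "\<exists>S. \<forall>i\<ge>S. \<exists>g \<in> E_sub n. act_E (Dgen 0) g - E_scale \<mu> g \<in> E_kernel \<and>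
    \<not> degenerate i \<and> Poly_Mapping.lookup g i \<notin> L"
proof -
  have "\<not> (c = 0 \<and> h = 0)"
    using no_phi_zero_trivial[of Q1 Q2 \<alpha> \<beta> n] Q n beta_ne_1 by (auto simp: zero_index_def)
  then obtain K where K: "\<And>k. k \<ge> K \<Longrightarrow> Ugen (Dgen (- k)) \<notin> L" using d_neg_notin_radical[of c h] by blast
  obtain i where i: "\<not> degenerate i" "Poly_Mapping.lookup f i \<notin> L" using f(1) by (auto simp: E_kernel_def)
  have "Ugen (Dgen 0) * Poly_Mapping.lookup f i + U_scale (\<alpha> + of_int i) (Poly_Mapping.lookup f i) -
      U_scale \<mu> (Poly_Mapping.lookup f i) \<in> L"
    using f(2) i(1) unfolding E_kernel_def by (simp add: lookup_minus lookup_E_act lookup_E_scale)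
  then have "Ugen (Dgen 0) * Poly_Mapping.lookup f i - U_scale (\<mu> - \<alpha> - of_int i) (Poly_Mapping.lookup f i) \<in> L"
    by (simp add: U.scale_left_diff_distrib U_scale_add_left algebra_simps)
  then obtain d :: int where "\<mu> - \<alpha> - of_int i = h + of_int d" using weight_vector_in_radical i(2) by blast
  then obtain m :: int where m: "\<mu> = \<alpha> + h + of_int m"
    by (intro that[of "i + d"]) (simp add: algebra_simps)
  \<comment> \<open>The bounds on j ensure, in turn: j is not degenerate; u \<otimes> v_j lies in
    W^(n); m < j, so the second-factor term sits at the different index m; and d_(m-j) u is nonzero
    in V(c,h).\<close>
  have "\<exists>g \<in> E_sub n. act_E (Dgen 0) g - E_scale \<mu> g \<in> E_kernel \<and> \<not> degenerate j \<and> Poly_Mapping.lookup g j \<notin> L"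
    if j: "j \<ge> max 1 (max (n + 1) (max (m + 1) (m + K)))" for j
  proof
    let ?k = "j - m"
    let ?e = "e_tensor j 1"
    let ?g = "act_E (Dgen (- ?k)) ?e"
    show "?g \<in> E_sub n"
      using j by (intro E_stableD(4)[OF E_stable_sub] e_tensor_in_sub) simp
    have e: "act_E (Dgen 0) ?e - E_scale (h + \<alpha> + of_int j) ?e \<in> E_kernel"
    proof -
      have "Ugen (Dgen 0) - U_scale h 1 \<in> verma_ideal c h"
        using verma_ideal_gen[of "Dgen 0" c h] by (simp add: borel_gens_def)
      then have "e_tensor j (Ugen (Dgen 0) - U_scale h 1) \<in> E_kernel"
        by (intro single_in_kernel VI_subset_radical)
      then show ?thesis
        by (simp add: E_act E_scale U_scale_add_left add.assoc single_add single_diff)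
    qed
    have "d_cocycle 0 (- ?k) = 0" by simp
    then have "act_E (Dgen 0) ?g = act_E (Dgen (- ?k)) (act_E (Dgen 0) ?e) + E_scale (of_int (m - j)) ?g"
      using E_act_bracket[of \<alpha> \<beta> 0 "- ?k" ?e] by simp
    moreover have "E_scale \<mu> ?g = act_E (Dgen (- ?k)) (E_scale (h + \<alpha> + of_int j) ?e) + E_scale (of_int (m - j)) ?g"
      unfolding E_act_scale E.scale_left_distrib[symmetric] m by (rule arg_cong[where f = "\<lambda>a. E_scale a ?g"]) simp
    ultimately have "act_E (Dgen 0) ?g - E_scale \<mu> ?g =
        act_E (Dgen (- ?k)) (act_E (Dgen 0) ?e - E_scale (h + \<alpha> + of_int j) ?e)"
      by (simp add: E_act_diff)
    also have "\<dots> \<in> E_kernel" by (rule E_kernelD(4)[OF e])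
    finally have 1: "act_E (Dgen 0) ?g - E_scale \<mu> ?g \<in> E_kernel" .
    have "Poly_Mapping.lookup ?g j = Ugen (Dgen (- ?k))"
      using j by (simp add: lookup_E_act lookup_single)
    moreover have "Ugen (Dgen (- ?k)) \<notin> L" by (rule K) (use j in simp)
    moreover have "\<not> degenerate j" using j by (simp add: degenerate_def)
    ultimately show "act_E (Dgen 0) ?g - E_scale \<mu> ?g \<in> E_kernel \<and> \<not> degenerate j \<and> Poly_Mapping.lookup ?g j \<notin> L"
      using 1 by simp
  qed
  then show ?thesis by blast
qed

end

end

section \<open>Modules as images of vector spaces\<close>

text \<open>
  A module \<open>T\<close> is handled through a map \<open>p\<close> onto \<open>T\<close> from a subspace \<open>S\<close> of a type that is itself
  a vector space with operators. Each quotient then only enlarges the kernel of \<open>p\<close>.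
\<close>

locale rep_image =
  fixes sc :: "complex \<Rightarrow> 'e::ab_group_add \<Rightarrow> 'e" and ac :: "vir_gen \<Rightarrow> 'e \<Rightarrow> 'e"
    and S :: "'e set" and p :: "'e \<Rightarrow> 'a" and T :: "('a, 'm) vir_rep_scheme"
  assumes vs: "vector_space sc"
    and S_zero: "0 \<in> S" and S_add: "x \<in> S \<Longrightarrow> y \<in> S \<Longrightarrow> x + y \<in> S"
    and S_scale: "x \<in> S \<Longrightarrow> sc a x \<in> S" and S_act: "x \<in> S \<Longrightarrow> ac g x \<in> S"
    and ac_add: "x \<in> S \<Longrightarrow> y \<in> S \<Longrightarrow> ac g (x + y) = ac g x + ac g y"
    and ac_scale: "x \<in> S \<Longrightarrow> ac g (sc a x) = sc a (ac g x)"
    and p_onto: "p ` S = carrier T"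
    and p_add: "x \<in> S \<Longrightarrow> y \<in> S \<Longrightarrow> p (x + y) = p x \<oplus>\<^bsub>T\<^esub> p y"
    and p_zero: "p 0 = \<zero>\<^bsub>T\<^esub>"
    and p_scale: "x \<in> S \<Longrightarrow> p (sc a x) = a \<odot>\<^bsub>T\<^esub> p x"
    and p_act: "x \<in> S \<Longrightarrow> p (ac g x) = act T g (p x)"
begin

lemma sc_simps:
  "sc a (x + y) = sc a x + sc a y" "sc (a + b) x = sc a x + sc b x" "sc a (sc b x) = sc (a * b) x"
  "sc 1 x = x" "sc 0 x = 0" "sc a 0 = 0" "sc (- 1) x = - x" "sc a (x - y) = sc a x - sc a y"
  using vs by (simp_all add: vector_space.vector_space_assms vector_space.vector_space_assms(3)
      module.scale_zero_left module.scale_zero_right module.scale_minus_left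
      module.scale_right_diff_distrib vector_space.vector_space_assms(4) module_iff_vector_space)

lemma S_uminus: "x \<in> S \<Longrightarrow> - x \<in> S"
  using S_scale[of x "- 1"] by (simp add: sc_simps)

lemma S_diff: "x \<in> S \<Longrightarrow> y \<in> S \<Longrightarrow> x - y \<in> S"
  using S_add[of x "- y"] S_uminus[of y] by simp

lemma ac_uminus: "x \<in> S \<Longrightarrow> ac g (- x) = - ac g x"
  using ac_scale[of x g "- 1"] by (simp add: sc_simps)

lemma ac_diff: "x \<in> S \<Longrightarrow> y \<in> S \<Longrightarrow> ac g (x - y) = ac g x - ac g y"
  using ac_add[of x "- y"] S_uminus[of y] by (simp add: ac_uminus)

lemma p_closed: "x \<in> S \<Longrightarrow> p x \<in> carrier T"
  using p_onto by blast

lemma carrierE: assumes "t \<in> carrier T" obtains x where "x \<in> S" "t = p x"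
  using assms p_onto by blast

lemma module_T: "module complex_ring T"
proof (rule moduleI)
  show "cring complex_ring" by (rule cring_from_type_algebra)
  show "abelian_group T"
  proof (rule abelian_groupI)
    fix t u v assume "t \<in> carrier T" "u \<in> carrier T" "v \<in> carrier T"
    then obtain x y z where xyz: "x \<in> S" "y \<in> S" "z \<in> S" "t = p x" "u = p y" "v = p z" by (metis carrierE)
    show "t \<oplus>\<^bsub>T\<^esub> u \<oplus>\<^bsub>T\<^esub> v = t \<oplus>\<^bsub>T\<^esub> (u \<oplus>\<^bsub>T\<^esub> v)"
      using xyz by (simp add: S_add flip: p_add) (simp add: add.assoc)
    show "t \<oplus>\<^bsub>T\<^esub> u = u \<oplus>\<^bsub>T\<^esub> t" "t \<oplus>\<^bsub>T\<^esub> u \<in> carrier T"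
      using xyz by (simp_all add: p_closed S_add add.commute flip: p_add)
  next
    fix t assume "t \<in> carrier T"
    then obtain x where x: "x \<in> S" "t = p x" by (rule carrierE)
    show "\<zero>\<^bsub>T\<^esub> \<oplus>\<^bsub>T\<^esub> t = t" using x p_add[OF S_zero x(1)] by (simp add: p_zero)
    show "\<exists>u\<in>carrier T. u \<oplus>\<^bsub>T\<^esub> t = \<zero>\<^bsub>T\<^esub>"
      using x S_uminus[OF x(1)] p_add[of "- x" x] by (intro bexI[of _ "p (- x)"]) (simp_all add: p_zero p_closed)
  qed (use p_closed[OF S_zero] p_zero in simp)
qed (auto elim!: carrierE simp: ring_of_type_algebra_def p_closed S_scale S_add sc_simps
    simp flip: p_scale p_add)

lemma p_uminus: "x \<in> S \<Longrightarrow> \<ominus>\<^bsub>T\<^esub> p x = p (- x)"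
proof -
  assume x: "x \<in> S"
  interpret T: module complex_ring T by (rule module_T)
  have "p (- x) \<oplus>\<^bsub>T\<^esub> p x = \<zero>\<^bsub>T\<^esub>" using x by (simp add: S_uminus p_zero flip: p_add)
  then show ?thesis using x by (simp add: T.minus_equality p_closed S_uminus)
qed

lemma p_diff: "x \<in> S \<Longrightarrow> y \<in> S \<Longrightarrow> p (x - y) = p x \<ominus>\<^bsub>T\<^esub> p y"
  using p_add[of x "- y"] by (simp add: a_minus_def p_uminus S_uminus)

lemma p_eq_iff: assumes "x \<in> S" "y \<in> S" shows "p x = p y \<longleftrightarrow> p (x - y) = \<zero>\<^bsub>T\<^esub>"
proof
  interpret T: module complex_ring T by (rule module_T)
  show "p (x - y) = \<zero>\<^bsub>T\<^esub>" if "p x = p y"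
    using that assms p_closed[OF assms(2)] by (simp add: p_diff T.r_neg a_minus_def)
  assume "p (x - y) = \<zero>\<^bsub>T\<^esub>"
  then have "p x = \<zero>\<^bsub>T\<^esub> \<oplus>\<^bsub>T\<^esub> p y" using p_add[of "x - y" y] assms by (simp add: S_diff)
  then show "p x = p y" using assms p_closed by simp
qed

definition pull :: "'a set \<Rightarrow> 'e set" where
  "pull H = {x \<in> S. p x \<in> H}"

lemma p_pull: "H \<subseteq> carrier T \<Longrightarrow> p ` pull H = H"
  using p_onto by (auto simp: pull_def)

lemma submodule_iff:
  "submodule H complex_ring T \<longleftrightarrow> H \<subseteq> carrier T \<and> 0 \<in> pull H \<and>
     (\<forall>x\<in>pull H. \<forall>y\<in>pull H. x + y \<in> pull H) \<and> (\<forall>a. \<forall>x\<in>pull H. sc a x \<in> pull H)"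
proof
  interpret T: module complex_ring T by (rule module_T)
  {
    assume H: "submodule H complex_ring T"
    note E = T.submoduleE[OF H]
    have "\<zero>\<^bsub>T\<^esub> \<in> H" using H by (simp add: submodule_def subgroup_def)
    then show "H \<subseteq> carrier T \<and> 0 \<in> pull H \<and>
     (\<forall>x\<in>pull H. \<forall>y\<in>pull H. x + y \<in> pull H) \<and> (\<forall>a. \<forall>x\<in>pull H. sc a x \<in> pull H)"
      using E(1) E(4) E(5) by (auto simp: pull_def S_zero S_add S_scale p_zero p_add p_scale ring_of_type_algebra_def)
  next
    assume *: "H \<subseteq> carrier T \<and> 0 \<in> pull H \<and>
     (\<forall>x\<in>pull H. \<forall>y\<in>pull H. x + y \<in> pull H) \<and> (\<forall>a. \<forall>x\<in>pull H. sc a x \<in> pull H)"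
    have ex: "\<exists>x\<in>pull H. t = p x" if "t \<in> H" for t using p_pull[of H] * that by blast
    show "submodule H complex_ring T"
    proof (rule T.submoduleI)
      show "H \<subseteq> carrier T" using * by blast
      show "\<zero>\<^bsub>T\<^esub> \<in> H" using * by (simp add: pull_def p_zero)
      show "\<ominus>\<^bsub>T\<^esub> t \<in> H" if t: "t \<in> H" for t
      proof -
        obtain x where x: "x \<in> pull H" "t = p x" using ex[OF t] by blast
        then have "sc (- 1) x \<in> pull H" using * by blast
        then show ?thesis using x by (simp add: sc_simps pull_def p_uminus)
      qed
      show "t \<oplus>\<^bsub>T\<^esub> u \<in> H" if tu: "t \<in> H" "u \<in> H" for t u
      proof -
        obtain x y where x: "x \<in> pull H" "t = p x" "y \<in> pull H" "u = p y" using ex tu by meson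
        then have "x + y \<in> pull H" using * by blast
        then show ?thesis using x by (simp add: pull_def p_add)
      qed
      show "a \<odot>\<^bsub>T\<^esub> t \<in> H" if t: "t \<in> H" for a t
      proof -
        obtain x where x: "x \<in> pull H" "t = p x" using ex[OF t] by blast
        then have "sc a x \<in> pull H" using * by blast
        then show ?thesis using x by (simp add: pull_def p_scale)
      qed
    qed
  }
qed

lemma vir_submodule_iff:
  "vir_submodule H T \<longleftrightarrow> H \<subseteq> carrier T \<and> 0 \<in> pull H \<and>
     (\<forall>x\<in>pull H. \<forall>y\<in>pull H. x + y \<in> pull H) \<and> (\<forall>a. \<forall>x\<in>pull H. sc a x \<in> pull H) \<and>
     (\<forall>g. \<forall>x\<in>pull H. ac g x \<in> pull H)"
proof -
  have "(\<forall>g. \<forall>t\<in>H. act T g t \<in> H) \<longleftrightarrow> (\<forall>g. \<forall>x\<in>pull H. ac g x \<in> pull H)" if "H \<subseteq> carrier T"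
  proof -
    have "(\<forall>t\<in>H. act T g t \<in> H) \<longleftrightarrow> (\<forall>t\<in>p ` pull H. act T g t \<in> H)" for g
      using p_pull[OF that] by simp
    also have "\<dots> g \<longleftrightarrow> (\<forall>x\<in>pull H. ac g x \<in> pull H)" for g
      by (auto simp: pull_def S_act p_act)
    finally show ?thesis by blast
  qed
  then show ?thesis unfolding vir_submodule_def submodule_iff by blast
qed

lemma quotient_coset:
  assumes "submodule N complex_ring T" "x \<in> S"
  shows "N +>\<^bsub>T\<^esub> p x = p ` {y \<in> S. y - x \<in> pull N}"
proof -
  have N: "N \<subseteq> carrier T" using assms(1) submodule_iff by blast
  show ?thesis
    unfolding a_r_coset_def'
  proof (intro equalityI subsetI)
    fix t assume "t \<in> (\<Union>h\<in>N. {h \<oplus>\<^bsub>T\<^esub> p x})"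
    then obtain n where n: "n \<in> N" "t = n \<oplus>\<^bsub>T\<^esub> p x" by blast
    then obtain z where z: "z \<in> pull N" "n = p z" using p_pull[OF N] by blast
    then have "t = p (z + x)" using n assms(2) by (simp add: pull_def p_add)
    moreover have "z + x \<in> S" using z assms(2) by (simp add: pull_def S_add)
    ultimately show "t \<in> p ` {y \<in> S. y - x \<in> pull N}" using z by (auto intro!: image_eqI[of _ _ "z + x"])
  next
    fix t assume "t \<in> p ` {y \<in> S. y - x \<in> pull N}"
    then obtain y where y: "y \<in> S" "y - x \<in> pull N" "t = p y" by blast
    have "t = p (y - x) \<oplus>\<^bsub>T\<^esub> p x" using y assms(2) p_add[of "y - x" x] by (simp add: S_diff)
    then show "t \<in> (\<Union>h\<in>N. {h \<oplus>\<^bsub>T\<^esub> p x})" using y by (auto simp: pull_def)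
  qed
qed

text \<open>The operations of \<open>vir_quotient\<close> are unions over the representatives of a
  coset. As N is stable, all of them give one and the same coset, so the composed map inherits every
  property of p and only its kernel grows.\<close>

lemma rep_image_quotient:
  assumes N: "vir_submodule N T"
  shows "rep_image sc ac S (\<lambda>x. N +>\<^bsub>T\<^esub> p x) (vir_quotient T N)"
    and "x \<in> S \<Longrightarrow> N +>\<^bsub>T\<^esub> p x = \<zero>\<^bsub>vir_quotient T N\<^esub> \<longleftrightarrow> p x \<in> N"
proof -
  let ?P = "pull N"
  have sub: "submodule N complex_ring T" using N by (simp add: vir_submodule_def)
  have NC: "N \<subseteq> carrier T" and P0: "0 \<in> ?P" and P_add: "\<And>x y. x \<in> ?P \<Longrightarrow> y \<in> ?P \<Longrightarrow> x + y \<in> ?P"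
    and P_scale: "\<And>a x. x \<in> ?P \<Longrightarrow> sc a x \<in> ?P" and P_act: "\<And>g x. x \<in> ?P \<Longrightarrow> ac g x \<in> ?P"
    using N unfolding vir_submodule_iff by blast+
  have P_S: "x \<in> ?P \<Longrightarrow> x \<in> S" for x by (simp add: pull_def)
  have P_uminus: "x \<in> ?P \<Longrightarrow> - x \<in> ?P" for x using P_scale[of x "- 1"] by (simp add: sc_simps)
  define r where "r = (\<lambda>x. N +>\<^bsub>T\<^esub> p x)"
  have r: "r x = p ` {y \<in> S. y - x \<in> ?P}" if "x \<in> S" for x
    unfolding r_def by (rule quotient_coset[OF sub that])
  have r_sub: "r x \<subseteq> r y" if "x \<in> S" "y \<in> S" "x - y \<in> ?P" for x y
  proof -
    have "z - y \<in> ?P" if "z - x \<in> ?P" for z using P_add[OF that \<open>x - y \<in> ?P\<close>] by simp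
    then show ?thesis unfolding r[OF that(1)] r[OF that(2)] by blast
  qed
  have r_cong: "r x = r y" if "x \<in> S" "y \<in> S" "x - y \<in> ?P" for x y
    using r_sub[OF that] r_sub[OF that(2,1)] P_uminus[OF that(3)] by simp
  have mem_r: "p x \<in> r x" if "x \<in> S" for x using r[OF that] that P0 by auto
  have r_eqD: "x - y \<in> ?P" if eq: "r x = r y" "x \<in> S" "y \<in> S" for x y
  proof -
    have "p x \<in> r y" using mem_r[OF eq(2)] eq(1) by simp
    then obtain z where z: "z \<in> S" "z - y \<in> ?P" "p x = p z" using r[OF eq(3)] by blast
    have "p (x - z) = \<zero>\<^bsub>T\<^esub>" using p_eq_iff[OF eq(2) z(1)] z(3) by simp
    then have "x - z \<in> ?P" using eq z P0 by (auto simp: pull_def S_diff p_zero)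
    from P_add[OF this z(2)] show ?thesis by simp
  qed
  have r_zero: "r 0 = N"
  proof -
    have "{y \<in> S. y - 0 \<in> ?P} = ?P" using P_S by auto
    then show ?thesis using r[OF S_zero] p_pull[OF NC] by simp
  qed
  have p_carrier: "(\<Union>a\<in>carrier T. {N +>\<^bsub>T\<^esub> a}) = r ` S"
    unfolding p_onto[symmetric] r_def by blast
  have r_add: "r (x + y) = r x <+>\<^bsub>T\<^esub> r y" if xy: "x \<in> S" "y \<in> S" for x y
  proof -
    have "(\<Union>s\<in>r x. \<Union>t\<in>r y. {s \<oplus>\<^bsub>T\<^esub> t}) = r (x + y)"
    proof (intro equalityI subsetI)
      fix t assume "t \<in> (\<Union>s\<in>r x. \<Union>t\<in>r y. {s \<oplus>\<^bsub>T\<^esub> t})"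
      then obtain x' y' where *: "x' \<in> S" "x' - x \<in> ?P" "y' \<in> S" "y' - y \<in> ?P" "t = p x' \<oplus>\<^bsub>T\<^esub> p y'"
        unfolding r[OF xy(1)] r[OF xy(2)] by blast
      then have "x' + y' - (x + y) \<in> ?P" using P_add[OF *(2) *(4)] by (simp add: algebra_simps)
      then show "t \<in> r (x + y)" using * xy by (auto simp: r S_add p_add intro!: image_eqI[of _ _ "x' + y'"])
    next
      fix t assume "t \<in> r (x + y)"
      then obtain z where z: "z \<in> S" "z - (x + y) \<in> ?P" "t = p z" using r[OF S_add[OF xy]] by blast
      have "p (z - y) \<in> r x" using z xy by (auto simp: r S_diff algebra_simps)
      moreover have "p (z - y) \<oplus>\<^bsub>T\<^esub> p y = t" using z xy p_add[of "z - y" y] by (simp add: S_diff)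
      ultimately show "t \<in> (\<Union>s\<in>r x. \<Union>t\<in>r y. {s \<oplus>\<^bsub>T\<^esub> t})" using mem_r[OF xy(2)] by blast
    qed
    then show ?thesis unfolding set_add_def' ..
  qed
  have r_op: "(\<Union>t\<in>r x. N +>\<^bsub>T\<^esub> F t) = r (G x)"
    if x: "x \<in> S" and G: "\<And>y. y \<in> S \<Longrightarrow> G y \<in> S" "\<And>y. y \<in> S \<Longrightarrow> F (p y) = p (G y)"
      "\<And>y. y \<in> S \<Longrightarrow> y - x \<in> ?P \<Longrightarrow> G y - G x \<in> ?P" for x F G
  proof -
    have "N +>\<^bsub>T\<^esub> F t = r (G x)" if t: "t \<in> r x" for t
    proof -
      obtain y where y: "y \<in> S" "y - x \<in> ?P" "t = p y" using t r[OF x] by blast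
      then have "N +>\<^bsub>T\<^esub> F t = r (G y)" by (simp add: r_def G)
      then show ?thesis using r_cong[OF G(1)[OF y(1)] G(1)[OF x] G(3)[OF y(1,2)]] by simp
    qed
    then show ?thesis using mem_r[OF x] by auto
  qed
  have r_scale: "(\<Union>t\<in>r x. N +>\<^bsub>T\<^esub> (a \<odot>\<^bsub>T\<^esub> t)) = r (sc a x)" if "x \<in> S" for x a
    using that P_scale by (intro r_op) (auto simp: S_scale p_scale simp flip: sc_simps(8))
  have r_act: "(\<Union>t\<in>r x. N +>\<^bsub>T\<^esub> act T g t) = r (ac g x)" if "x \<in> S" for x g
    using that P_act by (intro r_op) (auto simp: S_act p_act simp flip: ac_diff)
  show "rep_image sc ac S (\<lambda>x. N +>\<^bsub>T\<^esub> p x) (vir_quotient T N)"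
    unfolding r_def[symmetric]
    by unfold_locales
       (simp_all add: vs vir_quotient_def A_RCOSETS_def' p_carrier r_add r_scale r_act r_zero
        S_zero S_add S_scale S_act ac_add ac_scale vector_space.vector_space_assms)
  show "x \<in> S \<Longrightarrow> N +>\<^bsub>T\<^esub> p x = \<zero>\<^bsub>vir_quotient T N\<^esub> \<longleftrightarrow> p x \<in> N"
  proof -
    assume x: "x \<in> S"
    have "r x = N \<longleftrightarrow> p x \<in> N"
      using r_eqD[of x 0] r_cong[of x 0] x S_zero r_zero by (auto simp: pull_def)
    then show ?thesis by (simp add: r_def vir_quotient_def)
  qed
qed

lemma vir_module_if:
  assumes "\<And>m n x. x \<in> S \<Longrightarrow> ac (Dgen m) (ac (Dgen n) x) = ac (Dgen n) (ac (Dgen m) x) +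
       sc (of_int (n - m)) (ac (Dgen (m + n)) x) + sc (d_cocycle m n) (ac Cgen x)"
    and "\<And>m x. x \<in> S \<Longrightarrow> ac Cgen (ac (Dgen m) x) = ac (Dgen m) (ac Cgen x)"
  shows "vir_module T"
proof -
  interpret T: module complex_ring T by (rule module_T)
  show ?thesis
  proof unfold_locales
    fix t g a m n assume "t \<in> carrier T"
    then obtain x where x: "x \<in> S" "t = p x" by (rule carrierE)
    show "act T g t \<in> carrier T" "act T g (a \<odot>\<^bsub>T\<^esub> t) = a \<odot>\<^bsub>T\<^esub> act T g t"
      using x by (simp_all add: p_closed S_act S_scale ac_scale flip: p_act p_scale)
    show "act T Cgen (act T (Dgen m) t) = act T (Dgen m) (act T Cgen t)"
      using x assms(2)[of x m] by (simp add: S_act flip: p_act)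
    have "ac (Dgen m) (ac (Dgen n) x) - ac (Dgen n) (ac (Dgen m) x) =
       sc (of_int (n - m)) (ac (Dgen (m + n)) x) + sc (d_cocycle m n) (ac Cgen x)"
      using assms(1)[OF x(1), of m n] by simp
    from arg_cong[OF this, of p]
    show "act T (Dgen m) (act T (Dgen n) t) \<ominus>\<^bsub>T\<^esub> act T (Dgen n) (act T (Dgen m) t) =
        of_int (n - m) \<odot>\<^bsub>T\<^esub> act T (Dgen (m + n)) t \<oplus>\<^bsub>T\<^esub> d_cocycle m n \<odot>\<^bsub>T\<^esub> act T Cgen t"
      using x(1) unfolding x(2)
      by (simp only: p_diff p_add p_scale p_act S_act S_scale)
  next
    fix t u g assume "t \<in> carrier T" "u \<in> carrier T"
    then obtain x y where "x \<in> S" "t = p x" "y \<in> S" "u = p y" by (metis carrierE)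
    then show "act T g (t \<oplus>\<^bsub>T\<^esub> u) = act T g t \<oplus>\<^bsub>T\<^esub> act T g u"
      by (simp add: S_act S_add ac_add flip: p_act p_add)
  qed
qed

lemma rep_image_restrict:
  assumes "vir_submodule H T"
  shows "rep_image sc ac (pull H) p (T\<lparr>carrier := H\<rparr>)"
proof -
  have H: "H \<subseteq> carrier T" "0 \<in> pull H" "\<And>x y. x \<in> pull H \<Longrightarrow> y \<in> pull H \<Longrightarrow> x + y \<in> pull H"
    "\<And>a x. x \<in> pull H \<Longrightarrow> sc a x \<in> pull H" "\<And>g x. x \<in> pull H \<Longrightarrow> ac g x \<in> pull H"
    using assms unfolding vir_submodule_iff by blast+
  have S: "x \<in> pull H \<Longrightarrow> x \<in> S" for x by (simp add: pull_def)
  show ?thesis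
    by (intro rep_image.intro vs) (simp_all add: H S p_pull ac_add ac_scale p_add p_scale p_act p_zero)
qed

end

section \<open>Finitely supported functions and linear spans\<close>

abbreviation pm_scale :: "complex \<Rightarrow> ('k \<Rightarrow>\<^sub>0 complex) \<Rightarrow> ('k \<Rightarrow>\<^sub>0 complex)" where
  "pm_scale a \<equiv> Poly_Mapping.map ((*) a)"

lemma lookup_pm_scale: "Poly_Mapping.lookup (pm_scale a p) k = a * Poly_Mapping.lookup p k"
  by (simp add: Poly_Mapping.map.rep_eq when_def)

lemma pm_scale_single: "pm_scale a (Poly_Mapping.single k b) = Poly_Mapping.single k (a * b)"
  by (rule poly_mapping_eqI) (simp add: lookup_pm_scale lookup_single when_def)

lemma vector_space_pm: "vector_space (pm_scale :: complex \<Rightarrow> ('k \<Rightarrow>\<^sub>0 complex) \<Rightarrow> _)"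
  by standard (auto intro!: poly_mapping_eqI simp: lookup_pm_scale lookup_add algebra_simps)

lemma keys_pm_scale: "Poly_Mapping.keys (pm_scale a p) \<subseteq> Poly_Mapping.keys p"
  by (auto simp: in_keys_iff lookup_pm_scale)

definition pm_lin :: "('k \<Rightarrow> 'b::ab_group_add) \<Rightarrow> (complex \<Rightarrow> 'b \<Rightarrow> 'b) \<Rightarrow> ('k \<Rightarrow>\<^sub>0 complex) \<Rightarrow> 'b" where
  "pm_lin F sc p = (\<Sum>k\<in>Poly_Mapping.keys p. sc (Poly_Mapping.lookup p k) (F k))"

locale complex_space = vector_space scale for scale :: "complex \<Rightarrow> 'b::ab_group_add \<Rightarrow> 'b"
begin

lemma pm_lin_add: "pm_lin F scale (p + q) = pm_lin F scale p + pm_lin F scale q"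
  unfolding pm_lin_def by (rule setsum_keys_plus_distrib) (simp_all add: scale_left_distrib)

lemma pm_lin_zero [simp]: "pm_lin F scale 0 = 0"
  by (simp add: pm_lin_def)

lemma pm_lin_single: "pm_lin F scale (Poly_Mapping.single k a) = scale a (F k)"
  by (cases "a = 0") (simp_all add: pm_lin_def)

lemma pm_lin_diff: "pm_lin F scale (p - q) = pm_lin F scale p - pm_lin F scale q"
  using pm_lin_add[of F "p - q" q] by simp

lemma pm_lin_sum: "pm_lin F scale (\<Sum>i\<in>A. f i) = (\<Sum>i\<in>A. pm_lin F scale (f i))"
  by (induction A rule: infinite_finite_induct) (simp_all add: pm_lin_add)

lemma pm_lin_scale: "pm_lin F scale (pm_scale a p) = scale a (pm_lin F scale p)"
proof -
  have "pm_scale a p = (\<Sum>k\<in>Poly_Mapping.keys p. Poly_Mapping.single k (a * Poly_Mapping.lookup p k))"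
    by (rule poly_mapping_eqI)
       (auto simp: lookup_sum lookup_single when_def in_keys_iff lookup_pm_scale)
  then show ?thesis
    by (simp add: pm_lin_sum pm_lin_single scale_sum_right) (simp add: pm_lin_def scale_sum_right)
qed

end

interpretation PM: complex_space pm_scale
  by (rule complex_space.intro[OF vector_space_pm])

lemma keys_pm_lin:
  assumes "\<And>k. k \<in> Poly_Mapping.keys p \<Longrightarrow> Poly_Mapping.keys (F k) \<subseteq> A"
  shows "Poly_Mapping.keys (pm_lin F pm_scale p) \<subseteq> A"
proof -
  have "Poly_Mapping.keys (pm_scale a (F k)) \<subseteq> A" if "k \<in> Poly_Mapping.keys p" for a k
    by (rule order_trans[OF keys_pm_scale assms[OF that]])
  then show ?thesis
    unfolding pm_lin_def by (intro order_trans[OF keys_sum] UN_least)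
qed

lemma act_free_rep: "act (free_rep A f) g p = pm_lin (f g) pm_scale p"
  by (simp add: free_rep_def pm_lin_def)

lemma rep_image_free_rep:
  assumes "\<And>g k. k \<in> A \<Longrightarrow> Poly_Mapping.keys (f g k) \<subseteq> A"
  shows "rep_image pm_scale (\<lambda>g. pm_lin (f g) pm_scale) {p. Poly_Mapping.keys p \<subseteq> A} (\<lambda>p. p) (free_rep A f)"
proof (rule rep_image.intro)
  show "pm_lin (f g) pm_scale p \<in> {p. Poly_Mapping.keys p \<subseteq> A}" if "p \<in> {p. Poly_Mapping.keys p \<subseteq> A}" for g p
    unfolding mem_Collect_eq by (rule keys_pm_lin, rule assms) (use that in blast)
  show "pm_scale a p \<in> {p. Poly_Mapping.keys p \<subseteq> A}" if "p \<in> {p. Poly_Mapping.keys p \<subseteq> A}" for a and p :: "'a \<Rightarrow>\<^sub>0 complex"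
    using that keys_pm_scale[of a p] by auto
  show "p + q \<in> {p. Poly_Mapping.keys p \<subseteq> A}" if "p \<in> {p. Poly_Mapping.keys p \<subseteq> A}" "q \<in> {p. Poly_Mapping.keys p \<subseteq> A}"
    for p q :: "'a \<Rightarrow>\<^sub>0 complex"
    using that Poly_Mapping.keys_add[of p q] by auto
  show "pm_lin (f g) pm_scale p = act (free_rep A f) g p" for g p
    by (simp add: act_free_rep)
qed (simp_all add: vector_space_pm PM.pm_lin_add PM.pm_lin_scale, simp_all add: free_rep_def)

text \<open>\<open>hull\<close> is an intersection. The assumption on B puts the carrier into the
  family, which is therefore nonempty and has its intersection inside the carrier.\<close>

lemma (in rep_image) lin_span_properties:
  assumes "B \<subseteq> carrier T"
  shows "submodule (lin_span T B) complex_ring T" "B \<subseteq> lin_span T B"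
    "\<And>H. submodule H complex_ring T \<Longrightarrow> B \<subseteq> H \<Longrightarrow> lin_span T B \<subseteq> H"
proof -
  show "B \<subseteq> lin_span T B" unfolding lin_span_def by (rule hull_subset)
  show "\<And>H. submodule H complex_ring T \<Longrightarrow> B \<subseteq> H \<Longrightarrow> lin_span T B \<subseteq> H"
    unfolding lin_span_def by (rule hull_minimal)
  have ex: "submodule (carrier T) complex_ring T" by (rule module.carrier_is_submodule[OF module_T])
  define SS where "SS = {H. submodule H complex_ring T \<and> B \<subseteq> H}"
  have "carrier T \<in> SS" using ex assms by (simp add: SS_def)
  have "submodule (\<Inter>SS) complex_ring T"
    unfolding submodule_iff
  proof (intro conjI ballI allI)
    have *: "x \<in> pull (\<Inter>SS) \<longleftrightarrow> (\<forall>H\<in>SS. x \<in> pull H)" for x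
      using \<open>carrier T \<in> SS\<close> by (auto simp: pull_def)
    have sub: "0 \<in> pull H \<and> (\<forall>x\<in>pull H. \<forall>y\<in>pull H. x + y \<in> pull H) \<and> (\<forall>a. \<forall>x\<in>pull H. sc a x \<in> pull H)"
      if "H \<in> SS" for H using that unfolding SS_def submodule_iff by blast
    show "\<Inter>SS \<subseteq> carrier T" using \<open>carrier T \<in> SS\<close> by blast
    show "0 \<in> pull (\<Inter>SS)" using * sub by blast
    show "x + y \<in> pull (\<Inter>SS)" if "x \<in> pull (\<Inter>SS)" "y \<in> pull (\<Inter>SS)" for x y
      using that sub unfolding * by blast
    show "sc a x \<in> pull (\<Inter>SS)" if "x \<in> pull (\<Inter>SS)" for a x
      using that sub unfolding * by blast
  qed
  then show "submodule (lin_span T B) complex_ring T"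
    by (simp add: lin_span_def hull_def SS_def Collect_conj_eq Int_commute)
qed

text \<open>The vectors whose images under all generators lie in the span form a subspace; as it
  contains B, it contains the span.\<close>

lemma (in rep_image) lin_span_vir_submodule:
  assumes B: "B \<subseteq> carrier T" and act: "\<And>g t. t \<in> B \<Longrightarrow> act T g t \<in> lin_span T B"
  shows "vir_submodule (lin_span T B) T"
proof -
  let ?H = "lin_span T B"
  have H: "?H \<subseteq> carrier T" "0 \<in> pull ?H" "\<And>x y. x \<in> pull ?H \<Longrightarrow> y \<in> pull ?H \<Longrightarrow> x + y \<in> pull ?H"
    "\<And>a x. x \<in> pull ?H \<Longrightarrow> sc a x \<in> pull ?H"
    using lin_span_properties(1)[OF B] unfolding submodule_iff by blast+
  have "lin_span T B \<subseteq> p ` {x \<in> S. \<forall>g. ac g x \<in> pull ?H}" (is "_ \<subseteq> p ` ?K")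
  proof (rule lin_span_properties(3)[OF B])
    have pull: "x \<in> pull (p ` ?K) \<longleftrightarrow> x \<in> ?K" for x
    proof
      assume "x \<in> pull (p ` ?K)"
      then obtain y where y: "y \<in> ?K" "x \<in> S" "p x = p y" by (auto simp: pull_def)
      have "p (ac g x) = p (ac g y)" for g using y by (simp add: p_act)
      with y show "x \<in> ?K" by (auto simp: pull_def S_act)
    qed (auto simp: pull_def)
    have ac0: "ac g 0 = 0" for g using ac_add[OF S_zero S_zero, of g] by simp
    show "submodule (p ` ?K) complex_ring T"
      unfolding submodule_iff
    proof (intro conjI ballI allI)
      show "p ` ?K \<subseteq> carrier T" using p_closed by blast
      show "0 \<in> pull (p ` ?K)" unfolding pull using S_zero ac0 H(2) by simp
      show "x + y \<in> pull (p ` ?K)" if "x \<in> pull (p ` ?K)" "y \<in> pull (p ` ?K)" for x y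
        using that H(3) unfolding pull by (auto simp: S_add ac_add)
      show "sc a x \<in> pull (p ` ?K)" if "x \<in> pull (p ` ?K)" for a x
        using that H(4) unfolding pull by (auto simp: S_scale ac_scale)
    qed
    show "B \<subseteq> p ` ?K"
    proof
      fix t assume t: "t \<in> B"
      then obtain x where x: "x \<in> S" "t = p x" using B carrierE by blast
      have "ac g x \<in> pull ?H" for g using act[OF t, of g] x by (simp add: pull_def S_act p_act)
      with x show "t \<in> p ` ?K" by blast
    qed
  qed
  then have "ac g x \<in> pull ?H" if "x \<in> pull ?H" for g x
  proof -
    have x: "x \<in> S" "p x \<in> lin_span T B" using that by (auto simp: pull_def)
    then obtain y where y: "y \<in> S" "\<And>g. ac g y \<in> pull ?H" "p x = p y"
      using \<open>lin_span T B \<subseteq> p ` ?K\<close> by blast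
    have "p (ac g x) = p (ac g y)" using x y by (simp add: p_act)
    then show ?thesis using x y(2)[of g] by (simp add: pull_def S_act)
  qed
  with H show ?thesis unfolding vir_submodule_iff by blast
qed

section \<open>The Verma module and its simple quotient\<close>

interpretation Us: complex_space U_scale
  by (rule complex_space.intro[OF U.vector_space_axioms])

interpretation Es: complex_space E_scale
  by (rule complex_space.intro[OF E.vector_space_axioms])

lemma poly_mapping_induct_single [case_names single add]:
  assumes "\<And>k a. P (Poly_Mapping.single k a)" "\<And>p q. P p \<Longrightarrow> P q \<Longrightarrow> P (p + q)"
  shows "P (p :: 'k \<Rightarrow>\<^sub>0 complex)"
proof -
  have "P (\<Sum>k\<in>A. Poly_Mapping.single k (Poly_Mapping.lookup p k))" if "finite A" for A
    using that
  proof induction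
    case empty
    show ?case using assms(1)[of undefined 0] by simp
  qed (simp add: assms)
  from this[OF finite_keys] show ?thesis by (subst poly_mapping_sum_single)
qed

lemma rep_image_id_submodule:
  assumes R: "rep_image pm_scale ac S (\<lambda>p. p) T" and H: "submodule H complex_ring T"
  shows "0 \<in> H" "p \<in> H \<Longrightarrow> q \<in> H \<Longrightarrow> p + q \<in> H" "p \<in> H \<Longrightarrow> pm_scale a p \<in> H"
    "p \<in> H \<Longrightarrow> - p \<in> H" "p \<in> H \<Longrightarrow> q \<in> H \<Longrightarrow> p - q \<in> H"
proof -
  interpret rep_image pm_scale ac S "\<lambda>p. p" T by (rule R)
  have sub: "H \<subseteq> S" using H p_onto unfolding submodule_iff by auto
  have pull: "pull H = H" using sub by (auto simp: pull_def)
  note * = H[unfolded submodule_iff pull]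
  show "0 \<in> H" and add: "\<And>p q. p \<in> H \<Longrightarrow> q \<in> H \<Longrightarrow> p + q \<in> H"
    and scale: "\<And>p a. p \<in> H \<Longrightarrow> pm_scale a p \<in> H" using * by blast+
  show minus: "p \<in> H \<Longrightarrow> - p \<in> H" for p using scale[of p "- 1"] by (simp only: PM.scale_minus_left PM.scale_one)
  show "p \<in> H \<Longrightarrow> q \<in> H \<Longrightarrow> p - q \<in> H" using add[of p "- q"] minus[of q] by simp
qed

lemma rep_image_verma_cover:
  "rep_image pm_scale (\<lambda>g. pm_lin (\<lambda>(x, z). basis_vec (Ugen g * x, z)) pm_scale) UNIV (\<lambda>p. p) verma_cover"
  using rep_image_free_rep[of UNIV "\<lambda>g (x, z). basis_vec (Ugen g * x, z)"] by (simp add: verma_cover_def)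

context
  fixes c h :: complex
begin

inductive_set verma_relators :: "(Uvir \<times> complex \<Rightarrow>\<^sub>0 complex) set" where
  add1: "basis_vec (x + x', y) - basis_vec (x, y) - basis_vec (x', y) \<in> verma_relators"
| add2: "basis_vec (x, y + y') - basis_vec (x, y) - basis_vec (x, y') \<in> verma_relators"
| scale1: "basis_vec (U_scale a x, y) - Poly_Mapping.single (x, y) a \<in> verma_relators"
| scale2: "basis_vec (x, a * y) - Poly_Mapping.single (x, y) a \<in> verma_relators"
| borel: "b \<in> borel_gens \<Longrightarrow> basis_vec (x * Ugen b, z) - basis_vec (x, highest_weight c h b * z) \<in> verma_relators"

lemma verma_relators_eq:
  "bilinear_relators U_space line_space \<union>
     {basis_vec (x * Ugen b, z) - basis_vec (x, highest_weight c h b * z) | x b z. b \<in> borel_gens} = verma_relators"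
  (is "?A = _")
proof (intro equalityI subsetI)
  have A: "?A = {basis_vec (x + x', y) - basis_vec (x, y) - basis_vec (x', y) | x x' y. True} \<union>
     {basis_vec (x, y + y') - basis_vec (x, y) - basis_vec (x, y') | x y y'. True} \<union>
     {basis_vec (U_scale a x, y) - Poly_Mapping.single (x, y) a | a x y. True} \<union>
     {basis_vec (x, a * y) - Poly_Mapping.single (x, y) a | a x y. True} \<union>
     {basis_vec (x * Ugen b, z) - basis_vec (x, highest_weight c h b * z) | x b z. b \<in> borel_gens}"
    unfolding bilinear_relators_def by (simp add: U_space_def line_space_def)
  show "r \<in> verma_relators" if "r \<in> ?A" for r
    using that unfolding A by (auto intro: verma_relators.intros)
  show "r \<in> ?A" if "r \<in> verma_relators" for r
    using that unfolding A by cases blast+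
qed

interpretation VC: rep_image pm_scale "\<lambda>g. pm_lin (\<lambda>(x, z). basis_vec (Ugen g * x, z)) pm_scale" UNIV "\<lambda>p. p" verma_cover
  by (rule rep_image_verma_cover)

lemma verma_kernel_eq: "verma_kernel c h = lin_span verma_cover verma_relators"
  unfolding verma_kernel_def verma_relators_eq ..

lemma relators_carrier: "verma_relators \<subseteq> carrier verma_cover"
  using VC.p_onto by auto

lemmas VK = VC.lin_span_properties[OF relators_carrier, folded verma_kernel_eq]
lemmas VKD = rep_image_id_submodule[OF rep_image_verma_cover VK(1)]

lemma vir_submodule_verma_kernel: "vir_submodule (verma_kernel c h) verma_cover"
  unfolding verma_kernel_eq
proof (rule VC.lin_span_vir_submodule[OF relators_carrier])
  fix g r assume "r \<in> verma_relators"
  then have "act verma_cover g r \<in> verma_relators"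
  proof cases
    case (scale1 a x y)
    then show ?thesis using verma_relators.scale1[of a "Ugen g * x" y]
      by (simp add: PM.pm_lin_diff PM.pm_lin_single pm_scale_single U_scale_right verma_cover_def act_free_rep)
  next
    case (borel b x z)
    then show ?thesis using verma_relators.borel[of b "Ugen g * x" z]
      by (simp add: PM.pm_lin_diff PM.pm_lin_single pm_scale_single mult.assoc verma_cover_def act_free_rep)
  qed (simp_all add: PM.pm_lin_diff PM.pm_lin_single pm_scale_single verma_relators.intros distrib_left verma_cover_def act_free_rep)
  then show "act verma_cover g r \<in> lin_span verma_cover verma_relators"
    using VC.lin_span_properties(2)[OF relators_carrier] by blast
qed

lemma relator_in_VK: "r \<in> verma_relators \<Longrightarrow> r \<in> verma_kernel c h"
  using VK(2) by blast

lemma VK_add: "basis_vec (x + x', 1) - basis_vec (x, 1) - basis_vec (x', 1) \<in> verma_kernel c h"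
  by (intro relator_in_VK verma_relators.intros)

lemma VK_scale: "basis_vec (U_scale a x, 1) - pm_scale a (basis_vec (x, 1)) \<in> verma_kernel c h"
  using relator_in_VK[OF verma_relators.scale1[of a x 1]] by (simp add: pm_scale_single)

lemma VK_exists: "\<exists>x. p - basis_vec (x, 1) \<in> verma_kernel c h"
proof (induction p rule: poly_mapping_induct_single)
  case (single k a)
  obtain x z where k: "k = (x, z)" by (cases k)
  have 1: "basis_vec (x, z) - Poly_Mapping.single (x, 1) z \<in> verma_kernel c h"
    using relator_in_VK[OF verma_relators.scale2[of x z 1]] by simp
  have 2: "basis_vec (U_scale (a * z) x, 1) - Poly_Mapping.single (x, 1) (a * z) \<in> verma_kernel c h"
    by (intro relator_in_VK verma_relators.intros)
  have "pm_scale a (basis_vec (x, z) - Poly_Mapping.single (x, 1) z) -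
      (basis_vec (U_scale (a * z) x, 1) - Poly_Mapping.single (x, 1) (a * z)) \<in> verma_kernel c h"
    by (rule VKD(5)[OF VKD(3)[OF 1] 2])
  then show ?case
    unfolding k by (intro exI[of _ "U_scale (a * z) x"]) (simp add: PM.scale_right_diff_distrib pm_scale_single)
next
  case (add p q)
  then obtain x y where "p - basis_vec (x, 1) \<in> verma_kernel c h" "q - basis_vec (y, 1) \<in> verma_kernel c h" by blast
  from VKD(5)[OF VKD(2)[OF this] VK_add[of x y]]
  show ?case by (intro exI[of _ "x + y"]) (simp add: algebra_simps)
qed

text \<open>The map x \<otimes> z \<mapsto> z x sends every relator into the annihilator of u, which
  gives one direction. Conversely each rule of \<open>verma_ideal\<close> is imitated by relators,
  with the scalar of a Borel generator carried from the second factor to the first by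
  \<open>scale2\<close> and \<open>scale1\<close>.\<close>

lemma VK_iff: "basis_vec (x, 1) \<in> verma_kernel c h \<longleftrightarrow> x \<in> verma_ideal c h"
proof
  let ?\<theta> = "pm_lin (\<lambda>(x, z). U_scale z x) U_scale"
  let ?H = "{p. ?\<theta> p \<in> verma_ideal c h}"
  have "submodule ?H complex_ring verma_cover"
    unfolding VC.submodule_iff
    using VC.p_onto by (auto simp: VC.pull_def Us.pm_lin_add Us.pm_lin_scale intro: verma_idealD)
  moreover have "verma_relators \<subseteq> ?H"
  proof
    fix r assume "r \<in> verma_relators"
    then show "r \<in> ?H"
    proof (cases)
      case (borel b x z)
      have "U_scale z (x * Ugen b - U_scale (highest_weight c h b) x) \<in> verma_ideal c h"
        by (intro verma_idealD(4) verma_ideal.rel borel(2))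
      then show ?thesis
        by (simp add: borel(1) Us.pm_lin_diff Us.pm_lin_single U.scale_right_diff_distrib mult.commute)
    qed (simp_all add: Us.pm_lin_diff Us.pm_lin_single U_scale_simps U_scale_add_left verma_idealD(1) mult.commute)
  qed
  ultimately have "verma_kernel c h \<subseteq> ?H" by (rule VK(3))
  then show "basis_vec (x, 1) \<in> verma_kernel c h \<Longrightarrow> x \<in> verma_ideal c h"
    by (auto simp: Us.pm_lin_single)
next
  assume "x \<in> verma_ideal c h"
  then show "basis_vec (x, 1) \<in> verma_kernel c h"
  proof induction
    case zero
    show ?case using VK_scale[of 0 0] by (simp add: PM.scale_zero_left)
  next
    case (rel b x)
    let ?y = "U_scale (highest_weight c h b) x"
    have 1: "basis_vec (x * Ugen b, 1) - basis_vec (x, highest_weight c h b * 1) \<in> verma_kernel c h"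
      by (intro relator_in_VK verma_relators.intros rel)
    have 2: "basis_vec (x, highest_weight c h b * 1) - Poly_Mapping.single (x, 1) (highest_weight c h b) \<in> verma_kernel c h"
      by (intro relator_in_VK verma_relators.intros)
    have 3: "basis_vec (?y, 1) - Poly_Mapping.single (x, 1) (highest_weight c h b) \<in> verma_kernel c h"
      by (intro relator_in_VK verma_relators.intros)
    have 4: "basis_vec (x * Ugen b - ?y + ?y, 1) - basis_vec (x * Ugen b - ?y, 1) - basis_vec (?y, 1) \<in> verma_kernel c h"
      by (rule VK_add)
    from VKD(5)[OF VKD(5)[OF VKD(2)[OF 1 2] 3] 4] show ?case by simp
  next
    case (add x y)
    from VKD(2)[OF VKD(2)[OF add.IH] VK_add[of x y]] show ?case by (simp add: algebra_simps)
  qed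
qed

lemma rep_image_verma:
  "rep_image U_scale (\<lambda>g x. Ugen g * x) UNIV (verma_vec c h) (verma c h)"
  and verma_vec_eq_zero_iff: "verma_vec c h x = \<zero>\<^bsub>verma c h\<^esub> \<longleftrightarrow> x \<in> verma_ideal c h"
proof -
  note Q = VC.rep_image_quotient[OF vir_submodule_verma_kernel, folded verma_def]
  interpret Q: rep_image pm_scale "\<lambda>g. pm_lin (\<lambda>(x, z). basis_vec (Ugen g * x, z)) pm_scale" UNIV
    "\<lambda>p. verma_kernel c h +>\<^bsub>verma_cover\<^esub> p" "verma c h" by (rule Q(1))
  let ?Q = "\<lambda>p. verma_kernel c h +>\<^bsub>verma_cover\<^esub> p"
  have vec: "verma_vec c h x = ?Q (basis_vec (x, 1))" for x by (simp add: verma_vec_def)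
  have cong: "?Q p = ?Q q" if "p - q \<in> verma_kernel c h" for p q
    using Q.p_eq_iff[of p q] Q(2)[of "p - q"] that by simp
  show zero: "verma_vec c h x = \<zero>\<^bsub>verma c h\<^esub> \<longleftrightarrow> x \<in> verma_ideal c h" for x
    unfolding vec using Q(2)[of "basis_vec (x, 1)"] VK_iff by simp
  show "rep_image U_scale (\<lambda>g x. Ugen g * x) UNIV (verma_vec c h) (verma c h)"
  proof (rule rep_image.intro)
    show "range (verma_vec c h) = carrier (verma c h)"
    proof (intro equalityI subsetI)
      fix t assume "t \<in> carrier (verma c h)"
      then obtain p where p: "t = ?Q p" using Q.carrierE by blast
      obtain x where "p - basis_vec (x, 1) \<in> verma_kernel c h" using VK_exists by blast
      from cong[OF this] p show "t \<in> range (verma_vec c h)" by (auto simp: vec)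
    qed (auto simp: vec Q.p_closed)
    show "verma_vec c h (x + y) = verma_vec c h x \<oplus>\<^bsub>verma c h\<^esub> verma_vec c h y" for x y
      unfolding vec using cong[of "basis_vec (x + y, 1)" "basis_vec (x, 1) + basis_vec (y, 1)"] VK_add[of x y]
      by (simp add: diff_diff_eq flip: Q.p_add)
    show "verma_vec c h (U_scale a x) = a \<odot>\<^bsub>verma c h\<^esub> verma_vec c h x" for a x
      unfolding vec using cong[OF VK_scale[of a x]] Q.p_scale[of "basis_vec (x, 1)" a] by simp
    show "verma_vec c h (Ugen g * x) = act (verma c h) g (verma_vec c h x)" for g x
      unfolding vec using Q.p_act[of "basis_vec (x, 1)" g] by (simp add: PM.pm_lin_single pm_scale_single)
    show "verma_vec c h 0 = \<zero>\<^bsub>verma c h\<^esub>" using zero verma_idealD(1) by blast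
  qed (simp_all add: U.vector_space_axioms distrib_left U_scale_right)
qed

interpretation V: rep_image U_scale "\<lambda>g x. Ugen g * x" UNIV "verma_vec c h" "verma c h"
  by (rule rep_image_verma)

lemma verma_vec_eq_iff: "verma_vec c h x = verma_vec c h y \<longleftrightarrow> x - y \<in> verma_ideal c h"
  using V.p_eq_iff[of x y] verma_vec_eq_zero_iff by simp

section \<open>J(c,h) as the image of the radical\<close>

lemma vir_submodule_verma_iff:
  "vir_submodule H (verma c h) \<longleftrightarrow> H \<subseteq> carrier (verma c h) \<and> left_ideal (V.pull H)"
proof
  assume "vir_submodule H (verma c h)"
  then have "H \<subseteq> carrier (verma c h) \<and> 0 \<in> V.pull H \<and>
     (\<forall>x\<in>V.pull H. \<forall>y\<in>V.pull H. x + y \<in> V.pull H) \<and> (\<forall>a. \<forall>x\<in>V.pull H. U_scale a x \<in> V.pull H) \<and>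
     (\<forall>g. \<forall>x\<in>V.pull H. Ugen g * x \<in> V.pull H)" unfolding V.vir_submodule_iff .
  then show "H \<subseteq> carrier (verma c h) \<and> left_ideal (V.pull H)"
    by (intro conjI left_idealI) blast+
next
  assume *: "H \<subseteq> carrier (verma c h) \<and> left_ideal (V.pull H)"
  then show "vir_submodule H (verma c h)"
    unfolding V.vir_submodule_iff using left_idealD[of "V.pull H"] by blast
qed

abbreviation "J \<equiv> verma_vec c h ` verma_radical c h"

lemma pull_J: "V.pull J = verma_radical c h"
proof (intro equalityI subsetI)
  fix x assume "x \<in> V.pull J"
  then obtain y where "y \<in> verma_radical c h" "x - y \<in> verma_ideal c h"
    by (auto simp: V.pull_def verma_vec_eq_iff)
  then have "(x - y) + y \<in> verma_radical c h"
    by (intro verma_radicalD(2)[OF VI_subset_radical])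
  then show "x \<in> verma_radical c h" by simp
qed (simp add: V.pull_def)

lemma vir_submodule_J: "vir_submodule J (verma c h)"
  unfolding vir_submodule_verma_iff pull_J using V.p_closed left_ideal_radical by auto

text \<open>A proper submodule pulls back to a proper left ideal that contains the annihilator of u,
  hence lies in the radical; this gives the uniqueness that \<open>THE\<close> requires.\<close>

lemma verma_max_eq: "verma_max c h = J"
  unfolding verma_max_def
proof (rule the_equality)
  have full: "H = carrier (verma c h)" if "H \<subseteq> carrier (verma c h)" "V.pull H = UNIV" for H
    using V.p_pull[OF that(1)] that(2) V.p_onto by simp
  have J_ne: "J \<noteq> carrier (verma c h)"
  proof
    assume "J = carrier (verma c h)"
    then have "1 \<in> V.pull J" using V.p_closed by (simp add: V.pull_def)
    then show False using pull_J one_notin_radical by simp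
  qed
  have VI_pull: "verma_ideal c h \<subseteq> V.pull H" if "vir_submodule H (verma c h)" for H
  proof
    fix x assume "x \<in> verma_ideal c h"
    then have "verma_vec c h x = verma_vec c h 0" using verma_vec_eq_iff by simp
    moreover have "0 \<in> V.pull H" using that unfolding V.vir_submodule_iff by blast
    ultimately show "x \<in> V.pull H" by (simp add: V.pull_def)
  qed
  show max: "maximal_submodule J (verma c h)"
    unfolding maximal_submodule_def
  proof (intro conjI allI impI)
    show "vir_submodule J (verma c h)" "J \<noteq> carrier (verma c h)" by (rule vir_submodule_J, rule J_ne)
    fix K assume K: "vir_submodule K (verma c h) \<and> J \<subseteq> K"
    then have K': "K \<subseteq> carrier (verma c h)" "left_ideal (V.pull K)" unfolding vir_submodule_verma_iff by auto
    have sub: "verma_radical c h \<subseteq> V.pull K" using K by (auto simp: V.pull_def)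
    show "K = J \<or> K = carrier (verma c h)"
    proof (cases "V.pull K = verma_radical c h")
      case True
      then show ?thesis using V.p_pull[OF K'(1)] by simp
    next
      case False
      then obtain x where "x \<in> V.pull K" "x \<notin> verma_radical c h" using sub by blast
      then have "V.pull K = UNIV" by (rule left_ideal_eq_UNIV[OF K'(2) sub])
      then show ?thesis using full[OF K'(1)] by blast
    qed
  qed
  fix H assume H: "maximal_submodule H (verma c h)"
  then have H': "vir_submodule H (verma c h)" "H \<noteq> carrier (verma c h)" by (simp_all add: maximal_submodule_def)
  then have H'': "H \<subseteq> carrier (verma c h)" "left_ideal (V.pull H)" unfolding vir_submodule_verma_iff by auto
  have "V.pull H \<subseteq> verma_radical c h"
    using proper_left_ideal_subset_radical[OF H''(2) VI_pull[OF H'(1)]] full[OF H''(1)] H'(2) by blast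
  then have "H \<subseteq> J" using V.p_pull[OF H''(1)] by blast
  then show "H = J" using H vir_submodule_J J_ne unfolding maximal_submodule_def by blast
qed

definition simple_vec :: "Uvir \<Rightarrow> (Uvir \<times> complex \<Rightarrow>\<^sub>0 complex) set set" where
  "simple_vec x = verma_max c h +>\<^bsub>verma c h\<^esub> verma_vec c h x"

lemma rep_image_simple:
  "rep_image U_scale (\<lambda>g x. Ugen g * x) UNIV simple_vec (simple_hw c h)"
  and simple_vec_eq_zero_iff: "simple_vec x = \<zero>\<^bsub>simple_hw c h\<^esub> \<longleftrightarrow> x \<in> verma_radical c h"
proof -
  have "vir_submodule (verma_max c h) (verma c h)" unfolding verma_max_eq by (rule vir_submodule_J)
  note Q = V.rep_image_quotient[OF this, folded simple_hw_def, folded simple_vec_def]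
  show "rep_image U_scale (\<lambda>g x. Ugen g * x) UNIV simple_vec (simple_hw c h)" by (rule Q(1))
  have "verma_vec c h x \<in> verma_max c h \<longleftrightarrow> x \<in> V.pull J" by (simp add: verma_max_eq V.pull_def)
  then show "simple_vec x = \<zero>\<^bsub>simple_hw c h\<^esub> \<longleftrightarrow> x \<in> verma_radical c h"
    using Q(2)[of x] pull_J by simp
qed

lemma hw_vec_eq: "hw_vec c h = simple_vec 1"
  by (simp add: hw_vec_def simple_vec_def)

text \<open>Each case of the definition amounts to J(c,h) = U(Vir_-) Q1 u + U(Vir_-) Q2 u; when Q2 =
  Q1, the second coefficient is taken to be 0. The coefficient 1 puts Q1 u and Q2 u into
  J(c,h).\<close>

lemma max_generators_radical:
  assumes "max_generators c h Q1 Q2"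
  shows "radical_generators c h Q1 Q2"
proof -
  define UQ where "UQ = (\<lambda>Q. {verma_vec c h (x * Q) | x. x \<in> U_minus})"
  have J_mem: "verma_vec c h x \<in> J \<longleftrightarrow> x \<in> verma_radical c h" for x
    using pull_J by (auto simp: V.pull_def)
  have hom0: "U_homogeneous 0 0" by (simp add: U_homogeneous_def)
  show ?thesis
  proof (cases "J = {\<zero>\<^bsub>verma c h\<^esub>}")
    case True
    then have Q: "Q1 = 0" "Q2 = 0" using assms by (simp_all add: max_generators_def verma_max_eq Let_def)
    have "x \<in> verma_ideal c h" if "x \<in> verma_radical c h" for x
    proof -
      have "verma_vec c h x \<in> {\<zero>\<^bsub>verma c h\<^esub>}" unfolding True[symmetric] using that by (rule imageI)
      then show ?thesis using verma_vec_eq_zero_iff by simp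
    qed
    then show ?thesis
      unfolding radical_generators_def Q using U_minus_zero hom0 verma_radicalD(1) by auto
  next
    case nonzero: False
    show ?thesis
    proof (cases "\<exists>v. singular_vector (verma c h) v \<and> J = vir_generated (verma c h) {v}")
      case True
      then have Q: "Q1 \<in> U_minus" "\<exists>m. U_homogeneous m Q1" "J = UQ Q1" "Q2 = Q1"
        using assms nonzero by (simp_all add: max_generators_def verma_max_eq Let_def UQ_def)
      have "verma_vec c h (1 * Q1) \<in> UQ Q1" unfolding UQ_def using U_minus.one by blast
      then have "Q1 \<in> verma_radical c h" using J_mem[of Q1] Q(3) by simp
      moreover have "\<exists>a\<in>U_minus. \<exists>b\<in>U_minus. x - (a * Q1 + b * Q1) \<in> verma_ideal c h" if "x \<in> verma_radical c h" for x
      proof -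
        have "verma_vec c h x \<in> UQ Q1" using that J_mem[of x] Q(3) by simp
        then obtain a where "a \<in> U_minus" "x - a * Q1 \<in> verma_ideal c h" by (auto simp: UQ_def verma_vec_eq_iff)
        then show ?thesis using U_minus_zero by (intro bexI[of _ a] bexI[of _ 0]) auto
      qed
      ultimately show ?thesis using Q by (auto simp: radical_generators_def)
    next
      case False
      have "Q1 \<in> U_minus \<and> Q2 \<in> U_minus \<and> (\<exists>m. U_homogeneous m Q1) \<and> (\<exists>m. U_homogeneous m Q2) \<and>
          J = UQ Q1 <+>\<^bsub>verma c h\<^esub> UQ Q2"
        using assms unfolding max_generators_def Let_def verma_max_eq if_not_P[OF nonzero] if_not_P[OF False] UQ_def .
      then have Q: "Q1 \<in> U_minus" "Q2 \<in> U_minus" "\<exists>m. U_homogeneous m Q1" "\<exists>m. U_homogeneous m Q2"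
        "J = UQ Q1 <+>\<^bsub>verma c h\<^esub> UQ Q2" by blast+
      have "UQ Q1 <+>\<^bsub>verma c h\<^esub> UQ Q2 = {verma_vec c h (a * Q1 + b * Q2) | a b. a \<in> U_minus \<and> b \<in> U_minus}"
      proof (intro equalityI subsetI)
        fix t assume "t \<in> UQ Q1 <+>\<^bsub>verma c h\<^esub> UQ Q2"
        then obtain a b where "a \<in> U_minus" "b \<in> U_minus"
          "t = verma_vec c h (a * Q1) \<oplus>\<^bsub>verma c h\<^esub> verma_vec c h (b * Q2)"
          unfolding set_add_def' UQ_def by blast
        then show "t \<in> {verma_vec c h (a * Q1 + b * Q2) | a b. a \<in> U_minus \<and> b \<in> U_minus}"
          using V.p_add[of "a * Q1" "b * Q2"] by auto
      next
        fix t assume "t \<in> {verma_vec c h (a * Q1 + b * Q2) | a b. a \<in> U_minus \<and> b \<in> U_minus}"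
        then obtain a b where "a \<in> U_minus" "b \<in> U_minus"
          "t = verma_vec c h (a * Q1) \<oplus>\<^bsub>verma c h\<^esub> verma_vec c h (b * Q2)"
          using V.p_add by auto
        then show "t \<in> UQ Q1 <+>\<^bsub>verma c h\<^esub> UQ Q2"
          unfolding set_add_def' UQ_def by blast
      qed
      then have J: "J = {verma_vec c h (a * Q1 + b * Q2) | a b. a \<in> U_minus \<and> b \<in> U_minus}" using Q(5) by simp
      have "verma_vec c h (1 * Q1 + 0 * Q2) \<in> J" "verma_vec c h (0 * Q1 + 1 * Q2) \<in> J"
        unfolding J using U_minus.one U_minus_zero by blast+
      then have "Q1 \<in> verma_radical c h" "Q2 \<in> verma_radical c h" using J_mem by simp_all
      moreover have "\<exists>a\<in>U_minus. \<exists>b\<in>U_minus. x - (a * Q1 + b * Q2) \<in> verma_ideal c h" if "x \<in> verma_radical c h" for x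
      proof -
        have "verma_vec c h x \<in> {verma_vec c h (a * Q1 + b * Q2) | a b. a \<in> U_minus \<and> b \<in> U_minus}"
          using that J_mem[of x] J by simp
        then show ?thesis unfolding mem_Collect_eq verma_vec_eq_iff by blast
      qed
      ultimately show ?thesis using Q by (auto simp: radical_generators_def)
    qed
  qed
qed

end

section \<open>Tensor products\<close>

lemma (in rep_image) T_act:
  "t \<in> carrier T \<Longrightarrow> act T g t \<in> carrier T"
  "t \<in> carrier T \<Longrightarrow> u \<in> carrier T \<Longrightarrow> act T g (t \<oplus>\<^bsub>T\<^esub> u) = act T g t \<oplus>\<^bsub>T\<^esub> act T g u"
  "t \<in> carrier T \<Longrightarrow> act T g (a \<odot>\<^bsub>T\<^esub> t) = a \<odot>\<^bsub>T\<^esub> act T g t"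
  "t \<in> carrier T \<Longrightarrow> u \<in> carrier T \<Longrightarrow> t \<oplus>\<^bsub>T\<^esub> u \<in> carrier T"
  "t \<in> carrier T \<Longrightarrow> a \<odot>\<^bsub>T\<^esub> t \<in> carrier T"
  "\<zero>\<^bsub>T\<^esub> \<in> carrier T" "t \<in> carrier T \<Longrightarrow> 0 \<odot>\<^bsub>T\<^esub> t = \<zero>\<^bsub>T\<^esub>"
proof -
  show "\<zero>\<^bsub>T\<^esub> \<in> carrier T" using p_closed[OF S_zero] p_zero by simp
next
  assume "t \<in> carrier T"
  then obtain x where x: "x \<in> S" "t = p x" by (rule carrierE)
  show "act T g t \<in> carrier T" "act T g (a \<odot>\<^bsub>T\<^esub> t) = a \<odot>\<^bsub>T\<^esub> act T g t" "a \<odot>\<^bsub>T\<^esub> t \<in> carrier T"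
    using x by (simp_all add: p_closed S_act S_scale ac_scale flip: p_act p_scale)
  show "0 \<odot>\<^bsub>T\<^esub> t = \<zero>\<^bsub>T\<^esub>"
    using x p_scale[OF x(1), of 0] by (simp add: sc_simps p_zero)
next
  assume "t \<in> carrier T" "u \<in> carrier T"
  then obtain x y where "x \<in> S" "t = p x" "y \<in> S" "u = p y" by (metis carrierE)
  then show "act T g (t \<oplus>\<^bsub>T\<^esub> u) = act T g t \<oplus>\<^bsub>T\<^esub> act T g u" "t \<oplus>\<^bsub>T\<^esub> u \<in> carrier T"
    by (simp_all add: p_closed S_act S_add ac_add flip: p_act p_add)
qed

locale tensor_factors =
  M: rep_image sc1 ac1 S1 p1 M + N: rep_image sc2 ac2 S2 p2 N
  for sc1 :: "complex \<Rightarrow> 'e::ab_group_add \<Rightarrow> 'e" and ac1 S1 and p1 :: "'e \<Rightarrow> 'a" and M :: "('a, 'm) vir_rep_scheme"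
    and sc2 :: "complex \<Rightarrow> 'f::ab_group_add \<Rightarrow> 'f" and ac2 S2 and p2 :: "'f \<Rightarrow> 'b" and N :: "('b, 'n) vir_rep_scheme"
begin

abbreviation "pairs \<equiv> {p :: 'a \<times> 'b \<Rightarrow>\<^sub>0 complex. Poly_Mapping.keys p \<subseteq> carrier M \<times> carrier N}"
abbreviation "pair_act \<equiv> \<lambda>g (x, y). basis_vec (act M g x, y) + basis_vec (x, act N g y)"
abbreviation "TK \<equiv> tensor_kernel M N"

lemma rep_image_pair:
  "rep_image pm_scale (\<lambda>g. pm_lin (pair_act g) pm_scale) pairs (\<lambda>p. p) (pair_rep M N)"
  unfolding pair_rep_def
proof (rule rep_image_free_rep)
  fix g k assume "k \<in> carrier M \<times> carrier N"
  then show "Poly_Mapping.keys (pair_act g k) \<subseteq> carrier M \<times> carrier N"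
    using Poly_Mapping.keys_add by (cases k) (fastforce simp: M.T_act N.T_act)
qed

interpretation P: rep_image pm_scale "\<lambda>g. pm_lin (pair_act g) pm_scale" pairs "\<lambda>p. p" "pair_rep M N"
  by (rule rep_image_pair)

lemma act_pair: "act (pair_rep M N) g p = pm_lin (pair_act g) pm_scale p"
  by (simp add: pair_rep_def act_free_rep)

lemma bilinear_relators_cases:
  assumes "r \<in> bilinear_relators M N"
  obtains (add1) x x' y where "r = basis_vec (x \<oplus>\<^bsub>M\<^esub> x', y) - basis_vec (x, y) - basis_vec (x', y)"
      "x \<in> carrier M" "x' \<in> carrier M" "y \<in> carrier N"
  | (add2) x y y' where "r = basis_vec (x, y \<oplus>\<^bsub>N\<^esub> y') - basis_vec (x, y) - basis_vec (x, y')"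
      "x \<in> carrier M" "y \<in> carrier N" "y' \<in> carrier N"
  | (scale1) a x y where "r = basis_vec (a \<odot>\<^bsub>M\<^esub> x, y) - Poly_Mapping.single (x, y) a" "x \<in> carrier M" "y \<in> carrier N"
  | (scale2) a x y where "r = basis_vec (x, a \<odot>\<^bsub>N\<^esub> y) - Poly_Mapping.single (x, y) a" "x \<in> carrier M" "y \<in> carrier N"
  using assms unfolding bilinear_relators_def by blast

lemma relator_in_pairs: "r \<in> bilinear_relators M N \<Longrightarrow> r \<in> pairs"
proof -
  have b: "Poly_Mapping.single (x, y) a \<in> pairs" if "x \<in> carrier M" "y \<in> carrier N" for x y a
    using that by simp
  show "r \<in> pairs" if "r \<in> bilinear_relators M N"
    using that
  proof (cases rule: bilinear_relators_cases)
    case (add1 x x' y)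
    show ?thesis unfolding add1(1) by (intro P.S_diff b M.T_act add1(2-))
  next
    case (add2 x y y')
    show ?thesis unfolding add2(1) by (intro P.S_diff b N.T_act add2(2-))
  next
    case (scale1 a x y)
    show ?thesis unfolding scale1(1) by (intro P.S_diff b M.T_act scale1(2-))
  next
    case (scale2 a x y)
    show ?thesis unfolding scale2(1) by (intro P.S_diff b N.T_act scale2(2-))
  qed
qed

lemma relators_sub: "bilinear_relators M N \<subseteq> carrier (pair_rep M N)"
  unfolding P.p_onto[symmetric] image_ident using relator_in_pairs by blast

lemmas TK = P.lin_span_properties[OF relators_sub, folded tensor_kernel_def]
lemmas TKD = rep_image_id_submodule[OF rep_image_pair TK(1)]

lemma relators_in_TK:
  "x \<in> carrier M \<Longrightarrow> x' \<in> carrier M \<Longrightarrow> y \<in> carrier N \<Longrightarrow>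
     basis_vec (x \<oplus>\<^bsub>M\<^esub> x', y) - basis_vec (x, y) - basis_vec (x', y) \<in> TK"
  "x \<in> carrier M \<Longrightarrow> y \<in> carrier N \<Longrightarrow> y' \<in> carrier N \<Longrightarrow>
     basis_vec (x, y \<oplus>\<^bsub>N\<^esub> y') - basis_vec (x, y) - basis_vec (x, y') \<in> TK"
  "x \<in> carrier M \<Longrightarrow> y \<in> carrier N \<Longrightarrow> basis_vec (a \<odot>\<^bsub>M\<^esub> x, y) - Poly_Mapping.single (x, y) a \<in> TK"
  "x \<in> carrier M \<Longrightarrow> y \<in> carrier N \<Longrightarrow> basis_vec (x, a \<odot>\<^bsub>N\<^esub> y) - Poly_Mapping.single (x, y) a \<in> TK"
  by (rule subsetD[OF TK(2)], unfold bilinear_relators_def, blast)+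

text \<open>By the Leibniz rule g sends a relator to a sum of two relators of the same kind, with g
  applied in the first factor and in the second.\<close>

lemma act_relator_in_TK:
  assumes "r \<in> bilinear_relators M N"
  shows "act (pair_rep M N) g r \<in> TK"
proof -
  have single: "act (pair_rep M N) g (Poly_Mapping.single (x, y) a) =
      Poly_Mapping.single (act M g x, y) a + Poly_Mapping.single (x, act N g y) a" for x y a
    by (simp add: act_pair PM.pm_lin_single PM.scale_right_distrib pm_scale_single)
  have diff: "act (pair_rep M N) g (p - q) = act (pair_rep M N) g p - act (pair_rep M N) g q" for p q
    by (simp add: act_pair PM.pm_lin_diff)
  have split3: "a1 + a2 - (b1 + b2) - (c1 + c2) = (a1 - b1 - c1) + (a2 - b2 - c2)"
    and split2: "a1 + a2 - (b1 + b2) = (a1 - b1) + (a2 - b2)"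
    for a1 a2 b1 b2 c1 c2 :: "'a \<times> 'b \<Rightarrow>\<^sub>0 complex"
    by simp_all
  show ?thesis
    using assms
  proof (cases rule: bilinear_relators_cases)
    case (add1 x x' y)
    show ?thesis
      unfolding add1(1) diff single M.T_act(2)[OF add1(2,3)] split3
      by (intro TKD(2) relators_in_TK M.T_act N.T_act add1(2-))
  next
    case (add2 x y y')
    show ?thesis
      unfolding add2(1) diff single N.T_act(2)[OF add2(3,4)] split3
      by (intro TKD(2) relators_in_TK M.T_act N.T_act add2(2-))
  next
    case (scale1 a x y)
    show ?thesis
      unfolding scale1(1) diff single M.T_act(3)[OF scale1(2)] split2
      by (intro TKD(2) relators_in_TK M.T_act N.T_act scale1(2-))
  next
    case (scale2 a x y)
    show ?thesis
      unfolding scale2(1) diff single N.T_act(3)[OF scale2(3)] split2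
      by (intro TKD(2) relators_in_TK M.T_act N.T_act scale2(2-))
  qed
qed

lemma vir_submodule_TK: "vir_submodule TK (pair_rep M N)"
  unfolding tensor_kernel_def
  by (rule P.lin_span_vir_submodule[OF relators_sub]) (use act_relator_in_TK in \<open>simp add: tensor_kernel_def\<close>)

lemma pair_act_TK: "p \<in> TK \<Longrightarrow> pm_lin (pair_act g) pm_scale p \<in> TK"
  using vir_submodule_TK by (simp add: vir_submodule_def act_pair)

lemma rep_image_tensor:
  "rep_image pm_scale (\<lambda>g. pm_lin (pair_act g) pm_scale) pairs (\<lambda>p. TK +>\<^bsub>pair_rep M N\<^esub> p) (vir_tensor_product M N)"
  and tensor_eq_zero_iff: "p \<in> pairs \<Longrightarrow> TK +>\<^bsub>pair_rep M N\<^esub> p = \<zero>\<^bsub>vir_tensor_product M N\<^esub> \<longleftrightarrow> p \<in> TK"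
  using P.rep_image_quotient[OF vir_submodule_TK, folded vir_tensor_product_def] by blast+

lemma pure_zero_in_TK:
  "y \<in> carrier N \<Longrightarrow> basis_vec (\<zero>\<^bsub>M\<^esub>, y) \<in> TK" "x \<in> carrier M \<Longrightarrow> basis_vec (x, \<zero>\<^bsub>N\<^esub>) \<in> TK"
  using relators_in_TK(3)[of "\<zero>\<^bsub>M\<^esub>" y 0] relators_in_TK(4)[of x "\<zero>\<^bsub>N\<^esub>" 0]
  by (simp_all add: M.T_act N.T_act)

end

section \<open>The tensor product as an image of \<open>tensor_cover\<close>\<close>

context hw_interm
begin

abbreviation "interm_act \<equiv> \<lambda>g. pm_lin (\<lambda>n. case g of
     Dgen m \<Rightarrow> Poly_Mapping.single (m + n) (\<alpha> + of_int n + of_int m * \<beta>) | Cgen \<Rightarrow> 0) pm_scale"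

lemma rep_image_interm: "rep_image pm_scale interm_act UNIV (\<lambda>p. p) (interm \<alpha> \<beta>)"
  using rep_image_free_rep[of UNIV "\<lambda>g n. case g of
     Dgen m \<Rightarrow> Poly_Mapping.single (m + n) (\<alpha> + of_int n + of_int m * \<beta>) | Cgen \<Rightarrow> 0"]
  by (simp add: interm_def)

interpretation I: rep_image pm_scale interm_act UNIV "\<lambda>p. p" "interm \<alpha> \<beta>"
  by (rule rep_image_interm)

lemma interm_kernel_eq: "interm_kernel \<alpha> \<beta> = {p. \<forall>i. \<not> degenerate i \<longrightarrow> Poly_Mapping.lookup p i = 0}" (is "_ = ?K")
proof (cases "\<alpha> = 0 \<and> \<beta> = 0")
  case True
  then have deg: "degenerate = (\<lambda>i. i = 0)" unfolding degenerate_def fun_eq_iff by blast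
  have carrier: "{basis_vec 0} \<subseteq> carrier (interm \<alpha> \<beta>)" using I.p_onto by auto
  note span = I.lin_span_properties[OF carrier]
  have "submodule ?K complex_ring (interm \<alpha> \<beta>)"
    unfolding I.submodule_iff I.pull_def using I.p_onto by (auto simp: lookup_add lookup_pm_scale)
  moreover have "{basis_vec 0} \<subseteq> ?K" by (auto simp: deg lookup_one when_def)
  ultimately have 1: "lin_span (interm \<alpha> \<beta>) {basis_vec 0} \<subseteq> ?K" by (rule span(3))
  have "p \<in> lin_span (interm \<alpha> \<beta>) {basis_vec 0}" if "p \<in> ?K" for p
  proof -
    have "p = pm_scale (Poly_Mapping.lookup p 0) (basis_vec 0)"
      using that by (intro poly_mapping_eqI) (auto simp: deg lookup_pm_scale lookup_one when_def)
    moreover have "pm_scale (Poly_Mapping.lookup p 0) (basis_vec 0) \<in> lin_span (interm \<alpha> \<beta>) {basis_vec 0}"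
      by (rule rep_image_id_submodule(3)[OF rep_image_interm span(1)]) (use span(2) in blast)
    ultimately show ?thesis by simp
  qed
  with 1 True show ?thesis by (auto simp: interm_kernel_def)
next
  case False
  then have "\<not> degenerate i" for i unfolding degenerate_def by blast
  then show ?thesis using False by (auto simp: interm_kernel_def intro: poly_mapping_eqI)
qed

lemma vir_submodule_interm_kernel: "vir_submodule (interm_kernel \<alpha> \<beta>) (interm \<alpha> \<beta>)"
proof -
  \<comment> \<open>For (\<alpha>,\<beta>) = (0,0) the vector v_0 is killed by Vir; otherwise the
    kernel is 0.\<close>
  have "interm_act g p = 0" if "p \<in> interm_kernel \<alpha> \<beta>" for g p
  proof (cases "\<alpha> = 0 \<and> \<beta> = 0")
    case True
    then have deg: "degenerate = (\<lambda>i. i = 0)" unfolding degenerate_def fun_eq_iff by blast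
    have "p = Poly_Mapping.single 0 (Poly_Mapping.lookup p 0)"
      using that unfolding interm_kernel_eq
      by (intro poly_mapping_eqI) (auto simp: deg lookup_single when_def)
    then have "interm_act g p = interm_act g (Poly_Mapping.single 0 (Poly_Mapping.lookup p 0))" by simp
    also have "\<dots> = 0" using True by (cases g) (simp_all add: PM.pm_lin_single)
    finally show ?thesis .
  next
    case False
    then have "p = 0" using that unfolding interm_kernel_eq degenerate_def by (auto intro: poly_mapping_eqI)
    then show ?thesis by simp
  qed
  then show ?thesis
    unfolding I.vir_submodule_iff I.pull_def using I.p_onto
    by (auto simp: interm_kernel_eq lookup_add lookup_pm_scale)
qed

definition interm_map :: "(int \<Rightarrow>\<^sub>0 complex) \<Rightarrow> (int \<Rightarrow>\<^sub>0 complex) set" where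
  "interm_map p = interm_kernel \<alpha> \<beta> +>\<^bsub>interm \<alpha> \<beta>\<^esub> p"

lemma rep_image_interm': "rep_image pm_scale interm_act UNIV interm_map (interm' \<alpha> \<beta>)"
  and interm_map_eq_zero_iff: "interm_map p = \<zero>\<^bsub>interm' \<alpha> \<beta>\<^esub> \<longleftrightarrow> (\<forall>i. \<not> degenerate i \<longrightarrow> Poly_Mapping.lookup p i = 0)"
proof -
  note Q = I.rep_image_quotient[OF vir_submodule_interm_kernel, folded interm'_def, folded interm_map_def]
  show "rep_image pm_scale interm_act UNIV interm_map (interm' \<alpha> \<beta>)" by (rule Q(1))
  show "interm_map p = \<zero>\<^bsub>interm' \<alpha> \<beta>\<^esub> \<longleftrightarrow> (\<forall>i. \<not> degenerate i \<longrightarrow> Poly_Mapping.lookup p i = 0)"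
    using Q(2)[of p] by (simp add: interm_kernel_eq)
qed

lemma interm_vec_eq: "interm_vec \<alpha> \<beta> i = interm_map (basis_vec i)"
  by (simp add: interm_vec_def interm_map_def)

abbreviation "simple_M \<equiv> simple_hw c h"
abbreviation "interm_N \<equiv> interm' \<alpha> \<beta>"
abbreviation "sv \<equiv> simple_vec c h"

interpretation TF: tensor_factors U_scale "\<lambda>g x. Ugen g * x" UNIV sv simple_M pm_scale interm_act UNIV interm_map interm_N
  by (rule tensor_factors.intro[OF rep_image_simple rep_image_interm'])

interpretation TP: rep_image pm_scale "\<lambda>g. pm_lin (TF.pair_act g) pm_scale" TF.pairs
    "\<lambda>p. TF.TK +>\<^bsub>pair_rep simple_M interm_N\<^esub> p" "hw_tensor c h \<alpha> \<beta>"
  unfolding hw_tensor_def by (rule TF.rep_image_tensor)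

lemma tensor_zero_iff:
  "p \<in> TF.pairs \<Longrightarrow> TF.TK +>\<^bsub>pair_rep simple_M interm_N\<^esub> p = \<zero>\<^bsub>hw_tensor c h \<alpha> \<beta>\<^esub> \<longleftrightarrow> p \<in> TF.TK"
  unfolding hw_tensor_def by (rule TF.tensor_eq_zero_iff)

abbreviation "b_tensor i x \<equiv> basis_vec (sv x, interm_vec \<alpha> \<beta> i)"

lemma iv_closed: "interm_vec \<alpha> \<beta> i \<in> carrier interm_N"
  by (simp add: interm_vec_eq TF.N.p_closed)

lemma sv_closed: "sv x \<in> carrier simple_M"
  by (simp add: TF.M.p_closed)

lemma b_pairs: "Poly_Mapping.single (sv x, interm_vec \<alpha> \<beta> i) a \<in> TF.pairs"
  using iv_closed sv_closed by simp

lemma b_add: "b_tensor i (x + y) - b_tensor i x - b_tensor i y \<in> TF.TK"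
  using TF.relators_in_TK(1)[OF sv_closed sv_closed iv_closed] by (simp add: TF.M.p_add)

lemma b_scale: "b_tensor i (U_scale a x) - pm_scale a (b_tensor i x) \<in> TF.TK"
  using TF.relators_in_TK(3)[OF sv_closed iv_closed] by (simp add: TF.M.p_scale pm_scale_single)

lemma b_zero: "b_tensor i 0 \<in> TF.TK"
  using TF.pure_zero_in_TK(1)[OF iv_closed] by (simp add: TF.M.p_zero)

text \<open>A formal sum of pairs that represents the sum of the x_i u \<otimes> v_i. It is not
  linear in f, because the pair of a sum is not the sum of the pairs; linearity holds only up to
  \<open>tcong\<close>.\<close>

definition cover :: "tensor_cover \<Rightarrow> _" where
  "cover f = (\<Sum>i\<in>Poly_Mapping.keys f. b_tensor i (Poly_Mapping.lookup f i))"

lemma TK_sum: "(\<And>i. i \<in> A \<Longrightarrow> F i \<in> TF.TK) \<Longrightarrow> (\<Sum>i\<in>A. F i) \<in> TF.TK"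
  by (induction A rule: infinite_finite_induct) (auto intro: TF.TKD)

lemma pairs_sum: "(\<And>i. i \<in> A \<Longrightarrow> F i \<in> TF.pairs) \<Longrightarrow> (\<Sum>i\<in>A. F i) \<in> TF.pairs"
proof (induction A rule: infinite_finite_induct)
  case (insert i A)
  then show ?case unfolding sum.insert[OF insert.hyps] by (intro TP.S_add) blast+
qed (use TP.S_zero in simp_all)

lemma cover_pairs: "cover f \<in> TF.pairs"
  unfolding cover_def by (intro pairs_sum b_pairs)

definition tcong :: "_ \<Rightarrow> _ \<Rightarrow> bool" where
  "tcong p q \<longleftrightarrow> p - q \<in> TF.TK"

lemma tcong_refl: "tcong p p"
  by (simp add: tcong_def TF.TKD(1))

lemma tcong_sym: "tcong p q \<Longrightarrow> tcong q p"
  using TF.TKD(4)[of "p - q"] by (simp add: tcong_def)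

lemma tcong_trans [trans]: "tcong p q \<Longrightarrow> tcong q r \<Longrightarrow> tcong p r"
  using TF.TKD(2)[of "p - q" "q - r"] by (simp add: tcong_def)

lemma tcong_add: "tcong p q \<Longrightarrow> tcong p' q' \<Longrightarrow> tcong (p + p') (q + q')"
  using TF.TKD(2)[of "p - q" "p' - q'"] by (simp add: tcong_def algebra_simps)

lemma tcong_scale: "tcong p q \<Longrightarrow> tcong (pm_scale a p) (pm_scale a q)"
  using TF.TKD(3)[of "p - q" a] by (simp add: tcong_def PM.scale_right_diff_distrib)

lemma tcong_act: "tcong p q \<Longrightarrow> tcong (pm_lin (TF.pair_act g) pm_scale p) (pm_lin (TF.pair_act g) pm_scale q)"
  using TF.pair_act_TK[of "p - q" g] by (simp add: tcong_def PM.pm_lin_diff)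

lemma tcong_sum: "(\<And>i. i \<in> A \<Longrightarrow> tcong (F i) (G i)) \<Longrightarrow> tcong (\<Sum>i\<in>A. F i) (\<Sum>i\<in>A. G i)"
  using TK_sum[of A "\<lambda>i. F i - G i"] by (simp add: tcong_def sum_subtractf)

lemma tcong_b_add: "tcong (b_tensor i (x + y)) (b_tensor i x + b_tensor i y)"
  using b_add[where i = i and x = x and y = y] by (simp add: tcong_def diff_diff_eq)

lemma tcong_b_scale: "tcong (b_tensor i (U_scale a x)) (pm_scale a (b_tensor i x))"
  using b_scale[where i = i and a = a and x = x] by (simp add: tcong_def)

text \<open>Enlarging the index set adds pairs with first entry 0. These are basis vectors rather
  than 0, but lie in the tensor kernel.\<close>

lemma cover_superset:
  assumes "finite A" "Poly_Mapping.keys f \<subseteq> A"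
  shows "tcong (cover f) (\<Sum>i\<in>A. b_tensor i (Poly_Mapping.lookup f i))"
proof -
  have "(\<Sum>i\<in>A. b_tensor i (Poly_Mapping.lookup f i)) - cover f =
      (\<Sum>i\<in>A - Poly_Mapping.keys f. b_tensor i (Poly_Mapping.lookup f i))"
    unfolding cover_def using sum.subset_diff[OF assms(2,1), of "\<lambda>i. b_tensor i (Poly_Mapping.lookup f i)"] by simp
  also have "\<dots> = (\<Sum>i\<in>A - Poly_Mapping.keys f. b_tensor i 0)"
    by (intro sum.cong) (auto simp: in_keys_iff)
  also have "\<dots> \<in> TF.TK" by (intro TK_sum b_zero)
  finally show ?thesis by (intro tcong_sym[of _ "cover f"]) (simp add: tcong_def)
qed

lemma cover_single: "tcong (cover (e_tensor i x)) (b_tensor i x)"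
  using cover_superset[of "{i}" "e_tensor i x"] by simp

lemma cover_add: "tcong (cover (f + g)) (cover f + cover g)"
proof -
  let ?A = "Poly_Mapping.keys f \<union> Poly_Mapping.keys g \<union> Poly_Mapping.keys (f + g)"
  have "tcong (cover (f + g)) (\<Sum>i\<in>?A. b_tensor i (Poly_Mapping.lookup (f + g) i))"
    by (rule cover_superset) auto
  also have "tcong (\<Sum>i\<in>?A. b_tensor i (Poly_Mapping.lookup (f + g) i))
      (\<Sum>i\<in>?A. b_tensor i (Poly_Mapping.lookup f i) + b_tensor i (Poly_Mapping.lookup g i))"
    unfolding lookup_add by (intro tcong_sum tcong_b_add)
  also have "tcong (\<Sum>i\<in>?A. b_tensor i (Poly_Mapping.lookup f i) + b_tensor i (Poly_Mapping.lookup g i)) (cover f + cover g)"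
    unfolding sum.distrib by (intro tcong_add tcong_sym[OF cover_superset]) auto
  finally show ?thesis .
qed

lemma cover_scale: "tcong (cover (E_scale a f)) (pm_scale a (cover f))"
proof (induction f rule: tensor_cover_induct)
  case (single i x)
  have "tcong (cover (E_scale a (e_tensor i x))) (b_tensor i (U_scale a x))"
    unfolding E_scale by (rule cover_single)
  also have "tcong (b_tensor i (U_scale a x)) (pm_scale a (b_tensor i x))" by (rule tcong_b_scale)
  also have "tcong (pm_scale a (b_tensor i x)) (pm_scale a (cover (e_tensor i x)))"
    by (rule tcong_scale[OF tcong_sym[OF cover_single]])
  finally show ?case .
next
  case (add f g)
  have "tcong (cover (E_scale a (f + g))) (cover (E_scale a f) + cover (E_scale a g))"
    unfolding E_scale by (rule cover_add)
  also have "tcong (cover (E_scale a f) + cover (E_scale a g)) (pm_scale a (cover f + cover g))"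
    unfolding PM.scale_right_distrib using add by (rule tcong_add)
  also have "tcong (pm_scale a (cover f + cover g)) (pm_scale a (cover (f + g)))"
    by (rule tcong_scale[OF tcong_sym[OF cover_add]])
  finally show ?case .
qed

lemma cover_act: "tcong (cover (act_E g f)) (pm_lin (TF.pair_act g) pm_scale (cover f))"
proof (induction f rule: tensor_cover_induct)
  case (single i x)
  have act_sv: "act simple_M g (sv x) = sv (Ugen g * x)" by (simp add: TF.M.p_act)
  have b: "pm_lin (TF.pair_act g) pm_scale (b_tensor i x) =
      b_tensor i (Ugen g * x) + basis_vec (sv x, act interm_N g (interm_vec \<alpha> \<beta> i))"
    by (simp add: PM.pm_lin_single act_sv)
  have act_iv: "act interm_N g (interm_vec \<alpha> \<beta> i) = interm_map (interm_act g (basis_vec i))"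
    by (simp add: interm_vec_eq TF.N.p_act)
  have "tcong (cover (act_E g (e_tensor i x))) (pm_lin (TF.pair_act g) pm_scale (b_tensor i x))"
  proof (cases g)
    case (Dgen m)
    let ?k = "\<alpha> + of_int i + of_int m * \<beta>"
    have "interm_act g (basis_vec i) = pm_scale ?k (basis_vec (m + i))"
      by (simp add: Dgen PM.pm_lin_single pm_scale_single)
    then have "act interm_N g (interm_vec \<alpha> \<beta> i) = interm_map (pm_scale ?k (basis_vec (m + i)))"
      by (simp only: act_iv)
    also have "\<dots> = ?k \<odot>\<^bsub>interm_N\<^esub> interm_vec \<alpha> \<beta> (m + i)"
      unfolding interm_vec_eq by (rule TF.N.p_scale) simp
    finally have "act interm_N g (interm_vec \<alpha> \<beta> i) = ?k \<odot>\<^bsub>interm_N\<^esub> interm_vec \<alpha> \<beta> (m + i)" .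
    then have 1: "tcong (basis_vec (sv x, act interm_N g (interm_vec \<alpha> \<beta> i))) (pm_scale ?k (b_tensor (m + i) x))"
      using TF.relators_in_TK(4)[OF sv_closed iv_closed, of x ?k "m + i"] by (simp add: tcong_def pm_scale_single)
    have "tcong (cover (act_E g (e_tensor i x))) (cover (e_tensor i (Ugen g * x)) + cover (e_tensor (m + i) (U_scale ?k x)))"
      unfolding Dgen E_act gen_tensor.simps by (rule cover_add)
    also have "tcong (cover (e_tensor i (Ugen g * x)) + cover (e_tensor (m + i) (U_scale ?k x)))
        (b_tensor i (Ugen g * x) + b_tensor (m + i) (U_scale ?k x))"
      by (intro tcong_add cover_single)
    also have "tcong (b_tensor i (Ugen g * x) + b_tensor (m + i) (U_scale ?k x))
        (b_tensor i (Ugen g * x) + pm_scale ?k (b_tensor (m + i) x))"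
      by (intro tcong_add tcong_refl tcong_b_scale)
    also have "tcong (b_tensor i (Ugen g * x) + pm_scale ?k (b_tensor (m + i) x)) (pm_lin (TF.pair_act g) pm_scale (b_tensor i x))"
      unfolding b by (intro tcong_add tcong_refl tcong_sym[OF 1])
    finally show ?thesis .
  next
    case Cgen
    have "act interm_N g (interm_vec \<alpha> \<beta> i) = \<zero>\<^bsub>interm_N\<^esub>"
      using act_iv by (simp add: Cgen PM.pm_lin_single TF.N.p_zero)
    then have 1: "basis_vec (sv x, act interm_N g (interm_vec \<alpha> \<beta> i)) \<in> TF.TK"
      using TF.pure_zero_in_TK(2)[OF sv_closed] by simp
    have "tcong (cover (act_E g (e_tensor i x))) (b_tensor i (Ugen g * x))"
      unfolding Cgen E_act gen_tensor.simps by (rule cover_single)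
    also have "tcong (b_tensor i (Ugen g * x)) (pm_lin (TF.pair_act g) pm_scale (b_tensor i x))"
      unfolding b by (rule tcong_sym) (simp add: tcong_def 1)
    finally show ?thesis .
  qed
  also have "tcong (pm_lin (TF.pair_act g) pm_scale (b_tensor i x)) (pm_lin (TF.pair_act g) pm_scale (cover (e_tensor i x)))"
    by (rule tcong_act[OF tcong_sym[OF cover_single]])
  finally show ?case .
next
  case (add f f')
  have "tcong (cover (act_E g (f + f'))) (cover (act_E g f) + cover (act_E g f'))"
    unfolding E_act by (rule cover_add)
  also have "tcong (cover (act_E g f) + cover (act_E g f')) (pm_lin (TF.pair_act g) pm_scale (cover f + cover f'))"
    unfolding PM.pm_lin_add using add by (rule tcong_add)
  also have "tcong (pm_lin (TF.pair_act g) pm_scale (cover f + cover f')) (pm_lin (TF.pair_act g) pm_scale (cover (f + f')))"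
    by (rule tcong_act[OF tcong_sym[OF cover_add]])
  finally show ?case .
qed

lemma cover_onto:
  assumes "p \<in> TF.pairs"
  shows "\<exists>f. tcong p (cover f)"
proof -
  have pure: "\<exists>f. tcong (basis_vec (sv x, interm_map q)) (cover f)" for x q
  proof (induction q rule: poly_mapping_induct_single)
    case (single i a)
    have "interm_map (Poly_Mapping.single i a) = a \<odot>\<^bsub>interm_N\<^esub> interm_vec \<alpha> \<beta> i"
      using TF.N.p_scale[of "basis_vec i" a] by (simp add: pm_scale_single interm_vec_eq)
    then have "tcong (basis_vec (sv x, interm_map (Poly_Mapping.single i a))) (pm_scale a (b_tensor i x))"
      using TF.relators_in_TK(4)[OF sv_closed iv_closed, of x a i] by (simp add: tcong_def pm_scale_single)
    also have "tcong (pm_scale a (b_tensor i x)) (b_tensor i (U_scale a x))" by (rule tcong_sym[OF tcong_b_scale])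
    also have "tcong (b_tensor i (U_scale a x)) (cover (e_tensor i (U_scale a x)))" by (rule tcong_sym[OF cover_single])
    finally show ?case by blast
  next
    case (add q q')
    then obtain f f' where f: "tcong (basis_vec (sv x, interm_map q)) (cover f)" "tcong (basis_vec (sv x, interm_map q')) (cover f')" by blast
    have "tcong (basis_vec (sv x, interm_map (q + q'))) (basis_vec (sv x, interm_map q) + basis_vec (sv x, interm_map q'))"
      using TF.relators_in_TK(2)[OF sv_closed, of "interm_map q" "interm_map q'" x] TF.N.p_closed
      by (simp add: tcong_def diff_diff_eq TF.N.p_add)
    also have "tcong (basis_vec (sv x, interm_map q) + basis_vec (sv x, interm_map q')) (cover f + cover f')"
      by (rule tcong_add[OF f])
    also have "tcong (cover f + cover f') (cover (f + f'))" by (rule tcong_sym[OF cover_add])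
    finally show ?case by blast
  qed
  have "\<exists>f. tcong (\<Sum>k\<in>A. Poly_Mapping.single k (Poly_Mapping.lookup p k)) (cover f)"
    if "finite A" "A \<subseteq> carrier simple_M \<times> carrier interm_N" for A
    using that
  proof (induction A)
    case empty
    have "cover 0 = 0" by (simp add: cover_def)
    then show ?case using tcong_refl[of 0] by (intro exI[of _ 0]) simp
  next
    case (insert k A)
    obtain s t where st: "k = (s, t)" "s \<in> carrier simple_M" "t \<in> carrier interm_N"
      using insert.prems by (cases k) auto
    obtain x where x: "s = sv x" using st(2) by (rule TF.M.carrierE)
    obtain q where q: "t = interm_map q" using st(3) by (rule TF.N.carrierE)
    have k: "k = (sv x, interm_map q)" using st(1) x q by simp
    obtain f where f: "tcong (\<Sum>k\<in>A. Poly_Mapping.single k (Poly_Mapping.lookup p k)) (cover f)" using insert by blast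
    obtain f' where f': "tcong (basis_vec k) (cover f')" using pure k by blast
    let ?a = "Poly_Mapping.lookup p k"
    have "tcong (\<Sum>k\<in>insert k A. Poly_Mapping.single k (Poly_Mapping.lookup p k)) (pm_scale ?a (cover f') + cover f)"
      using insert.hyps tcong_add[OF tcong_scale[OF f', of ?a] f] by (simp add: pm_scale_single)
    also have "tcong (pm_scale ?a (cover f') + cover f) (cover (E_scale ?a f') + cover f)"
      by (intro tcong_add tcong_refl tcong_sym[OF cover_scale])
    also have "tcong (cover (E_scale ?a f') + cover f) (cover (E_scale ?a f' + f))"
      by (rule tcong_sym[OF cover_add])
    finally show ?case by blast
  qed
  from this[OF finite_keys, of p] assms show ?thesis by (simp flip: poly_mapping_sum_single)
qed

text \<open>
  Arbitrary representatives of the factors give an inverse of \<open>cover\<close> up to \<open>E_kernel\<close>; hence no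
  element outside \<open>E_kernel\<close> vanishes in the tensor product.
\<close>

definition lift_left :: "_ \<Rightarrow> Uvir" where
  "lift_left s = (SOME x. sv x = s)"

definition lift_right :: "_ \<Rightarrow> (int \<Rightarrow>\<^sub>0 complex)" where
  "lift_right t = (SOME q. interm_map q = t)"

lemma lift_left: "s \<in> carrier simple_M \<Longrightarrow> sv (lift_left s) = s"
proof -
  assume "s \<in> carrier simple_M"
  then obtain x where "s = sv x" by (rule TF.M.carrierE)
  then show ?thesis unfolding lift_left_def by (intro someI_ex[of "\<lambda>x. sv x = s"]) blast
qed

lemma lift_right: "t \<in> carrier interm_N \<Longrightarrow> interm_map (lift_right t) = t"
proof -
  assume "t \<in> carrier interm_N"
  then obtain q where "t = interm_map q" by (rule TF.N.carrierE)
  then show ?thesis unfolding lift_right_def by (intro someI_ex[of "\<lambda>q. interm_map q = t"]) blast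
qed

lemma sv_eqD: "sv x = sv y \<Longrightarrow> x - y \<in> L"
  using iffD1[OF TF.M.p_eq_iff[OF UNIV_I UNIV_I]] simple_vec_eq_zero_iff by blast

lemma interm_map_lookup_eq:
  assumes "interm_map q = interm_map q'" "\<not> degenerate i"
  shows "Poly_Mapping.lookup q i = Poly_Mapping.lookup q' i"
proof -
  have "interm_map (q - q') = \<zero>\<^bsub>interm_N\<^esub>" by (rule iffD1[OF TF.N.p_eq_iff[OF UNIV_I UNIV_I] assms(1)])
  then have "Poly_Mapping.lookup (q - q') i = 0" using interm_map_eq_zero_iff assms(2) by blast
  then show ?thesis by (simp add: lookup_minus)
qed

definition uncover :: "_ \<Rightarrow> tensor_cover" where
  "uncover = pm_lin (\<lambda>(s, t). pm_lin (\<lambda>i. e_tensor i (lift_left s)) E_scale (lift_right t)) E_scale"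

lemma lookup_uncover_single:
  "Poly_Mapping.lookup (uncover (Poly_Mapping.single (s, t) a)) j =
     U_scale (a * Poly_Mapping.lookup (lift_right t) j) (lift_left s)"
proof -
  have "Poly_Mapping.lookup (pm_lin (\<lambda>i. e_tensor i x) E_scale q) j = U_scale (Poly_Mapping.lookup q j) x" for x q
    by (induction q rule: poly_mapping_induct_single)
       (auto simp: Es.pm_lin_single Es.pm_lin_add lookup_add lookup_E_scale lookup_single when_def U_scale_add_left)
  then show ?thesis by (simp add: uncover_def Es.pm_lin_single lookup_E_scale U_scale_simps)
qed

lemma uncover_linear:
  "uncover (p + q) = uncover p + uncover q" "uncover (p - q) = uncover p - uncover q"
  "uncover (pm_scale a p) = E_scale a (uncover p)" "uncover 0 = 0"
  "uncover (\<Sum>i\<in>A. F i) = (\<Sum>i\<in>A. uncover (F i))"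
  by (simp_all add: uncover_def Es.pm_lin_add Es.pm_lin_diff Es.pm_lin_scale Es.pm_lin_sum)

lemma lift_left_add:
  assumes "s \<in> carrier simple_M" "s' \<in> carrier simple_M"
  shows "lift_left (s \<oplus>\<^bsub>simple_M\<^esub> s') - lift_left s - lift_left s' \<in> L"
proof -
  have "sv (lift_left (s \<oplus>\<^bsub>simple_M\<^esub> s')) = sv (lift_left s + lift_left s')"
    unfolding TF.M.p_add[OF UNIV_I UNIV_I] lift_left[OF assms(1)] lift_left[OF assms(2)]
    by (rule lift_left[OF TF.M.T_act(4)[OF assms]])
  from sv_eqD[OF this] show ?thesis by (simp add: diff_diff_eq)
qed

lemma lift_left_scale:
  assumes "s \<in> carrier simple_M"
  shows "lift_left (a \<odot>\<^bsub>simple_M\<^esub> s) - U_scale a (lift_left s) \<in> L"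
proof -
  have "sv (lift_left (a \<odot>\<^bsub>simple_M\<^esub> s)) = sv (U_scale a (lift_left s))"
    unfolding TF.M.p_scale[OF UNIV_I] lift_left[OF assms]
    by (rule lift_left[OF TF.M.T_act(5)[OF assms]])
  then show ?thesis by (rule sv_eqD)
qed

lemma lift_left_sv: "lift_left (sv x) - x \<in> L"
  by (rule sv_eqD[OF lift_left[OF sv_closed]])

lemma lift_right_add:
  assumes "t \<in> carrier interm_N" "t' \<in> carrier interm_N" "\<not> degenerate i"
  shows "Poly_Mapping.lookup (lift_right (t \<oplus>\<^bsub>interm_N\<^esub> t')) i =
    Poly_Mapping.lookup (lift_right t) i + Poly_Mapping.lookup (lift_right t') i"
proof -
  have "interm_map (lift_right (t \<oplus>\<^bsub>interm_N\<^esub> t')) = interm_map (lift_right t + lift_right t')"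
    unfolding TF.N.p_add[OF UNIV_I UNIV_I] lift_right[OF assms(1)] lift_right[OF assms(2)]
    by (rule lift_right[OF TF.N.T_act(4)[OF assms(1,2)]])
  from interm_map_lookup_eq[OF this assms(3)] show ?thesis by (simp only: lookup_add)
qed

lemma lift_right_scale:
  assumes "t \<in> carrier interm_N" "\<not> degenerate i"
  shows "Poly_Mapping.lookup (lift_right (a \<odot>\<^bsub>interm_N\<^esub> t)) i = a * Poly_Mapping.lookup (lift_right t) i"
proof -
  have "interm_map (lift_right (a \<odot>\<^bsub>interm_N\<^esub> t)) = interm_map (pm_scale a (lift_right t))"
    unfolding TF.N.p_scale[OF UNIV_I] lift_right[OF assms(1)]
    by (rule lift_right[OF TF.N.T_act(5)[OF assms(1)]])
  from interm_map_lookup_eq[OF this assms(2)] show ?thesis by (simp only: lookup_pm_scale)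
qed

lemma lift_right_iv:
  assumes "\<not> degenerate i"
  shows "Poly_Mapping.lookup (lift_right (interm_vec \<alpha> \<beta> j)) i = (if i = j then 1 else 0)"
proof -
  have "interm_map (lift_right (interm_vec \<alpha> \<beta> j)) = interm_map (basis_vec j)"
    unfolding lift_right[OF iv_closed] by (rule interm_vec_eq)
  from interm_map_lookup_eq[OF this assms] show ?thesis
    unfolding lookup_single when_def by (auto split: if_splits)
qed

lemma uncover_relator:
  assumes "r \<in> bilinear_relators simple_M interm_N"
  shows "uncover r \<in> E_kernel"
  using assms
proof (cases rule: TF.bilinear_relators_cases)
  case (add1 x x' y)
  have "Poly_Mapping.lookup (uncover r) j =
      U_scale (Poly_Mapping.lookup (lift_right y) j) (lift_left (x \<oplus>\<^bsub>simple_M\<^esub> x') - lift_left x - lift_left x')" for j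
    unfolding add1(1) uncover_linear lookup_minus lookup_uncover_single
    by (simp only: U.scale_right_diff_distrib mult_1_left)
  then show ?thesis
    using verma_radicalD(4)[OF lift_left_add[OF add1(2,3)]] by (simp only: E_kernel_def mem_Collect_eq) blast
next
  case (add2 x y y')
  have "Poly_Mapping.lookup (uncover r) j = 0" if "\<not> degenerate j" for j
    unfolding add2(1) uncover_linear lookup_minus lookup_uncover_single lift_right_add[OF add2(3,4) that]
    by (simp only: distrib_left U_scale_add_left) simp
  then show ?thesis
    using verma_radicalD(1) unfolding E_kernel_def by simp
next
  case (scale1 a x y)
  have "Poly_Mapping.lookup (uncover r) j =
      U_scale (Poly_Mapping.lookup (lift_right y) j) (lift_left (a \<odot>\<^bsub>simple_M\<^esub> x) - U_scale a (lift_left x))" for j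
    unfolding scale1(1) uncover_linear lookup_minus lookup_uncover_single
    by (simp only: U.scale_right_diff_distrib mult_1_left U_scale_simps(2) mult.commute)
  then show ?thesis
    using verma_radicalD(4)[OF lift_left_scale[OF scale1(2)]] by (simp only: E_kernel_def mem_Collect_eq) blast
next
  case (scale2 a x y)
  have "Poly_Mapping.lookup (uncover r) j = 0" if "\<not> degenerate j" for j
  proof -
    have "Poly_Mapping.lookup (uncover r) j =
        U_scale (1 * Poly_Mapping.lookup (lift_right (a \<odot>\<^bsub>interm_N\<^esub> y)) j) (lift_left x) -
        U_scale (a * Poly_Mapping.lookup (lift_right y) j) (lift_left x)"
      unfolding scale2(1) uncover_linear lookup_minus lookup_uncover_single ..
    also have "\<dots> = 0"
      by (simp only: lift_right_scale[OF scale2(3) that, of a] mult_1_left diff_self)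
    finally show ?thesis .
  qed
  then show ?thesis
    using verma_radicalD(1) unfolding E_kernel_def by simp
qed

lemma uncover_cover: "uncover (cover f) - f \<in> E_kernel"
  unfolding E_kernel_def mem_Collect_eq lookup_minus
proof (intro allI impI)
  fix j assume j: "\<not> degenerate j"
  have "Poly_Mapping.lookup (uncover (cover f)) j =
      (\<Sum>i\<in>Poly_Mapping.keys f. if j = i then lift_left (sv (Poly_Mapping.lookup f i)) else 0)"
    unfolding cover_def uncover_linear lookup_sum lookup_uncover_single lift_right_iv[OF j]
    by (intro sum.cong) (auto simp: U_scale_simps)
  also have "\<dots> = (if j \<in> Poly_Mapping.keys f then lift_left (sv (Poly_Mapping.lookup f j)) else 0)"
    by (simp add: sum.delta')
  finally show "Poly_Mapping.lookup (uncover (cover f)) j - Poly_Mapping.lookup f j \<in> L"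
    using lift_left_sv[of "Poly_Mapping.lookup f j"] by (auto simp: in_keys_iff verma_radicalD(1))
qed

text \<open>The relators span the tensor kernel and \<open>uncover\<close> maps them into
  \<open>E_kernel\<close>; since \<open>uncover (cover f)\<close> differs from f by the kernel, f
  lies there too. Conversely, for f in \<open>E_kernel\<close> every single term has a vanishing
  factor.\<close>

lemma cover_in_TK_iff: "cover f \<in> TF.TK \<longleftrightarrow> f \<in> E_kernel"
proof
  interpret P: rep_image pm_scale "\<lambda>g. pm_lin (TF.pair_act g) pm_scale" TF.pairs "\<lambda>p. p" "pair_rep simple_M interm_N"
    by (rule TF.rep_image_pair)
  let ?H = "{p \<in> TF.pairs. uncover p \<in> E_kernel}"
  have pull: "P.pull ?H = ?H" by (auto simp: P.pull_def)
  have "submodule ?H complex_ring (pair_rep simple_M interm_N)"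
    unfolding P.submodule_iff pull
  proof (intro conjI ballI allI)
    show "?H \<subseteq> carrier (pair_rep simple_M interm_N)" using P.p_onto by auto
    show "0 \<in> ?H" using P.S_zero E_kernelD(1) by (simp add: uncover_linear)
    show "p + q \<in> ?H" if "p \<in> ?H" "q \<in> ?H" for p q
      using that P.S_add[of p q] E_kernelD(2) by (simp add: uncover_linear)
    show "pm_scale a p \<in> ?H" if "p \<in> ?H" for a p
      using that P.S_scale[of p a] E_kernelD(3) by (simp add: uncover_linear)
  qed
  moreover have "bilinear_relators simple_M interm_N \<subseteq> ?H"
    using TF.relator_in_pairs uncover_relator by blast
  ultimately have "TF.TK \<subseteq> ?H" by (rule TF.TK(3))
  then show "cover f \<in> TF.TK \<Longrightarrow> f \<in> E_kernel"
    using E_stable_cong[OF E_stable_kernel uncover_cover[of f]] by blast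
next
  assume f: "f \<in> E_kernel"
  have "b_tensor i (Poly_Mapping.lookup f i) \<in> TF.TK" for i
  proof (cases "degenerate i")
    case True
    then have "interm_vec \<alpha> \<beta> i = \<zero>\<^bsub>interm_N\<^esub>"
      unfolding interm_vec_eq interm_map_eq_zero_iff lookup_single when_def by auto
    then show ?thesis using TF.pure_zero_in_TK(2)[OF sv_closed] by simp
  next
    case False
    then have "Poly_Mapping.lookup f i \<in> L" using f by (simp add: E_kernel_def)
    then have "sv (Poly_Mapping.lookup f i) = \<zero>\<^bsub>simple_M\<^esub>" by (simp add: simple_vec_eq_zero_iff)
    then show ?thesis using TF.pure_zero_in_TK(1)[OF iv_closed] by simp
  qed
  then show "cover f \<in> TF.TK" unfolding cover_def by (intro TK_sum)
qed

definition tensor_map :: "tensor_cover \<Rightarrow> _" where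
  "tensor_map f = TF.TK +>\<^bsub>pair_rep simple_M interm_N\<^esub> cover f"

lemma tensor_map_zero_iff: "tensor_map f = \<zero>\<^bsub>hw_tensor c h \<alpha> \<beta>\<^esub> \<longleftrightarrow> f \<in> E_kernel"
  unfolding tensor_map_def using tensor_zero_iff[OF cover_pairs] cover_in_TK_iff by simp

lemma rep_image_hw_tensor: "rep_image E_scale act_E UNIV tensor_map (hw_tensor c h \<alpha> \<beta>)"
proof -
  let ?Q = "\<lambda>p. TF.TK +>\<^bsub>pair_rep simple_M interm_N\<^esub> p"
  have cong: "?Q p = ?Q q" if "tcong p q" "p \<in> TF.pairs" "q \<in> TF.pairs" for p q
    using TP.p_eq_iff[OF that(2,3)] tensor_zero_iff[OF TP.S_diff[OF that(2,3)]] that(1) by (simp add: tcong_def)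
  show ?thesis
  proof (rule rep_image.intro)
    show "range tensor_map = carrier (hw_tensor c h \<alpha> \<beta>)"
    proof (intro equalityI subsetI)
      fix t assume "t \<in> carrier (hw_tensor c h \<alpha> \<beta>)"
      then obtain p where p: "p \<in> TF.pairs" "t = ?Q p" by (rule TP.carrierE)
      obtain f where "tcong p (cover f)" using cover_onto[OF p(1)] by blast
      from cong[OF this p(1) cover_pairs] p(2) show "t \<in> range tensor_map" by (simp add: tensor_map_def)
    qed (auto simp: tensor_map_def simp del: mem_Collect_eq intro: TP.p_closed[OF cover_pairs])
    show "tensor_map (f + g) = tensor_map f \<oplus>\<^bsub>hw_tensor c h \<alpha> \<beta>\<^esub> tensor_map g" for f g
      unfolding tensor_map_def TP.p_add[OF cover_pairs cover_pairs, symmetric]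
      by (rule cong[OF cover_add cover_pairs TP.S_add[OF cover_pairs cover_pairs]])
    show "tensor_map (E_scale a f) = a \<odot>\<^bsub>hw_tensor c h \<alpha> \<beta>\<^esub> tensor_map f" for a f
      unfolding tensor_map_def TP.p_scale[OF cover_pairs, symmetric]
      by (rule cong[OF cover_scale cover_pairs TP.S_scale[OF cover_pairs]])
    show "tensor_map (act_E g f) = act (hw_tensor c h \<alpha> \<beta>) g (tensor_map f)" for g f
      unfolding tensor_map_def TP.p_act[OF cover_pairs, symmetric]
      by (rule cong[OF cover_act cover_pairs TP.S_act[OF cover_pairs]])
    show "tensor_map 0 = \<zero>\<^bsub>hw_tensor c h \<alpha> \<beta>\<^esub>" using tensor_map_zero_iff E_kernelD(1) by blast
  qed (simp_all add: E.vector_space_axioms E_act E_act_scale)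
qed

lemma pure_tensor_eq: "pure_tensor simple_M interm_N (hw_vec c h) (interm_vec \<alpha> \<beta> i) = tensor_map (e_tensor i 1)"
  by (simp add: pure_tensor_def tensor_map_def cover_def hw_vec_eq)

section \<open>Submodules of the tensor product\<close>

abbreviation "T \<equiv> hw_tensor c h \<alpha> \<beta>"

interpretation R: rep_image E_scale act_E UNIV tensor_map T
  by (rule rep_image_hw_tensor)

lemma vir_submodule_T_iff: "vir_submodule H T \<longleftrightarrow> H \<subseteq> carrier T \<and> E_stable \<alpha> \<beta> (R.pull H)"
  unfolding R.vir_submodule_iff E_stable_def by blast

lemma kernel_subset_pull:
  assumes "vir_submodule H T"
  shows "E_kernel \<subseteq> R.pull H"
proof
  fix f assume "f \<in> E_kernel"
  then have "tensor_map f = \<zero>\<^bsub>T\<^esub>" by (simp only: tensor_map_zero_iff)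
  moreover have "0 \<in> R.pull H" using assms unfolding R.vir_submodule_iff by blast
  then have "\<zero>\<^bsub>T\<^esub> \<in> H" by (simp add: R.pull_def R.p_zero)
  ultimately show "f \<in> R.pull H" by (simp add: R.pull_def)
qed

lemma tensor_map_eqD: "tensor_map f = tensor_map g \<Longrightarrow> f - g \<in> E_kernel"
  using iffD1[OF R.p_eq_iff[OF UNIV_I UNIV_I]] tensor_map_zero_iff by blast

lemma pull_image:
  assumes "E_kernel \<subseteq> N" "\<And>f g. f \<in> N \<Longrightarrow> g \<in> N \<Longrightarrow> f + g \<in> N"
  shows "R.pull (tensor_map ` N) = N"
proof (intro equalityI subsetI)
  fix f assume "f \<in> R.pull (tensor_map ` N)"
  then obtain g where g: "g \<in> N" "tensor_map f = tensor_map g" by (auto simp: R.pull_def)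
  have "f - g \<in> N" using tensor_map_eqD[OF g(2)] assms(1) by blast
  from assms(2)[OF this g(1)] show "f \<in> N" by simp
qed (simp add: R.pull_def)

lemma image_pull: "H \<subseteq> carrier T \<Longrightarrow> tensor_map ` R.pull H = H"
  by (rule R.p_pull)

lemma pull_stable_image: "E_stable \<alpha> \<beta> N \<Longrightarrow> E_kernel \<subseteq> N \<Longrightarrow> R.pull (tensor_map ` N) = N"
  by (rule pull_image) (auto intro: E_stableD(2))

lemma vir_submodule_image: "E_stable \<alpha> \<beta> N \<Longrightarrow> E_kernel \<subseteq> N \<Longrightarrow> vir_submodule (tensor_map ` N) T"
  unfolding vir_submodule_T_iff pull_stable_image using R.p_closed by blast

lemma W_sub_eq: "W_sub c h \<alpha> \<beta> n = tensor_map ` E_sub n"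
proof -
  let ?G = "{pure_tensor simple_M interm_N (hw_vec c h) (interm_vec \<alpha> \<beta> i) | i :: int. n < i}"
  have "vir_generated T ?G \<subseteq> tensor_map ` E_sub n"
    unfolding vir_generated_def
  proof (rule hull_minimal)
    show "?G \<subseteq> tensor_map ` E_sub n"
      using e_tensor_in_sub by (auto simp: pure_tensor_eq)
    show "vir_submodule (tensor_map ` E_sub n) T"
      by (rule vir_submodule_image[OF E_stable_sub E_kernel_subset_sub])
  qed
  moreover have "tensor_map ` E_sub n \<subseteq> H" if H: "vir_submodule H T" "?G \<subseteq> H" for H
  proof -
    have "E_sub n \<subseteq> R.pull H"
    proof (rule E_sub_least)
      show "E_stable \<alpha> \<beta> (R.pull H)" using H(1) vir_submodule_T_iff by blast
      show "E_kernel \<subseteq> R.pull H" by (rule kernel_subset_pull[OF H(1)])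
      fix i assume "i > n"
      then have "pure_tensor simple_M interm_N (hw_vec c h) (interm_vec \<alpha> \<beta> i) \<in> H" using H(2) by blast
      then show "e_tensor i 1 \<in> R.pull H" by (simp add: R.pull_def pure_tensor_eq)
    qed
    then show ?thesis by (auto simp: R.pull_def)
  qed
  then have "tensor_map ` E_sub n \<subseteq> vir_generated T ?G"
    unfolding vir_generated_def hull_def by blast
  ultimately show ?thesis by (simp add: W_sub_def)
qed

lemma submodule_eq_zero_iff:
  assumes "vir_submodule H T"
  shows "H = {\<zero>\<^bsub>T\<^esub>} \<longleftrightarrow> R.pull H = E_kernel"
proof
  show "R.pull H = E_kernel" if "H = {\<zero>\<^bsub>T\<^esub>}"
    using that tensor_map_zero_iff by (auto simp: R.pull_def)
  assume "R.pull H = E_kernel"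
  then have "H = tensor_map ` E_kernel" using image_pull[of H] assms vir_submodule_T_iff by metis
  also have "\<dots> = {\<zero>\<^bsub>T\<^esub>}" using tensor_map_zero_iff E_kernelD(1) by blast
  finally show "H = {\<zero>\<^bsub>T\<^esub>}" .
qed

lemma submodule_eq_carrier_iff: "H \<subseteq> carrier T \<Longrightarrow> H = carrier T \<longleftrightarrow> R.pull H = UNIV"
  using image_pull[of H] R.p_onto R.p_closed by (auto simp: R.pull_def)

lemma kernel_ne_UNIV: "E_kernel \<noteq> UNIV"
  using single_one_notin_kernel[of 1] by (auto simp: degenerate_def)

lemma carrier_ne_zero: "carrier T \<noteq> {\<zero>\<^bsub>T\<^esub>}"
  using tensor_map_zero_iff R.p_closed kernel_ne_UNIV by blast

lemma vir_module_T: "vir_module T"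
  by (rule R.vir_module_if[OF E_act_bracket E_act_central])

lemma vir_simple_T_iff:
  assumes Q: "radical_generators c h Q1 Q2"
  shows "vir_simple T \<longleftrightarrow> \<not> (\<exists>n. zero_index Q1 Q2 n)"
proof -
  have "(\<forall>H. vir_submodule H T \<longrightarrow> H = {\<zero>\<^bsub>T\<^esub>} \<or> H = carrier T) \<longleftrightarrow>
     (\<forall>N. E_stable \<alpha> \<beta> N \<and> E_kernel \<subseteq> N \<longrightarrow> N = E_kernel \<or> N = UNIV)"
  proof (intro iffI allI impI)
    fix N assume *: "\<forall>H. vir_submodule H T \<longrightarrow> H = {\<zero>\<^bsub>T\<^esub>} \<or> H = carrier T" and "E_stable \<alpha> \<beta> N \<and> E_kernel \<subseteq> N"
    then have N: "E_stable \<alpha> \<beta> N" "E_kernel \<subseteq> N" by blast+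
    have sub: "vir_submodule (tensor_map ` N) T" by (rule vir_submodule_image[OF N])
    then have "tensor_map ` N = {\<zero>\<^bsub>T\<^esub>} \<or> tensor_map ` N = carrier T" using * by blast
    then show "N = E_kernel \<or> N = UNIV"
      using submodule_eq_zero_iff[OF sub] submodule_eq_carrier_iff[of "tensor_map ` N"] pull_stable_image[OF N]
        sub vir_submodule_T_iff by simp
  next
    fix H assume *: "\<forall>N. E_stable \<alpha> \<beta> N \<and> E_kernel \<subseteq> N \<longrightarrow> N = E_kernel \<or> N = UNIV" and H: "vir_submodule H T"
    then have "E_stable \<alpha> \<beta> (R.pull H)" "H \<subseteq> carrier T" unfolding vir_submodule_T_iff by blast+
    with * kernel_subset_pull[OF H] have "R.pull H = E_kernel \<or> R.pull H = UNIV" by blast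
    then show "H = {\<zero>\<^bsub>T\<^esub>} \<or> H = carrier T"
      using submodule_eq_zero_iff[OF H] submodule_eq_carrier_iff[OF \<open>H \<subseteq> carrier T\<close>] by blast
  qed
  then show ?thesis
    unfolding vir_simple_def using E_simple_iff[OF Q] vir_module_T carrier_ne_zero by blast
qed

lemma vir_submodule_restrict_iff:
  assumes W: "vir_submodule W T"
  shows "vir_submodule H (T\<lparr>carrier := W\<rparr>) \<longleftrightarrow> vir_submodule H T \<and> H \<subseteq> W"
proof -
  interpret RW: rep_image E_scale act_E "R.pull W" tensor_map "T\<lparr>carrier := W\<rparr>"
    by (rule R.rep_image_restrict[OF W])
  have pull: "RW.pull H = R.pull H" if "H \<subseteq> W"
  proof -
    have RW: "x \<in> RW.pull H \<longleftrightarrow> x \<in> R.pull W \<and> tensor_map x \<in> H" for x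
      by (simp only: RW.pull_def mem_Collect_eq)
    have R: "x \<in> R.pull K \<longleftrightarrow> tensor_map x \<in> K" for x K by (simp add: R.pull_def)
    show ?thesis
    proof (rule Set.set_eqI)
      show "x \<in> RW.pull H \<longleftrightarrow> x \<in> R.pull H" for x
        unfolding RW R using subsetD[OF that, of "tensor_map x"] by argo
    qed
  qed
  have WT: "W \<subseteq> carrier T" using W vir_submodule_T_iff by blast
  show ?thesis
  proof (cases "H \<subseteq> W")
    case True
    then have "H \<subseteq> carrier T" using WT by blast
    with True show ?thesis
      unfolding RW.vir_submodule_iff R.vir_submodule_iff pull[OF True] by simp
  next
    case False
    then show ?thesis unfolding RW.vir_submodule_iff by simp
  qed
qed

lemma vir_simple_restrict_iff:
  assumes W: "vir_submodule W T"
  shows "vir_simple (T\<lparr>carrier := W\<rparr>) \<longleftrightarrow> W \<noteq> {\<zero>\<^bsub>T\<^esub>} \<and>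
     (\<forall>H. vir_submodule H T \<and> H \<subseteq> W \<longrightarrow> H = {\<zero>\<^bsub>T\<^esub>} \<or> H = W)"
proof -
  interpret RW: rep_image E_scale act_E "R.pull W" tensor_map "T\<lparr>carrier := W\<rparr>"
    by (rule R.rep_image_restrict[OF W])
  have "vir_module (T\<lparr>carrier := W\<rparr>)"
    by (rule RW.vir_module_if[OF E_act_bracket E_act_central])
  then show ?thesis
    unfolding vir_simple_def vir_submodule_restrict_iff[OF W] by simp
qed

lemma W_sub_submodule: "vir_submodule (W_sub c h \<alpha> \<beta> n) T"
  unfolding W_sub_eq by (rule vir_submodule_image[OF E_stable_sub E_kernel_subset_sub])

lemma pull_W_sub: "R.pull (W_sub c h \<alpha> \<beta> n) = E_sub n"
  unfolding W_sub_eq by (rule pull_stable_image[OF E_stable_sub E_kernel_subset_sub])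

lemma W_sub_ne_zero: "W_sub c h \<alpha> \<beta> n \<noteq> {\<zero>\<^bsub>T\<^esub>}"
  using submodule_eq_zero_iff[OF W_sub_submodule, of n] pull_W_sub E_sub_ne_kernel by simp

lemma W_sub_minimal:
  assumes Q: "radical_generators c h Q1 Q2" and max: "\<And>m. zero_index Q1 Q2 m \<Longrightarrow> m \<le> n"
    and H: "vir_submodule H T" "H \<noteq> {\<zero>\<^bsub>T\<^esub>}"
  shows "W_sub c h \<alpha> \<beta> n \<subseteq> H"
proof -
  have "R.pull H \<noteq> E_kernel" using submodule_eq_zero_iff[OF H(1)] H(2) by blast
  moreover have "E_stable \<alpha> \<beta> (R.pull H)" using H(1) vir_submodule_T_iff by blast
  ultimately have "E_sub n \<subseteq> R.pull H"
    by (intro E_sub_minimal[OF Q max] kernel_subset_pull[OF H(1)])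
  then show ?thesis unfolding W_sub_eq by (auto simp: R.pull_def)
qed

text \<open>A finite spanning set has representatives with finitely many indices. Requiring the
  coefficient at one further index i to lie in L defines a subspace that contains the spanning set,
  but for i large enough misses some vector of the same weight space.\<close>

lemma weight_space_infinite:
  assumes Q: "radical_generators c h Q1 Q2" and n: "zero_index Q1 Q2 n"
    and E: "weight_space (T\<lparr>carrier := W_sub c h \<alpha> \<beta> n\<rparr>) \<mu> \<noteq> {\<zero>\<^bsub>T\<^esub>}"
  shows "\<not> finite_dim T (weight_space (T\<lparr>carrier := W_sub c h \<alpha> \<beta> n\<rparr>) \<mu>)"
proof
  let ?E = "weight_space (T\<lparr>carrier := W_sub c h \<alpha> \<beta> n\<rparr>) \<mu>"
  assume "finite_dim T ?E"
  then obtain B where B: "finite B" "B \<subseteq> ?E" "lin_span T B = ?E" by (auto simp: finite_dim_def)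
  have mem_E: "tensor_map f \<in> ?E \<longleftrightarrow> f \<in> E_sub n \<and> act_E (Dgen 0) f - E_scale \<mu> f \<in> E_kernel" for f
  proof -
    have "tensor_map f \<in> W_sub c h \<alpha> \<beta> n \<longleftrightarrow> f \<in> E_sub n"
      using pull_W_sub[of n] by (auto simp: R.pull_def)
    moreover have "act T (Dgen 0) (tensor_map f) = \<mu> \<odot>\<^bsub>T\<^esub> tensor_map f \<longleftrightarrow>
        act_E (Dgen 0) f - E_scale \<mu> f \<in> E_kernel"
      using R.p_eq_iff[of "act_E (Dgen 0) f" "E_scale \<mu> f"] tensor_map_zero_iff
      by (simp add: R.p_act R.p_scale)
    ultimately show ?thesis by (simp add: weight_space_def)
  qed
  have E_T: "?E \<subseteq> carrier T"
    using W_sub_submodule[of n] vir_submodule_T_iff by (auto simp: weight_space_def)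
  have "0 \<in> E_sub n" by (rule E_stableD(1)[OF E_stable_sub])
  moreover have "act_E (Dgen 0) 0 - E_scale \<mu> 0 \<in> E_kernel" using E_kernelD(1) by (simp add: E_act)
  ultimately have "\<zero>\<^bsub>T\<^esub> \<in> ?E" using mem_E[of 0] R.p_zero by simp
  then obtain v where v: "v \<in> ?E" "v \<noteq> \<zero>\<^bsub>T\<^esub>" using E by blast
  then obtain f where f: "v = tensor_map f" using E_T R.carrierE by blast
  then have "f \<notin> E_kernel" "act_E (Dgen 0) f - E_scale \<mu> f \<in> E_kernel"
    using v mem_E tensor_map_zero_iff by blast+
  then obtain S where S: "\<And>i. i \<ge> S \<Longrightarrow> \<exists>g \<in> E_sub n. act_E (Dgen 0) g - E_scale \<mu> g \<in> E_kernel \<and>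
    \<not> degenerate i \<and> Poly_Mapping.lookup g i \<notin> L"
    using weight_vectors_unbounded[OF Q n] by meson
  have "\<forall>b\<in>B. \<exists>f. b = tensor_map f" using B(2) E_T R.carrierE by blast
  then obtain F where F: "\<And>b. b \<in> B \<Longrightarrow> b = tensor_map (F b)" by metis
  let ?K = "insert S (\<Union>b\<in>B. Poly_Mapping.keys (F b))"
  define i where "i = Max ?K + 1"
  have fin: "finite ?K" using B(1) by simp
  have "i > k" if "k \<in> ?K" for k using Max_ge[OF fin that] by (simp add: i_def)
  then have i: "i \<ge> S" "\<And>b. b \<in> B \<Longrightarrow> i \<notin> Poly_Mapping.keys (F b)" by fastforce+
  obtain g where g: "g \<in> E_sub n" "act_E (Dgen 0) g - E_scale \<mu> g \<in> E_kernel"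
    "\<not> degenerate i" "Poly_Mapping.lookup g i \<notin> L" using S[OF i(1)] by blast
  let ?N = "{f. Poly_Mapping.lookup f i \<in> L}"
  \<comment> \<open>Holds because i is not degenerate; it makes \<open>?N\<close> the full preimage
    of its image.\<close>
  have "E_kernel \<subseteq> ?N" using g(3) by (auto simp: E_kernel_def)
  then have pull: "R.pull (tensor_map ` ?N) = ?N"
    by (rule pull_image) (simp add: lookup_add verma_radicalD(2))
  have "submodule (tensor_map ` ?N) complex_ring T"
    unfolding R.submodule_iff pull using R.p_closed
    by (auto simp: lookup_add lookup_E_scale verma_radicalD(1,2,4))
  moreover have "B \<subseteq> tensor_map ` ?N"
  proof
    fix b assume b: "b \<in> B"
    have "Poly_Mapping.lookup (F b) i = 0" using i(2)[OF b] by (simp add: in_keys_iff)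
    then have "F b \<in> ?N" by (simp add: verma_radicalD(1))
    then show "b \<in> tensor_map ` ?N" using F[OF b] by blast
  qed
  ultimately have "?E \<subseteq> tensor_map ` ?N"
    using R.lin_span_properties(3)[of B "tensor_map ` ?N"] B E_T by blast
  then have "tensor_map g \<in> tensor_map ` ?N" using g mem_E by blast
  then have "g \<in> R.pull (tensor_map ` ?N)" by (simp add: R.pull_def)
  then show False using pull g(4) by blast
qed

end

theorem theorem1:
  fixes c h \<alpha> \<beta> :: complex and Q1 Q2 :: Uvir
  assumes "0 \<le> Re \<alpha>" and "Re \<alpha> < 1" and "\<beta> \<noteq> 1"
    and "max_generators c h Q1 Q2"
  shows "(vir_simple (hw_tensor c h \<alpha> \<beta>) \<longleftrightarrow> \<not> (\<exists>n. n \<in> phi_zeros \<alpha> \<beta> Q1 Q2)) \<and>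
    (\<forall>n. n \<in> phi_zeros \<alpha> \<beta> Q1 Q2 \<and> (\<forall>m \<in> phi_zeros \<alpha> \<beta> Q1 Q2. m \<le> n) \<longrightarrow>
      vir_submodule (W_sub c h \<alpha> \<beta> n) (hw_tensor c h \<alpha> \<beta>) \<and>
      vir_simple ((hw_tensor c h \<alpha> \<beta>)\<lparr>carrier := W_sub c h \<alpha> \<beta> n\<rparr>) \<and>
      (\<forall>H. vir_submodule H (hw_tensor c h \<alpha> \<beta>) \<and>
           vir_simple ((hw_tensor c h \<alpha> \<beta>)\<lparr>carrier := H\<rparr>) \<longrightarrow> H = W_sub c h \<alpha> \<beta> n) \<and>
      (\<forall>\<mu>. let E = weight_space ((hw_tensor c h \<alpha> \<beta>)\<lparr>carrier := W_sub c h \<alpha> \<beta> n\<rparr>) \<mu> in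
        E \<noteq> {\<zero>\<^bsub>hw_tensor c h \<alpha> \<beta>\<^esub>} \<longrightarrow> \<not> finite_dim (hw_tensor c h \<alpha> \<beta>) E))"
proof -
  interpret hw_interm c h \<alpha> \<beta> using assms(1-3) by unfold_locales
  have Q: "radical_generators c h Q1 Q2" by (rule max_generators_radical[OF assms(4)])
  have zeros: "n \<in> phi_zeros \<alpha> \<beta> Q1 Q2 \<longleftrightarrow> zero_index Q1 Q2 n" for n
    unfolding phi_zeros_def zero_index_def degenerate_def by blast
  show ?thesis
    unfolding Let_def
  proof (intro conjI allI impI; (elim conjE)?)
    show "vir_simple T \<longleftrightarrow> \<not> (\<exists>n. n \<in> phi_zeros \<alpha> \<beta> Q1 Q2)"
      unfolding zeros by (rule vir_simple_T_iff[OF Q])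
    fix n assume n: "n \<in> phi_zeros \<alpha> \<beta> Q1 Q2" and max: "\<forall>m \<in> phi_zeros \<alpha> \<beta> Q1 Q2. m \<le> n"
    let ?W = "W_sub c h \<alpha> \<beta> n"
    have minimal: "?W \<subseteq> H" if "vir_submodule H T" "H \<noteq> {\<zero>\<^bsub>T\<^esub>}" for H
      by (rule W_sub_minimal[OF Q _ that]) (use max zeros in blast)
    show "vir_submodule ?W T" by (rule W_sub_submodule)
    show "vir_simple (T\<lparr>carrier := ?W\<rparr>)"
      unfolding vir_simple_restrict_iff[OF W_sub_submodule] using W_sub_ne_zero minimal by blast
    show "H = ?W" if H: "vir_submodule H T" "vir_simple (T\<lparr>carrier := H\<rparr>)" for H
    proof -
      have *: "H \<noteq> {\<zero>\<^bsub>T\<^esub>}" "\<And>K. vir_submodule K T \<Longrightarrow> K \<subseteq> H \<Longrightarrow> K = {\<zero>\<^bsub>T\<^esub>} \<or> K = H"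
        using H(2) unfolding vir_simple_restrict_iff[OF H(1)] by blast+
      \<comment> \<open>W^(n) is nonzero and lies in every nonzero submodule; the simple H contains
        it and so equals it.\<close>
      then show ?thesis using *(2)[OF W_sub_submodule minimal[OF H(1) *(1)]] W_sub_ne_zero by blast
    qed
    show "\<not> finite_dim T (weight_space (T\<lparr>carrier := ?W\<rparr>) \<mu>)"
      if "weight_space (T\<lparr>carrier := ?W\<rparr>) \<mu> \<noteq> {\<zero>\<^bsub>T\<^esub>}" for \<mu>
      using weight_space_infinite[OF Q _ that] n zeros by blast
  qed
qed

end
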